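(* Let $(M,\theta)$ be a Sasakian manifold and $y,z\in M$. If $\gamma\in\Gamma$ is a lengthy geodesic of the Tanaka-Webster connection $\nabla$ of $(M,\theta)$, with $r=|\dot\gamma(t)|>0$, and $X,Y\in T_\gamma(\Gamma)$, then $$I(X,Y)=\frac1r\int_a^b\Big\{g_\theta(\nabla_{\dot\gamma}X^\bot,\nabla_{\dot\gamma}Y^\bot)-g_\theta(R(X^\bot,\dot\gamma)\dot\gamma,Y^\bot)-2\Omega(X^\bot,\dot\gamma)\,\theta(\nabla_{\dot\gamma}Y^\bot)-2\big[\theta(\nabla_{\dot\gamma}X^\bot)-2\Omega(X^\bot,\dot\gamma)\big]\Omega(Y^\bot,\dot\gamma)\Big\}\,dt,$$ where $X^\bot=X-(1/r^2)\,g_\theta(X,\dot\gamma)\,\dot\gamma$ (and similarly $Y^\bot$).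
   Context: Setting. $M$ is an orientable $C^\infty$ manifold of dimension $2n+1$ with a CR structure $T_{1,0}(M)\subset T(M)\otimes\mathbb C$ (a complex subbundle of complex rank $n$, with $T_{1,0}(M)\cap\overline{T_{1,0}(M)}=(0)$, closed under Lie brackets). $H(M)=\mathrm{Re}\{T_{1,0}(M)\oplus\overline{T_{1,0}(M)}\}$ is the Levi distribution, with complex structure $J(Z+\overline Z)=i(Z-\overline Z)$, $Z\in T_{1,0}(M)$. $\theta$ is a nowhere zero real $1$-form with $\mathrm{Ker}(\theta)=H(M)$; convention: $d\theta(X,Y)=\frac12\{X(\theta(Y))-Y(\theta(X))-\theta([X,Y])\}$. $G_\theta(X,Y)=(d\theta)(X,JY)$ on $H(M)$, assumed positive definite (strict pseudoconvexity). $T$ is the vector field with $\theta(T)=1$, $T\rfloor d\theta=0$; set $JT=0$. The Webster metric is the Riemannian metric $g_\theta$ with $g_\theta=G_\theta$ on $H(M)$, $g_\theta(X,T)=0$ for $X\in H(M)$, $g_\theta(T,T)=1$; $\Omega(X,Y)=g_\theta(X,JY)$. The Tanaka-Webster connection $\nabla$ is the unique linear connection such that $H(M)$ is parallel, $\nabla g_\theta=0$, $\nabla J=0$, and its torsion $T_\nabla$ satisfies $T_\nabla(Z,W)=0$, $T_\nabla(Z,\overline W)=2(d\theta)(Z,\overline W)T$ for $Z,W\in T_{1,0}(M)$, and $\tau\circ J+J\circ\tau=0$, where $\tau(X)=T_\nabla(T,X)$. $R$ is the curvature of $\nabla$, $R(X,Y)Z=\nabla_X\nabla_YZ-\nabla_Y\nabla_XZ-\nabla_{[X,Y]}Z$.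 $(M,\theta)$ is a Sasakian manifold if moreover $\tau=0$. A curve is lengthy if its tangent vectors lie in $H(M)$. $\Gamma$ is the set of all piecewise differentiable curves $\gamma:[a,b]\to M$ parametrized proportionally to arc length (w.r.t. $g_\theta$) with $\gamma(a)=y$, $\gamma(b)=z$. $T_\gamma(\Gamma)$ is the space of all piecewise differentiable vector fields $X$ along $\gamma$ vanishing at the endpoints $\gamma(a)$, $\gamma(b)$. For $X\in T_\gamma(\Gamma)$ one takes a family $\gamma^s:[a,b]\to M$, $|s|<\epsilon$, such that $\gamma^s\in\Gamma$, $\gamma^0=\gamma$, there is a partition $a=t_0<\cdots<t_k=b$ with $(t,s)\mapsto\gamma^s(t)$ differentiable on each $[t_j,t_{j+1}]\times(-\epsilon,\epsilon)$, and for each $t$ the curve $\sigma_t(s)=\gamma^s(t)$ satisfies $\dot\sigma_t(0)=X_{\gamma(t)}$. For $\gamma\in\Gamma$ a geodesic, the index form is $I(X,X)=\frac{d^2}{ds^2}\{L(\gamma^s)\}_{s=0}$, where $L$ is the Riemannian length w.r.t. $g_\theta$, and $I(X,Y)$ is defined by polarization, $I(X,Y)=\frac12\{I(X+Y,X+Y)-I(X,X)-I(Y,Y)\}$.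
   Formalization: The varied curves in the definition of I(X,X) are piecewise smooth with fixed endpoints and need not be parametrized proportionally to arc length; with that requirement no family exists, and I(X,X) is undefined, for X not orthogonal to the velocity of the geodesic. *)

theory Defs
  imports "HOL-Analysis.Analysis" "HOL-Library.Function_Algebras"
begin

text \<open>Pointwise real vector space structure on functions; tangent vectors below are functions on
  the set of charts.\<close>

instantiation "fun" :: (type, real_vector) real_vector
begin

definition scaleR_fun :: "real \<Rightarrow> ('a \<Rightarrow> 'b) \<Rightarrow> 'a \<Rightarrow> 'b"
  where "scaleR_fun r f = (\<lambda>x. r *\<^sub>R f x)"

instance
  by standard (auto simp: scaleR_fun_def fun_eq_iff plus_fun_def algebra_simps)

end


subsection \<open>Smoothness\<close>

text \<open>Only used for open \<open>S\<close>.\<close>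

primrec Ck_on :: "nat \<Rightarrow> 'a::real_normed_vector set \<Rightarrow> ('a \<Rightarrow> 'b::real_normed_vector) \<Rightarrow> bool"
  where
    "Ck_on 0 S f \<longleftrightarrow> continuous_on S f"
  | "Ck_on (Suc k) S f \<longleftrightarrow>
      (\<forall>x\<in>S. f differentiable (at x)) \<and> (\<forall>v. Ck_on k S (\<lambda>x. frechet_derivative f (at x) v))"

definition smooth_on :: "'a::real_normed_vector set \<Rightarrow> ('a \<Rightarrow> 'b::real_normed_vector) \<Rightarrow> bool"
  where "smooth_on S f \<longleftrightarrow> (\<forall>k. Ck_on k S f)"


subsection \<open>Manifolds\<close>

text \<open>The manifold is the whole type \<open>'p\<close>; a chart is a domain together with a coordinate map.\<close>

type_synonym ('p, 'm) chart = "'p set \<times> ('p \<Rightarrow> real^'m)"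

definition chart_inv :: "('p, 'm::finite) chart \<Rightarrow> real^'m \<Rightarrow> 'p"
  where "chart_inv c = inv_into (fst c) (snd c)"

definition transition :: "('p, 'm::finite) chart \<Rightarrow> ('p, 'm) chart \<Rightarrow> real^'m \<Rightarrow> real^'m"
  where "transition c c' = snd c' \<circ> chart_inv c"

definition is_chart :: "('p::topological_space, 'm::finite) chart \<Rightarrow> bool"
  where "is_chart c \<longleftrightarrow> open (fst c) \<and> open (snd c ` fst c) \<and>
    homeomorphism (fst c) (snd c ` fst c) (snd c) (chart_inv c)"

definition smooth_atlas :: "('p::topological_space, 'm::finite) chart set \<Rightarrow> bool"
  where "smooth_atlas A \<longleftrightarrow> (\<forall>c\<in>A. is_chart c) \<and> (\<Union>c\<in>A. fst c) = UNIV \<and>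
    (\<forall>c\<in>A. \<forall>c'\<in>A. smooth_on (snd c ` (fst c \<inter> fst c')) (transition c c'))"

definition orientable :: "('p::topological_space, 'm::finite) chart set \<Rightarrow> bool"
  where "orientable A \<longleftrightarrow> (\<exists>B. smooth_atlas B \<and> smooth_atlas (A \<union> B) \<and>
    (\<forall>c\<in>B. \<forall>c'\<in>B. \<forall>x\<in>snd c ` (fst c \<inter> fst c').
      det (matrix (frechet_derivative (transition c c') (at x))) > 0))"

definition chart_at :: "('p, 'm) chart set \<Rightarrow> 'p \<Rightarrow> ('p, 'm) chart"
  where "chart_at A p = (SOME c. c \<in> A \<and> p \<in> fst c)"

definition smooth_fun :: "('p, 'm::finite) chart set \<Rightarrow> 'p set \<Rightarrow> ('p \<Rightarrow> real) \<Rightarrow> bool"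
  where "smooth_fun A U f \<longleftrightarrow> (\<forall>c\<in>A. smooth_on (snd c ` (U \<inter> fst c)) (f \<circ> chart_inv c))"

text \<open>Smooth maps from an arbitrary subset \<open>S\<close> of a Euclidean space into the manifold: the coordinate
  expressions locally extend to smooth maps on open sets.\<close>

definition smooth_map ::
    "('p, 'm::finite) chart set \<Rightarrow> 'a::real_normed_vector set \<Rightarrow> ('a \<Rightarrow> 'p) \<Rightarrow> bool"
  where "smooth_map A S f \<longleftrightarrow> (\<forall>x\<in>S. \<forall>c\<in>A. f x \<in> fst c \<longrightarrow>
    (\<exists>W h. open W \<and> x \<in> W \<and> f ` (W \<inter> S) \<subseteq> fst c \<and> smooth_on W h \<and>
      (\<forall>w\<in>W \<inter> S. h w = snd c (f w))))"


subsection \<open>Tangent vectors and vector fields\<close>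

text \<open>A tangent vector at \<open>p\<close> is the family of its components in all charts around \<open>p\<close>, related by
  the Jacobians of the transition maps. Charts that are not around \<open>p\<close> carry the dummy value 0.\<close>

type_synonym ('p, 'm) tvec = "('p, 'm) chart \<Rightarrow> real^'m"

definition tangent_space :: "('p, 'm::finite) chart set \<Rightarrow> 'p \<Rightarrow> ('p, 'm) tvec set"
  where "tangent_space A p = {v.
    (\<forall>c\<in>A. \<forall>c'\<in>A. p \<in> fst c \<and> p \<in> fst c' \<longrightarrow>
      v c' = frechet_derivative (transition c c') (at (snd c p)) (v c)) \<and>
    (\<forall>c. \<not> (c \<in> A \<and> p \<in> fst c) \<longrightarrow> v c = 0)}"

text \<open>The tangent vector at \<open>p\<close> with components \<open>u\<close> in the chart \<open>c\<close>; for fixed \<open>u\<close>, as a function of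
  \<open>p\<close>, it is the constant coefficient combination \<open>\<Sum>i. u $ i * \<partial>/\<partial>x\<^sub>i\<close> of the coordinate fields.\<close>

definition coord_vec ::
    "('p, 'm::finite) chart set \<Rightarrow> ('p, 'm) chart \<Rightarrow> real^'m \<Rightarrow> 'p \<Rightarrow> ('p, 'm) tvec"
  where "coord_vec A c u p = (\<lambda>c'. if c' \<in> A \<and> p \<in> fst c'
    then frechet_derivative (transition c c') (at (snd c p)) u else 0)"

text \<open>An extension of \<open>v\<close>, tangent at \<open>p\<close>, to a smooth vector field near \<open>p\<close>. It is used to evaluate
  pointwise those expressions in vector fields which are tensorial.\<close>

definition ext_field :: "('p, 'm::finite) chart set \<Rightarrow> 'p \<Rightarrow> ('p, 'm) tvec \<Rightarrow> 'p \<Rightarrow> ('p, 'm) tvec"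
  where "ext_field A p v = coord_vec A (chart_at A p) (v (chart_at A p))"

definition smooth_comps ::
    "('p, 'm::finite) chart set \<Rightarrow> 'p set \<Rightarrow> ('p \<Rightarrow> ('p, 'm) chart \<Rightarrow> 'k::real_normed_vector^'m) \<Rightarrow> bool"
  where "smooth_comps A U X \<longleftrightarrow>
    (\<forall>c\<in>A. smooth_on (snd c ` (U \<inter> fst c)) (\<lambda>x. X (chart_inv c x) c))"

definition vector_field ::
    "('p::topological_space, 'm::finite) chart set \<Rightarrow> 'p set \<Rightarrow> ('p \<Rightarrow> ('p, 'm) tvec) \<Rightarrow> bool"
  where "vector_field A U X \<longleftrightarrow> open U \<and> (\<forall>p\<in>U. X p \<in> tangent_space A p) \<and> smooth_comps A U X"

text \<open>The derivative \<open>v(f)\<close> of a function \<open>f\<close> along \<open>v\<close>, tangent at \<open>p\<close>.\<close>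

definition dir_deriv :: "('p, 'm::finite) chart set \<Rightarrow> 'p \<Rightarrow> ('p, 'm) tvec \<Rightarrow> ('p \<Rightarrow> real) \<Rightarrow> real"
  where "dir_deriv A p v f = (let c = chart_at A p in
    frechet_derivative (f \<circ> chart_inv c) (at (snd c p)) (v c))"

definition bracket ::
    "('p, 'm::finite) chart set \<Rightarrow> ('p \<Rightarrow> ('p, 'm) tvec) \<Rightarrow> ('p \<Rightarrow> ('p, 'm) tvec) \<Rightarrow> 'p \<Rightarrow> ('p, 'm) tvec"
  where "bracket A X Y p = (\<lambda>c. if c \<in> A \<and> p \<in> fst c
    then frechet_derivative (\<lambda>x. Y (chart_inv c x) c) (at (snd c p)) (X p c) -
         frechet_derivative (\<lambda>x. X (chart_inv c x) c) (at (snd c p)) (Y p c)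
    else 0)"


subsection \<open>The complexified tangent bundle\<close>

type_synonym ('p, 'm) ctvec = "('p, 'm) chart \<Rightarrow> complex^'m"

definition cplx :: "('p, 'm::finite) tvec \<Rightarrow> ('p, 'm) ctvec"
  where "cplx v = (\<lambda>c. \<chi> i. complex_of_real (v c $ i))"

definition re_part :: "('p, 'm::finite) ctvec \<Rightarrow> ('p, 'm) tvec"
  where "re_part Z = (\<lambda>c. \<chi> i. Re (Z c $ i))"

definition im_part :: "('p, 'm::finite) ctvec \<Rightarrow> ('p, 'm) tvec"
  where "im_part Z = (\<lambda>c. \<chi> i. Im (Z c $ i))"

definition conj_vec :: "('p, 'm::finite) ctvec \<Rightarrow> ('p, 'm) ctvec"
  where "conj_vec Z = (\<lambda>c. \<chi> i. cnj (Z c $ i))"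

definition cscale :: "complex \<Rightarrow> ('p, 'm::finite) ctvec \<Rightarrow> ('p, 'm) ctvec"
  where "cscale a Z = (\<lambda>c. a *s Z c)"

definition ctangent_space :: "('p, 'm::finite) chart set \<Rightarrow> 'p \<Rightarrow> ('p, 'm) ctvec set"
  where "ctangent_space A p =
    {Z. re_part Z \<in> tangent_space A p \<and> im_part Z \<in> tangent_space A p}"

definition cvector_field ::
    "('p::topological_space, 'm::finite) chart set \<Rightarrow> 'p set \<Rightarrow> ('p \<Rightarrow> ('p, 'm) ctvec) \<Rightarrow> bool"
  where "cvector_field A U Z \<longleftrightarrow> open U \<and> (\<forall>p\<in>U. Z p \<in> ctangent_space A p) \<and> smooth_comps A U Z"

text \<open>Complex bilinear extensions of real bilinear operations.\<close>

definition cbracket ::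
    "('p, 'm::finite) chart set \<Rightarrow> ('p \<Rightarrow> ('p, 'm) ctvec) \<Rightarrow> ('p \<Rightarrow> ('p, 'm) ctvec) \<Rightarrow> 'p \<Rightarrow> ('p, 'm) ctvec"
  where "cbracket A Z W p =
    (let X = (\<lambda>q. re_part (Z q)); X' = (\<lambda>q. im_part (Z q));
         Y = (\<lambda>q. re_part (W q)); Y' = (\<lambda>q. im_part (W q))
     in cplx (bracket A X Y p - bracket A X' Y' p) +
        cscale \<i> (cplx (bracket A X Y' p + bracket A X' Y p)))"

definition cext_scalar ::
    "(('p, 'm::finite) tvec \<Rightarrow> ('p, 'm) tvec \<Rightarrow> real) \<Rightarrow> ('p, 'm) ctvec \<Rightarrow> ('p, 'm) ctvec \<Rightarrow> complex"
  where "cext_scalar B Z W = Complex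
    (B (re_part Z) (re_part W) - B (im_part Z) (im_part W))
    (B (re_part Z) (im_part W) + B (im_part Z) (re_part W))"

definition cext_vec ::
    "(('p, 'm::finite) tvec \<Rightarrow> ('p, 'm) tvec \<Rightarrow> ('p, 'm) tvec) \<Rightarrow>
      ('p, 'm) ctvec \<Rightarrow> ('p, 'm) ctvec \<Rightarrow> ('p, 'm) ctvec"
  where "cext_vec B Z W =
    cplx (B (re_part Z) (re_part W) - B (im_part Z) (im_part W)) +
    cscale \<i> (cplx (B (re_part Z) (im_part W) + B (im_part Z) (re_part W)))"


subsection \<open>CR structures and pseudohermitian structures\<close>

text \<open>\<open>T10 p\<close> is the fibre over \<open>p\<close>; local smooth frames \<open>F 0, \<dots>, F (n - 1)\<close> make \<open>T10\<close> a complex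
  subbundle of rank \<open>n\<close>.\<close>

definition cr_structure ::
    "('p::topological_space, 'm::finite) chart set \<Rightarrow> nat \<Rightarrow> ('p \<Rightarrow> ('p, 'm) ctvec set) \<Rightarrow> bool"
  where "cr_structure A n T10 \<longleftrightarrow>
    (\<forall>p. \<exists>U F. p \<in> U \<and> (\<forall>i<n. cvector_field A U (F i)) \<and>
      (\<forall>q\<in>U. T10 q = {\<Sum>i<n. cscale (a i) (F i q) | a. True} \<and>
        (\<forall>a. (\<Sum>i<n. cscale (a i) (F i q)) = 0 \<longrightarrow> (\<forall>i<n. a i = 0)))) \<and>
    (\<forall>p. T10 p \<inter> conj_vec ` T10 p = {0}) \<and>
    (\<forall>U Z W. cvector_field A U Z \<and> cvector_field A U W \<and> (\<forall>q\<in>U. Z q \<in> T10 q \<and> W q \<in> T10 q) \<longrightarrow>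
      (\<forall>q\<in>U. cbracket A Z W q \<in> T10 q))"

definition levi :: "('p \<Rightarrow> ('p, 'm::finite) ctvec set) \<Rightarrow> 'p \<Rightarrow> ('p, 'm) tvec set"
  where "levi T10 p = {v. \<exists>Z\<in>T10 p. \<exists>W\<in>T10 p. cplx v = Z + conj_vec W}"

definition levi_J :: "('p \<Rightarrow> ('p, 'm::finite) ctvec set) \<Rightarrow> 'p \<Rightarrow> ('p, 'm) tvec \<Rightarrow> ('p, 'm) tvec"
  where "levi_J T10 p v = (THE w. \<exists>Z\<in>T10 p.
    cplx v = Z + conj_vec Z \<and> cplx w = cscale \<i> (Z - conj_vec Z))"

definition one_form ::
    "('p::topological_space, 'm::finite) chart set \<Rightarrow> ('p \<Rightarrow> ('p, 'm) tvec \<Rightarrow> real) \<Rightarrow> bool"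
  where "one_form A \<theta> \<longleftrightarrow>
    (\<forall>p. \<forall>v\<in>tangent_space A p. \<forall>w\<in>tangent_space A p. \<theta> p (v + w) = \<theta> p v + \<theta> p w) \<and>
    (\<forall>p. \<forall>v\<in>tangent_space A p. \<forall>k. \<theta> p (k *\<^sub>R v) = k * \<theta> p v) \<and>
    (\<forall>U X. vector_field A U X \<longrightarrow> smooth_fun A U (\<lambda>p. \<theta> p (X p)))"

definition ext_deriv ::
    "('p, 'm::finite) chart set \<Rightarrow> ('p \<Rightarrow> ('p, 'm) tvec \<Rightarrow> real) \<Rightarrow>
      'p \<Rightarrow> ('p, 'm) tvec \<Rightarrow> ('p, 'm) tvec \<Rightarrow> real"
  where "ext_deriv A \<theta> p u v =
    (let X = ext_field A p u; Y = ext_field A p v in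
      (dir_deriv A p u (\<lambda>q. \<theta> q (Y q)) - dir_deriv A p v (\<lambda>q. \<theta> q (X q)) -
        \<theta> p (bracket A X Y p)) / 2)"

definition levi_form ::
    "('p, 'm::finite) chart set \<Rightarrow> ('p \<Rightarrow> ('p, 'm) ctvec set) \<Rightarrow> ('p \<Rightarrow> ('p, 'm) tvec \<Rightarrow> real) \<Rightarrow>
      'p \<Rightarrow> ('p, 'm) tvec \<Rightarrow> ('p, 'm) tvec \<Rightarrow> real"
  where "levi_form A T10 \<theta> p u v = ext_deriv A \<theta> p u (levi_J T10 p v)"

definition pseudohermitian ::
    "('p::topological_space, 'm::finite) chart set \<Rightarrow> ('p \<Rightarrow> ('p, 'm) ctvec set) \<Rightarrow>
      ('p \<Rightarrow> ('p, 'm) tvec \<Rightarrow> real) \<Rightarrow> bool"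
  where "pseudohermitian A T10 \<theta> \<longleftrightarrow> one_form A \<theta> \<and>
    (\<forall>p. \<exists>v\<in>tangent_space A p. \<theta> p v \<noteq> 0) \<and>
    (\<forall>p. {v \<in> tangent_space A p. \<theta> p v = 0} = levi T10 p)"

definition strictly_pseudoconvex ::
    "('p::topological_space, 'm::finite) chart set \<Rightarrow> ('p \<Rightarrow> ('p, 'm) ctvec set) \<Rightarrow>
      ('p \<Rightarrow> ('p, 'm) tvec \<Rightarrow> real) \<Rightarrow> bool"
  where "strictly_pseudoconvex A T10 \<theta> \<longleftrightarrow>
    (\<forall>p. \<forall>v\<in>levi T10 p. v \<noteq> 0 \<longrightarrow> levi_form A T10 \<theta> p v v > 0)"

definition reeb ::
    "('p, 'm::finite) chart set \<Rightarrow> ('p \<Rightarrow> ('p, 'm) tvec \<Rightarrow> real) \<Rightarrow> 'p \<Rightarrow> ('p, 'm) tvec"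
  where "reeb A \<theta> p = (THE v. v \<in> tangent_space A p \<and> \<theta> p v = 1 \<and>
    (\<forall>w\<in>tangent_space A p. ext_deriv A \<theta> p v w = 0))"

definition horiz ::
    "('p, 'm::finite) chart set \<Rightarrow> ('p \<Rightarrow> ('p, 'm) tvec \<Rightarrow> real) \<Rightarrow> 'p \<Rightarrow> ('p, 'm) tvec \<Rightarrow> ('p, 'm) tvec"
  where "horiz A \<theta> p v = v - \<theta> p v *\<^sub>R reeb A \<theta> p"

text \<open>\<open>J\<close> extended to the whole tangent space by \<open>J T = 0\<close>.\<close>

definition J_tensor ::
    "('p, 'm::finite) chart set \<Rightarrow> ('p \<Rightarrow> ('p, 'm) ctvec set) \<Rightarrow> ('p \<Rightarrow> ('p, 'm) tvec \<Rightarrow> real) \<Rightarrow>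
      'p \<Rightarrow> ('p, 'm) tvec \<Rightarrow> ('p, 'm) tvec"
  where "J_tensor A T10 \<theta> p v = levi_J T10 p (horiz A \<theta> p v)"

definition webster_metric ::
    "('p, 'm::finite) chart set \<Rightarrow> ('p \<Rightarrow> ('p, 'm) ctvec set) \<Rightarrow> ('p \<Rightarrow> ('p, 'm) tvec \<Rightarrow> real) \<Rightarrow>
      'p \<Rightarrow> ('p, 'm) tvec \<Rightarrow> ('p, 'm) tvec \<Rightarrow> real"
  where "webster_metric A T10 \<theta> p u v =
    levi_form A T10 \<theta> p (horiz A \<theta> p u) (horiz A \<theta> p v) + \<theta> p u * \<theta> p v"

definition Omega_form ::
    "('p, 'm::finite) chart set \<Rightarrow> ('p \<Rightarrow> ('p, 'm) ctvec set) \<Rightarrow> ('p \<Rightarrow> ('p, 'm) tvec \<Rightarrow> real) \<Rightarrow>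
      'p \<Rightarrow> ('p, 'm) tvec \<Rightarrow> ('p, 'm) tvec \<Rightarrow> real"
  where "Omega_form A T10 \<theta> p u v = webster_metric A T10 \<theta> p u (J_tensor A T10 \<theta> p v)"


subsection \<open>Linear connections\<close>

text \<open>\<open>nabla p v Y\<close> is the covariant derivative at \<open>p\<close>, in the direction \<open>v\<close>, of a smooth vector field
  \<open>Y\<close> defined on some neighbourhood of \<open>p\<close>; it only depends on the germ of \<open>Y\<close> at \<open>p\<close>.\<close>

type_synonym ('p, 'm) connection = "'p \<Rightarrow> ('p, 'm) tvec \<Rightarrow> ('p \<Rightarrow> ('p, 'm) tvec) \<Rightarrow> ('p, 'm) tvec"

definition linear_connection ::
    "('p::topological_space, 'm::finite) chart set \<Rightarrow> ('p, 'm) connection \<Rightarrow> bool"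
  where "linear_connection A nabla \<longleftrightarrow>
    (\<forall>U Y. vector_field A U Y \<longrightarrow> (\<forall>p\<in>U. \<forall>v\<in>tangent_space A p.
      nabla p v Y \<in> tangent_space A p \<and>
      (\<forall>w\<in>tangent_space A p. nabla p (v + w) Y = nabla p v Y + nabla p w Y) \<and>
      (\<forall>k. nabla p (k *\<^sub>R v) Y = k *\<^sub>R nabla p v Y) \<and>
      (\<forall>Y'. vector_field A U Y' \<longrightarrow> nabla p v (\<lambda>q. Y q + Y' q) = nabla p v Y + nabla p v Y') \<and>
      (\<forall>f. smooth_fun A U f \<longrightarrow>
        nabla p v (\<lambda>q. f q *\<^sub>R Y q) = dir_deriv A p v f *\<^sub>R Y p + f p *\<^sub>R nabla p v Y) \<and>
      (\<forall>Y'. (\<forall>q\<in>U. Y' q = Y q) \<longrightarrow> nabla p v Y' = nabla p v Y))) \<and>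
    (\<forall>U X Y. vector_field A U X \<and> vector_field A U Y \<longrightarrow>
      vector_field A U (\<lambda>q. nabla q (X q) Y))"

definition torsion ::
    "('p, 'm::finite) chart set \<Rightarrow> ('p, 'm) connection \<Rightarrow>
      'p \<Rightarrow> ('p, 'm) tvec \<Rightarrow> ('p, 'm) tvec \<Rightarrow> ('p, 'm) tvec"
  where "torsion A nabla p u v =
    (let X = ext_field A p u; Y = ext_field A p v in
      nabla p u Y - nabla p v X - bracket A X Y p)"

definition curvature ::
    "('p, 'm::finite) chart set \<Rightarrow> ('p, 'm) connection \<Rightarrow>
      'p \<Rightarrow> ('p, 'm) tvec \<Rightarrow> ('p, 'm) tvec \<Rightarrow> ('p, 'm) tvec \<Rightarrow> ('p, 'm) tvec"
  where "curvature A nabla p u v w =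
    (let X = ext_field A p u; Y = ext_field A p v; Z = ext_field A p w in
      nabla p u (\<lambda>q. nabla q (Y q) Z) - nabla p v (\<lambda>q. nabla q (X q) Z) -
        nabla p (bracket A X Y p) Z)"

definition pseudo_torsion ::
    "('p, 'm::finite) chart set \<Rightarrow> ('p \<Rightarrow> ('p, 'm) tvec \<Rightarrow> real) \<Rightarrow> ('p, 'm) connection \<Rightarrow>
      'p \<Rightarrow> ('p, 'm) tvec \<Rightarrow> ('p, 'm) tvec"
  where "pseudo_torsion A \<theta> nabla p v = torsion A nabla p (reeb A \<theta> p) v"

definition tanaka_webster ::
    "('p::topological_space, 'm::finite) chart set \<Rightarrow> ('p \<Rightarrow> ('p, 'm) ctvec set) \<Rightarrow>
      ('p \<Rightarrow> ('p, 'm) tvec \<Rightarrow> real) \<Rightarrow> ('p, 'm) connection \<Rightarrow> bool"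
  where "tanaka_webster A T10 \<theta> nabla \<longleftrightarrow>
    (let g = webster_metric A T10 \<theta>; J = J_tensor A T10 \<theta>; \<tau> = pseudo_torsion A \<theta> nabla in
      linear_connection A nabla \<and>
      (\<forall>U Y. vector_field A U Y \<and> (\<forall>q\<in>U. Y q \<in> levi T10 q) \<longrightarrow>
        (\<forall>p\<in>U. \<forall>v\<in>tangent_space A p. nabla p v Y \<in> levi T10 p)) \<and>
      (\<forall>U Y W. vector_field A U Y \<and> vector_field A U W \<longrightarrow>
        (\<forall>p\<in>U. \<forall>v\<in>tangent_space A p. dir_deriv A p v (\<lambda>q. g q (Y q) (W q)) =
          g p (nabla p v Y) (W p) + g p (Y p) (nabla p v W))) \<and>
      (\<forall>U Y. vector_field A U Y \<longrightarrow>
        (\<forall>p\<in>U. \<forall>v\<in>tangent_space A p. nabla p v (\<lambda>q. J q (Y q)) = J p (nabla p v Y))) \<and>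
      (\<forall>p. \<forall>Z\<in>T10 p. \<forall>W\<in>T10 p.
        cext_vec (torsion A nabla p) Z W = 0 \<and>
        cext_vec (torsion A nabla p) Z (conj_vec W) =
          cscale (2 * cext_scalar (ext_deriv A \<theta> p) Z (conj_vec W)) (cplx (reeb A \<theta> p))) \<and>
      (\<forall>p. \<forall>v\<in>tangent_space A p. \<tau> p (J p v) + J p (\<tau> p v) = 0))"

definition sasakian ::
    "('p::topological_space, 'm::finite) chart set \<Rightarrow> nat \<Rightarrow> ('p \<Rightarrow> ('p, 'm) ctvec set) \<Rightarrow>
      ('p \<Rightarrow> ('p, 'm) tvec \<Rightarrow> real) \<Rightarrow> ('p, 'm) connection \<Rightarrow> bool"
  where "sasakian A n T10 \<theta> nabla \<longleftrightarrow>
    CARD('m) = 2 * n + 1 \<and> smooth_atlas A \<and> orientable A \<and>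
    cr_structure A n T10 \<and> pseudohermitian A T10 \<theta> \<and> strictly_pseudoconvex A T10 \<theta> \<and>
    tanaka_webster A T10 \<theta> nabla \<and>
    (\<forall>p. \<forall>v\<in>tangent_space A p. pseudo_torsion A \<theta> nabla p v = 0)"


subsection \<open>Curves\<close>

definition curve_velocity ::
    "('p, 'm::finite) chart set \<Rightarrow> real set \<Rightarrow> (real \<Rightarrow> 'p) \<Rightarrow> real \<Rightarrow> ('p, 'm) tvec"
  where "curve_velocity A S \<sigma> t = (\<lambda>c. if c \<in> A \<and> \<sigma> t \<in> fst c
    then vector_derivative (\<lambda>s. snd c (\<sigma> s)) (at t within S) else 0)"

text \<open>The covariant derivative along \<open>\<gamma>\<close> of \<open>\<Sum>i. X\<^sub>i * \<partial>/\<partial>x\<^sub>i\<close>, that is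
  \<open>\<Sum>i. X\<^sub>i' * \<partial>/\<partial>x\<^sub>i + X\<^sub>i * nabla (\<partial>/\<partial>x\<^sub>i)\<close> in a chart around \<open>\<gamma> t\<close>.\<close>

definition cov_deriv ::
    "('p, 'm::finite) chart set \<Rightarrow> ('p, 'm) connection \<Rightarrow> real set \<Rightarrow>
      (real \<Rightarrow> 'p) \<Rightarrow> (real \<Rightarrow> ('p, 'm) tvec) \<Rightarrow> real \<Rightarrow> ('p, 'm) tvec"
  where "cov_deriv A nabla S \<gamma> X t = (let c = chart_at A (\<gamma> t) in
    coord_vec A c (vector_derivative (\<lambda>s. X s c) (at t within S)) (\<gamma> t) +
    nabla (\<gamma> t) (curve_velocity A S \<gamma> t) (coord_vec A c (X t c)))"

definition partition :: "real \<Rightarrow> real \<Rightarrow> nat \<Rightarrow> (nat \<Rightarrow> real) \<Rightarrow> bool"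
  where "partition a b k ts \<longleftrightarrow> ts 0 = a \<and> ts k = b \<and> (\<forall>j<k. ts j < ts (Suc j))"

definition piecewise_smooth_curve ::
    "('p, 'm::finite) chart set \<Rightarrow> real \<Rightarrow> real \<Rightarrow> (real \<Rightarrow> 'p) \<Rightarrow> bool"
  where "piecewise_smooth_curve A a b \<gamma> \<longleftrightarrow>
    (\<exists>k ts. partition a b k ts \<and> (\<forall>j<k. smooth_map A {ts j..ts (Suc j)} \<gamma>))"

definition curve_length ::
    "('p, 'm::finite) chart set \<Rightarrow> ('p \<Rightarrow> ('p, 'm) tvec \<Rightarrow> ('p, 'm) tvec \<Rightarrow> real) \<Rightarrow>
      real \<Rightarrow> real \<Rightarrow> (real \<Rightarrow> 'p) \<Rightarrow> real"
  where "curve_length A g a b \<gamma> = integral {a..b}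
    (\<lambda>t. sqrt (g (\<gamma> t) (curve_velocity A {a..b} \<gamma> t) (curve_velocity A {a..b} \<gamma> t)))"

definition Gamma_curves ::
    "('p, 'm::finite) chart set \<Rightarrow> ('p \<Rightarrow> ('p, 'm) tvec \<Rightarrow> ('p, 'm) tvec \<Rightarrow> real) \<Rightarrow>
      real \<Rightarrow> real \<Rightarrow> 'p \<Rightarrow> 'p \<Rightarrow> (real \<Rightarrow> 'p) set"
  where "Gamma_curves A g a b y z = {\<gamma>. piecewise_smooth_curve A a b \<gamma> \<and> \<gamma> a = y \<and> \<gamma> b = z \<and>
    (\<exists>k. \<forall>t\<in>{a..b}. curve_length A g a t \<gamma> = k * (t - a))}"

definition geodesic ::
    "('p, 'm::finite) chart set \<Rightarrow> ('p, 'm) connection \<Rightarrow> real \<Rightarrow> real \<Rightarrow> (real \<Rightarrow> 'p) \<Rightarrow> bool"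
  where "geodesic A nabla a b \<gamma> \<longleftrightarrow> smooth_map A {a..b} \<gamma> \<and>
    (\<forall>t\<in>{a..b}. cov_deriv A nabla {a..b} \<gamma> (curve_velocity A {a..b} \<gamma>) t = 0)"

definition lengthy ::
    "('p, 'm::finite) chart set \<Rightarrow> ('p \<Rightarrow> ('p, 'm) ctvec set) \<Rightarrow> real \<Rightarrow> real \<Rightarrow> (real \<Rightarrow> 'p) \<Rightarrow> bool"
  where "lengthy A T10 a b \<gamma> \<longleftrightarrow>
    (\<forall>t\<in>{a..b}. curve_velocity A {a..b} \<gamma> t \<in> levi T10 (\<gamma> t))"

definition smooth_field_along ::
    "('p, 'm::finite) chart set \<Rightarrow> real set \<Rightarrow> (real \<Rightarrow> 'p) \<Rightarrow> (real \<Rightarrow> ('p, 'm) tvec) \<Rightarrow> bool"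
  where "smooth_field_along A S \<gamma> X \<longleftrightarrow> (\<forall>t\<in>S. X t \<in> tangent_space A (\<gamma> t)) \<and>
    (\<forall>t\<in>S. \<forall>c\<in>A. \<gamma> t \<in> fst c \<longrightarrow>
      (\<exists>W h. open W \<and> t \<in> W \<and> \<gamma> ` (W \<inter> S) \<subseteq> fst c \<and> smooth_on W h \<and>
        (\<forall>w\<in>W \<inter> S. h w = X w c)))"

text \<open>The space of piecewise smooth fields along \<open>\<gamma>\<close> that vanish at the end points. The pieces are
  closed intervals, so such fields are continuous.\<close>

definition Gamma_tangent ::
    "('p, 'm::finite) chart set \<Rightarrow> real \<Rightarrow> real \<Rightarrow> (real \<Rightarrow> 'p) \<Rightarrow> (real \<Rightarrow> ('p, 'm) tvec) set"
  where "Gamma_tangent A a b \<gamma> = {X. X a = 0 \<and> X b = 0 \<and>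
    (\<exists>k ts. partition a b k ts \<and> (\<forall>j<k. smooth_field_along A {ts j..ts (Suc j)} \<gamma> X))}"

definition perp ::
    "('p, 'm::finite) chart set \<Rightarrow> ('p \<Rightarrow> ('p, 'm) tvec \<Rightarrow> ('p, 'm) tvec \<Rightarrow> real) \<Rightarrow>
      real \<Rightarrow> real \<Rightarrow> (real \<Rightarrow> 'p) \<Rightarrow> real \<Rightarrow> (real \<Rightarrow> ('p, 'm) tvec) \<Rightarrow> real \<Rightarrow> ('p, 'm) tvec"
  where "perp A g a b \<gamma> r X t =
    X t - (1 / r\<^sup>2 * g (\<gamma> t) (X t) (curve_velocity A {a..b} \<gamma> t)) *\<^sub>R curve_velocity A {a..b} \<gamma> t"


subsection \<open>The index form\<close>

text \<open>A variation of \<open>\<gamma>\<close> with fixed end points and variation field \<open>X\<close>. The neighbouring curves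
  \<open>V s\<close> are not required to be parametrized proportionally to arc length: for a geodesic \<open>\<gamma>\<close> the first
  variation formula would then force \<open>X\<close> to be orthogonal to \<open>\<gamma>\<close>, so that all other fields would have
  no variation. As length does not depend on the parametrization, this only enlarges the class of
  families over which the second variation is required to be the same.\<close>

definition variation ::
    "('p, 'm::finite) chart set \<Rightarrow> real \<Rightarrow> real \<Rightarrow> (real \<Rightarrow> 'p) \<Rightarrow> (real \<Rightarrow> ('p, 'm) tvec) \<Rightarrow>
      real \<Rightarrow> (real \<Rightarrow> real \<Rightarrow> 'p) \<Rightarrow> bool"
  where "variation A a b \<gamma> X \<epsilon> V \<longleftrightarrow> \<epsilon> > 0 \<and>
    (\<forall>t\<in>{a..b}. V 0 t = \<gamma> t) \<and>
    (\<forall>s\<in>{-\<epsilon><..<\<epsilon>}. V s a = \<gamma> a \<and> V s b = \<gamma> b) \<and>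
    (\<exists>k ts. partition a b k ts \<and>
      (\<forall>j<k. smooth_map A ({ts j..ts (Suc j)} \<times> {-\<epsilon><..<\<epsilon>}) (\<lambda>(t, s). V s t))) \<and>
    (\<forall>t\<in>{a..b}. curve_velocity A {-\<epsilon><..<\<epsilon>} (\<lambda>s. V s t) 0 = X t)"

definition has_second_deriv :: "(real \<Rightarrow> real) \<Rightarrow> real \<Rightarrow> real \<Rightarrow> bool"
  where "has_second_deriv f d x \<longleftrightarrow> (\<exists>f'. (\<forall>\<^sub>F s in nhds x. (f has_real_derivative f' s) (at s)) \<and>
    (f' has_real_derivative d) (at x))"

text \<open>\<open>I(X, X)\<close>: the common value of the second variation of length over all variations with field
  \<open>X\<close>.\<close>

definition index_quad ::
    "('p, 'm::finite) chart set \<Rightarrow> ('p \<Rightarrow> ('p, 'm) tvec \<Rightarrow> ('p, 'm) tvec \<Rightarrow> real) \<Rightarrow>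
      real \<Rightarrow> real \<Rightarrow> (real \<Rightarrow> 'p) \<Rightarrow> (real \<Rightarrow> ('p, 'm) tvec) \<Rightarrow> real"
  where "index_quad A g a b \<gamma> X = (THE d. (\<exists>\<epsilon> V. variation A a b \<gamma> X \<epsilon> V) \<and>
    (\<forall>\<epsilon> V. variation A a b \<gamma> X \<epsilon> V \<longrightarrow> has_second_deriv (\<lambda>s. curve_length A g a b (V s)) d 0))"

definition index_form ::
    "('p, 'm::finite) chart set \<Rightarrow> ('p \<Rightarrow> ('p, 'm) tvec \<Rightarrow> ('p, 'm) tvec \<Rightarrow> real) \<Rightarrow>
      real \<Rightarrow> real \<Rightarrow> (real \<Rightarrow> 'p) \<Rightarrow> (real \<Rightarrow> ('p, 'm) tvec) \<Rightarrow> (real \<Rightarrow> ('p, 'm) tvec) \<Rightarrow> real"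
  where "index_form A g a b \<gamma> X Y =
    (index_quad A g a b \<gamma> (\<lambda>t. X t + Y t) - index_quad A g a b \<gamma> X - index_quad A g a b \<gamma> Y) / 2"

end

theory Submission
  imports Defs
begin

text \<open>In a chart, the Tanaka-Webster connection of a Sasakian manifold is a metric connection with
  parallel Reeb field \<open>T\<close> and torsion \<open>2 d\<theta> \<otimes> T\<close>. For a variation \<open>V s t\<close> with \<open>S = \<partial>\<^sub>s V\<close>
  one has \<open>\<nabla>\<^sub>s \<gamma>' = \<nabla>\<^sub>t S - 2 \<Omega>(S, \<gamma>') T\<close>, and \<open>T\<close> is orthogonal to the lengthy curve \<open>\<gamma>\<close>. Hence the
  integrand of the second derivative of length at a geodesic is, up to the factor \<open>1 / r\<close> and the total
  derivative of \<open>g(\<nabla>\<^sub>s S, \<gamma>')\<close>, the quadratic form of the theorem evaluated at \<open>S\<close>. The total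
  derivative integrates to zero, since \<open>g(\<nabla>\<^sub>s S, \<gamma>')\<close> does not depend on the chart and vanishes at the
  end points. Polarization requires that \<open>g(R(X, \<gamma>')\<gamma>', Y)\<close> is symmetric in \<open>X\<close> and \<open>Y\<close>; this follows
  from the first Bianchi identity, in which the torsion terms cancel because \<open>d\<theta>\<close> is closed and \<open>T\<close> is
  parallel. The index form is defined by the common second derivative over all variations, so a variation
  must be shown to exist: it is glued from pieces that are, in a chart, linear in \<open>s\<close> up to a
  correction of second order at the ends of the piece.\<close>

subsection \<open>Calculus of smooth maps\<close>

text \<open>The metric and the Reeb field are defined pointwise, so their smoothness must be
  extracted from the frames of \<open>T10\<close>, the form \<theta> and the connection before
  anything can be differentiated. The symmetry of the metric and \<nabla>T = 0 must likewise be
  derived from the Tanaka-Webster axioms. Curvature and covariant derivatives along \<gamma> are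
  defined in a selected chart, and the selection jumps along \<gamma>. The pointwise formula is
  therefore proved in the chart selected at each parameter and then carried to a chart that serves a
  whole short interval; this needs the acceleration of a variation to transform as a vector. The
  constants come from |\<nabla>S - 2\<Omega>T|^2 = |\<nabla>S|^2 - 4\<Omega>\<theta>(\<nabla>S) +
  4\<Omega>^2, where \<nabla>S is the derivative of S along \<gamma> and \<Omega> stands for
  \<Omega>(S, \<gamma>'). Neighbouring curves may have variable speed: the square root in the length
  then contributes - g(\<nabla>S, \<gamma>')^2 / r^2, which replaces \<nabla>S by its normal part.
  The curvature and \<Omega> terms do not see the tangential part of S, whence the normal fields in
  the formula.\<close>

lemma frechet_eqI: "(f has_derivative f') (at x) \<Longrightarrow> frechet_derivative f (at x) = f'"
  by (metis frechet_derivative_at)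

lemma frechet_works: "f differentiable (at x) \<Longrightarrow> (f has_derivative frechet_derivative f (at x)) (at x)"
  using frechet_derivative_works by blast

lemma differentiable_cong_open:
  assumes "f differentiable (at x)" "open S" "x \<in> S" "\<And>y. y \<in> S \<Longrightarrow> f y = g y"
  shows "g differentiable (at x)" "frechet_derivative g (at x) = frechet_derivative f (at x)"
proof -
  have "(g has_derivative frechet_derivative f (at x)) (at x)"
    using has_derivative_transform_within_open[OF frechet_works[OF assms(1)] assms(2,3)] assms(4) by simp
  then show "g differentiable (at x)" "frechet_derivative g (at x) = frechet_derivative f (at x)"
    by (auto simp: differentiable_def intro: frechet_eqI)
qed

lemma frechet_cong_open:
  assumes "open S" "x \<in> S" "\<And>y. y \<in> S \<Longrightarrow> f y = g y"
  shows "frechet_derivative f (at x) = frechet_derivative g (at x)"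
proof -
  have "(f has_derivative D) (at x) \<longleftrightarrow> (g has_derivative D) (at x)" for D
    using has_derivative_transform_within_open[of f D x UNIV S g]
      has_derivative_transform_within_open[of g D x UNIV S f] assms by auto
  then show ?thesis by (simp add: frechet_derivative_def)
qed

lemma Ck_on_cong:
  assumes "open S" "\<And>x. x \<in> S \<Longrightarrow> f x = g x"
  shows "Ck_on k S f \<Longrightarrow> Ck_on k S g"
  using assms(2)
proof (induction k arbitrary: f g)
  case 0
  then show ?case by (metis Ck_on.simps(1) continuous_on_eq)
next
  case (Suc k)
  have eq: "g differentiable (at x) \<and> frechet_derivative g (at x) = frechet_derivative f (at x)"
    if "x \<in> S" for x
    using differentiable_cong_open[of f x S g] Suc.prems assms(1) that by simp
  have "Ck_on k S (\<lambda>x. frechet_derivative g (at x) v)" for v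
  proof (rule Suc.IH[of "\<lambda>x. frechet_derivative f (at x) v"])
    show "Ck_on k S (\<lambda>x. frechet_derivative f (at x) v)" using Suc.prems(1) by simp
  qed (use eq in simp)
  then show ?case using eq by simp
qed

lemma Ck_on_subset: "Ck_on k S f \<Longrightarrow> T \<subseteq> S \<Longrightarrow> Ck_on k T f"
  by (induction k arbitrary: f) (auto intro: continuous_on_subset)

lemma Ck_on_local:
  assumes "\<And>x. x \<in> S \<Longrightarrow> \<exists>T. open T \<and> x \<in> T \<and> Ck_on k (T \<inter> S) f" "open S"
  shows "Ck_on k S f"
  using assms(1)
proof (induction k arbitrary: f)
  case 0
  then have "\<forall>x\<in>S. continuous (at x) f"
    by (metis Ck_on.simps(1) IntI assms(2) continuous_on_eq_continuous_at open_Int)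
  then show ?case by (simp add: continuous_at_imp_continuous_on)
next
  case (Suc k)
  have "\<forall>x\<in>S. f differentiable (at x)"
    by (metis Ck_on.simps(2) IntI Suc.prems)
  moreover have "Ck_on k S (\<lambda>x. frechet_derivative f (at x) v)" for v
    by (rule Suc.IH) (use Suc.prems in fastforce)
  ultimately show ?case by simp
qed

lemma Ck_on_SucD: "Ck_on (Suc k) S f \<Longrightarrow> Ck_on k S f"
proof (induction k arbitrary: f)
  case 0
  then show ?case
    by (auto intro!: continuous_at_imp_continuous_on differentiable_imp_continuous_within)
next
  case (Suc k)
  then show ?case by (metis Ck_on.simps(2))
qed

lemma Ck_on_const: "Ck_on k S (\<lambda>x. c)"
proof (induction k arbitrary: c)
  case (Suc k)
  have "frechet_derivative (\<lambda>x. c) (at x) = (\<lambda>v. 0)" for x :: 'a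
    by (rule frechet_eqI) simp
  with Suc show ?case by simp
qed simp

lemma Ck_on_bounded_linear: "bounded_linear L \<Longrightarrow> Ck_on k S L"
proof (cases k)
  case 0
  then show "bounded_linear L \<Longrightarrow> ?thesis" by (simp add: linear_continuous_on)
next
  case (Suc j)
  assume "bounded_linear L"
  then have "frechet_derivative L (at x) = L" "L differentiable (at x)" for x
    using bounded_linear_imp_has_derivative[of L] by (auto intro: frechet_eqI simp: differentiable_def)
  with Suc show ?thesis by (simp add: Ck_on_const)
qed

lemma Ck_on_linear_comp:
  assumes "bounded_linear L" "open S"
  shows "Ck_on k S f \<Longrightarrow> Ck_on k S (\<lambda>x. L (f x))"
proof (induction k arbitrary: f)
  case 0
  then show ?case using bounded_linear.continuous_on[OF assms(1)] by simp
next
  case (Suc k)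
  have D: "((\<lambda>x. L (f x)) has_derivative (\<lambda>v. L (frechet_derivative f (at x) v))) (at x)"
    if "x \<in> S" for x
    using Suc.prems that by (auto intro!: bounded_linear.has_derivative[OF assms(1)] frechet_works)
  have "Ck_on k S (\<lambda>x. frechet_derivative (\<lambda>x. L (f x)) (at x) v)" for v
    by (rule Ck_on_cong[OF assms(2) _ Suc.IH[of "\<lambda>x. frechet_derivative f (at x) v"]])
      (use frechet_eqI[OF D] Suc.prems in auto)
  then show ?case using D by (auto simp: differentiable_def)
qed

lemma Ck_on_add:
  assumes "open S"
  shows "Ck_on k S f \<Longrightarrow> Ck_on k S g \<Longrightarrow> Ck_on k S (\<lambda>x. f x + g x)"
proof (induction k arbitrary: f g)
  case 0
  then show ?case by (simp add: continuous_on_add)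
next
  case (Suc k)
  have D: "((\<lambda>x. f x + g x) has_derivative
      (\<lambda>v. frechet_derivative f (at x) v + frechet_derivative g (at x) v)) (at x)"
    if "x \<in> S" for x
    using Suc.prems that by (auto intro!: has_derivative_add frechet_works)
  have "Ck_on k S (\<lambda>x. frechet_derivative (\<lambda>x. f x + g x) (at x) v)" for v
    by (rule Ck_on_cong[OF assms _ Suc.IH[of "\<lambda>x. frechet_derivative f (at x) v"
            "\<lambda>x. frechet_derivative g (at x) v"]])
      (use frechet_eqI[OF D] Suc.prems in auto)
  then show ?case using D by (auto simp: differentiable_def)
qed

lemma Ck_on_sum:
  assumes "open S" "\<And>i. i \<in> I \<Longrightarrow> Ck_on k S (f i)"
  shows "Ck_on k S (\<lambda>x. \<Sum>i\<in>I. f i x)"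
  using assms(2)
  by (induction I rule: infinite_finite_induct) (auto simp: Ck_on_const intro: Ck_on_add[OF assms(1)])

lemma Ck_on_bilinear:
  assumes B: "bounded_bilinear B" and "open S"
  shows "Ck_on k S f \<Longrightarrow> Ck_on k S g \<Longrightarrow> Ck_on k S (\<lambda>x. B (f x) (g x))"
proof (induction k arbitrary: f g)
  case 0
  then show ?case by (simp add: bounded_bilinear.continuous_on[OF B])
next
  case (Suc k)
  have D: "((\<lambda>x. B (f x) (g x)) has_derivative
      (\<lambda>v. B (f x) (frechet_derivative g (at x) v) + B (frechet_derivative f (at x) v) (g x))) (at x)"
    if "x \<in> S" for x
    using Suc.prems that by (auto intro!: bounded_bilinear.FDERIV[OF B] frechet_works)
  have "Ck_on k S (\<lambda>x. B (f x) (frechet_derivative g (at x) v) + B (frechet_derivative f (at x) v) (g x))"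
    for v
    by (intro Ck_on_add[OF assms(2)] Suc.IH) (use Suc.prems Ck_on_SucD[of k S f] Ck_on_SucD[of k S g] in auto)
  then have "Ck_on k S (\<lambda>x. frechet_derivative (\<lambda>x. B (f x) (g x)) (at x) v)" for v
    by (rule Ck_on_cong[OF assms(2), rotated]) (use frechet_eqI[OF D] in auto)
  then show ?case using D by (auto simp: differentiable_def)
qed

text \<open>The derivative of \<open>inverse (f x)\<close> contains only
  \<open>inverse (f x)\<close> and the derivative of \<open>f\<close>, so the order can be raised
  one step at a time with \<open>f\<close> fixed.\<close>

lemma Ck_on_inverse:
  fixes f :: "'a::real_normed_vector \<Rightarrow> real"
  assumes "open S" and nz: "\<And>x. x \<in> S \<Longrightarrow> f x \<noteq> 0"
  shows "Ck_on k S f \<Longrightarrow> Ck_on k S (\<lambda>x. inverse (f x))"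
proof (induction k)
  case 0
  then show ?case using nz by (auto intro!: continuous_on_inverse)
next
  case (Suc k)
  have D: "((\<lambda>x. inverse (f x)) has_derivative
      (\<lambda>v. - (inverse (f x) * frechet_derivative f (at x) v * inverse (f x)))) (at x)"
    if "x \<in> S" for x
    using Suc.prems that nz by (intro Deriv.has_derivative_inverse frechet_works) auto
  note m = Ck_on_bilinear[OF bounded_bilinear_mult assms(1)]
  have "Ck_on k S (\<lambda>x. - (inverse (f x) * frechet_derivative f (at x) v * inverse (f x)))" for v
    by (intro Ck_on_linear_comp[OF bounded_linear_minus[OF bounded_linear_ident] assms(1)] m)
      (use Suc Ck_on_SucD[of k S f] in auto)
  then have "Ck_on k S (\<lambda>x. frechet_derivative (\<lambda>x. inverse (f x)) (at x) v)" for v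
    by (rule Ck_on_cong[OF assms(1), rotated]) (use frechet_eqI[OF D] in auto)
  then show ?case using D by (auto simp: differentiable_def)
qed

text \<open>In a chain rule the derivative of \<open>f\<close> is applied to a direction that varies
  with the point. Expanding that direction in \<open>Basis\<close> leaves derivatives of
  \<open>f\<close> in fixed directions, which is all that \<open>Ck_on\<close> controls.\<close>

lemma frechet_expand:
  fixes f :: "'b::euclidean_space \<Rightarrow> 'c::real_normed_vector"
  assumes "f differentiable (at x)"
  shows "frechet_derivative f (at x) w = (\<Sum>b\<in>Basis. (w \<bullet> b) *\<^sub>R frechet_derivative f (at x) b)"
proof -
  interpret linear "frechet_derivative f (at x)"
    using assms by (rule linear_frechet_derivative)
  show ?thesis
    by (subst (1) euclidean_representation[of w, symmetric]) (simp add: sum scaleR del: euclidean_representation)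
qed

lemma Ck_on_compose:
  fixes f :: "'b::euclidean_space \<Rightarrow> 'c::real_normed_vector" and g :: "'a::real_normed_vector \<Rightarrow> 'b"
  assumes "open S" "open T" "g ` S \<subseteq> T"
  shows "Ck_on k T f \<Longrightarrow> Ck_on k S g \<Longrightarrow> Ck_on k S (\<lambda>x. f (g x))"
proof (induction k arbitrary: f)
  case 0
  then show ?case using assms(3) by (auto intro: continuous_on_compose2)
next
  case (Suc k)
  have D: "((\<lambda>x. f (g x)) has_derivative
      (\<lambda>v. frechet_derivative f (at (g x)) (frechet_derivative g (at x) v))) (at x)"
    if "x \<in> S" for x
    using Suc.prems that assms(3)
    by (intro has_derivative_compose[of g _ x UNIV f] frechet_works) auto
  have "Ck_on k S (\<lambda>x. \<Sum>b\<in>Basis. (frechet_derivative g (at x) v \<bullet> b) *\<^sub>R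
      frechet_derivative f (at (g x)) b)" for v
    by (intro Ck_on_sum[OF assms(1)] Ck_on_bilinear[OF bounded_bilinear_scaleR assms(1)]
        Ck_on_linear_comp[OF bounded_linear_inner_left assms(1)]
        Suc.IH[of "\<lambda>y. frechet_derivative f (at y) b" for b])
      (use Suc.prems Ck_on_SucD[of k S g] in auto)
  then have "Ck_on k S (\<lambda>x. frechet_derivative (\<lambda>x. f (g x)) (at x) v)" for v
  proof (rule Ck_on_cong[OF assms(1), rotated])
    fix x assume x: "x \<in> S"
    then have "f differentiable (at (g x))" using Suc.prems assms(3) by auto
    then show "(\<Sum>b\<in>Basis. (frechet_derivative g (at x) v \<bullet> b) *\<^sub>R frechet_derivative f (at (g x)) b) =
        frechet_derivative (\<lambda>x. f (g x)) (at x) v"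
      using frechet_eqI[OF D[OF x]] frechet_expand[of f "g x" "frechet_derivative g (at x) v"] by simp
  qed
  then show ?case using D by (auto simp: differentiable_def)
qed

lemma smooth_on_cong: "smooth_on S f \<Longrightarrow> open S \<Longrightarrow> (\<And>x. x \<in> S \<Longrightarrow> f x = g x) \<Longrightarrow> smooth_on S g"
  unfolding smooth_on_def using Ck_on_cong by blast

lemma smooth_on_subset: "smooth_on S f \<Longrightarrow> T \<subseteq> S \<Longrightarrow> smooth_on T f"
  unfolding smooth_on_def using Ck_on_subset by blast

lemma smooth_on_local:
  assumes "open S" "\<And>x. x \<in> S \<Longrightarrow> \<exists>T. open T \<and> x \<in> T \<and> smooth_on (T \<inter> S) f"
  shows "smooth_on S f"
  unfolding smooth_on_def
proof
  show "Ck_on k S f" for k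
    by (rule Ck_on_local[OF _ assms(1)]) (use assms(2) smooth_on_def in blast)
qed

lemma smooth_on_differentiable: "smooth_on S f \<Longrightarrow> x \<in> S \<Longrightarrow> f differentiable (at x)"
  unfolding smooth_on_def using Ck_on.simps(2) by blast

lemma smooth_on_has_derivative:
  "smooth_on S f \<Longrightarrow> x \<in> S \<Longrightarrow> (f has_derivative frechet_derivative f (at x)) (at x)"
  by (intro frechet_works smooth_on_differentiable)

lemma smooth_on_continuous_on: "smooth_on S f \<Longrightarrow> continuous_on S f"
  unfolding smooth_on_def using Ck_on.simps(1) by blast

lemma smooth_on_frechet: "smooth_on S f \<Longrightarrow> smooth_on S (\<lambda>x. frechet_derivative f (at x) v)"
  unfolding smooth_on_def using Ck_on.simps(2) by blast

lemma smooth_on_const: "smooth_on S (\<lambda>x. c)"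
  by (simp add: smooth_on_def Ck_on_const)

lemma smooth_on_linear: "bounded_linear L \<Longrightarrow> smooth_on S L"
  by (simp add: smooth_on_def Ck_on_bounded_linear)

lemma smooth_on_id: "smooth_on S (\<lambda>x. x)"
  by (rule smooth_on_linear) (rule bounded_linear_ident)

lemma smooth_on_linear_comp:
  "bounded_linear L \<Longrightarrow> open S \<Longrightarrow> smooth_on S f \<Longrightarrow> smooth_on S (\<lambda>x. L (f x))"
  by (simp add: smooth_on_def Ck_on_linear_comp)

lemma smooth_on_add: "open S \<Longrightarrow> smooth_on S f \<Longrightarrow> smooth_on S g \<Longrightarrow> smooth_on S (\<lambda>x. f x + g x)"
  by (simp add: smooth_on_def Ck_on_add)

lemma smooth_on_minus: "open S \<Longrightarrow> smooth_on S f \<Longrightarrow> smooth_on S (\<lambda>x. - f x)"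
  by (rule smooth_on_linear_comp[OF bounded_linear_minus[OF bounded_linear_ident]])

lemma smooth_on_diff: "open S \<Longrightarrow> smooth_on S f \<Longrightarrow> smooth_on S g \<Longrightarrow> smooth_on S (\<lambda>x. f x - g x)"
  using smooth_on_add[of S f "\<lambda>x. - g x"] smooth_on_minus[of S g] by simp

lemma smooth_on_sum:
  "open S \<Longrightarrow> (\<And>i. i \<in> I \<Longrightarrow> smooth_on S (f i)) \<Longrightarrow> smooth_on S (\<lambda>x. \<Sum>i\<in>I. f i x)"
  by (simp add: smooth_on_def Ck_on_sum)

lemma smooth_on_scaleR:
  "open S \<Longrightarrow> smooth_on S f \<Longrightarrow> smooth_on S g \<Longrightarrow> smooth_on S (\<lambda>x. f x *\<^sub>R g x)"
  by (simp add: smooth_on_def Ck_on_bilinear[OF bounded_bilinear_scaleR])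

lemma smooth_on_mult:
  fixes f g :: "'a::real_normed_vector \<Rightarrow> real"
  shows "open S \<Longrightarrow> smooth_on S f \<Longrightarrow> smooth_on S g \<Longrightarrow> smooth_on S (\<lambda>x. f x * g x)"
  by (simp add: smooth_on_def Ck_on_bilinear[OF bounded_bilinear_mult])

lemma smooth_on_prod:
  fixes f :: "'i \<Rightarrow> 'a::real_normed_vector \<Rightarrow> real"
  assumes "open S" "\<And>i. i \<in> I \<Longrightarrow> smooth_on S (f i)"
  shows "smooth_on S (\<lambda>x. \<Prod>i\<in>I. f i x)"
  using assms(2)
  by (induction I rule: infinite_finite_induct) (auto simp: smooth_on_const intro: smooth_on_mult[OF assms(1)])

lemma smooth_on_divide:
  fixes f g :: "'a::real_normed_vector \<Rightarrow> real"
  shows "open S \<Longrightarrow> smooth_on S f \<Longrightarrow> smooth_on S g \<Longrightarrow> (\<And>x. x \<in> S \<Longrightarrow> g x \<noteq> 0) \<Longrightarrow>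
    smooth_on S (\<lambda>x. f x / g x)"
  using smooth_on_mult[of S f "\<lambda>x. inverse (g x)"]
  by (simp add: smooth_on_def Ck_on_inverse divide_inverse)

lemma smooth_on_compose:
  fixes f :: "'b::euclidean_space \<Rightarrow> 'c::real_normed_vector"
  shows "open S \<Longrightarrow> open T \<Longrightarrow> g ` S \<subseteq> T \<Longrightarrow> smooth_on T f \<Longrightarrow> smooth_on S g \<Longrightarrow>
    smooth_on S (\<lambda>x. f (g x))"
  unfolding smooth_on_def using Ck_on_compose by blast

lemma smooth_on_vec_nth: "open S \<Longrightarrow> smooth_on S f \<Longrightarrow> smooth_on S (\<lambda>x. f x $ i)"
  by (rule smooth_on_linear_comp[OF bounded_linear_vec_nth])

lemma smooth_on_det:
  fixes M :: "'a::real_normed_vector \<Rightarrow> real^'m^'m"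
  assumes "open S" "\<And>i j. smooth_on S (\<lambda>x. M x $ i $ j)"
  shows "smooth_on S (\<lambda>x. det (M x))"
  unfolding det_def
  by (intro smooth_on_sum smooth_on_mult smooth_on_const smooth_on_prod assms)

text \<open>Metric, Christoffel symbols and \<theta> are families of multilinear maps whose
  smoothness is known on fixed vectors. Expanding \<open>p x\<close> in \<open>Basis\<close> extends
  it to variable ones.\<close>

lemma smooth_on_apply_linear:
  fixes L :: "'b::real_normed_vector \<Rightarrow> 'v::euclidean_space \<Rightarrow> 'c::real_normed_vector"
  assumes "open S" "\<And>x. x \<in> S \<Longrightarrow> linear (L x)" "\<And>u. smooth_on S (\<lambda>x. L x u)" "smooth_on S p"
  shows "smooth_on S (\<lambda>x. L x (p x))"
proof -
  have "smooth_on S (\<lambda>x. \<Sum>b\<in>Basis. (p x \<bullet> b) *\<^sub>R L x b)"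
    by (intro smooth_on_sum smooth_on_scaleR smooth_on_linear_comp[OF bounded_linear_inner_left] assms)
  moreover have "(\<Sum>b\<in>Basis. (p x \<bullet> b) *\<^sub>R L x b) = L x (p x)" if "x \<in> S" for x
  proof -
    have "L x (p x) = L x (\<Sum>b\<in>Basis. (p x \<bullet> b) *\<^sub>R b)" by (simp add: euclidean_representation)
    also have "\<dots> = (\<Sum>b\<in>Basis. (p x \<bullet> b) *\<^sub>R L x b)"
      using assms(2)[OF that] by (simp add: linear_sum linear_scale)
    finally show ?thesis by simp
  qed
  ultimately show ?thesis by (rule smooth_on_cong[OF _ assms(1)])
qed

text \<open>The product rule for such a family. The first summand differentiates the map with its
  argument frozen at \<open>p x\<close>; this is the term to which metric compatibility applies
  later.\<close>

lemma frechet_apply_linear: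
  fixes L :: "'b::real_normed_vector \<Rightarrow> 'v::euclidean_space \<Rightarrow> 'c::real_normed_vector"
  assumes "open S" "x \<in> S" "\<And>x. x \<in> S \<Longrightarrow> linear (L x)" "\<And>u. (\<lambda>x. L x u) differentiable (at x)"
    and p: "(p has_derivative p') (at x)"
  shows "((\<lambda>x. L x (p x)) has_derivative
    (\<lambda>d. frechet_derivative (\<lambda>y. L y (p x)) (at x) d + L x (p' d))) (at x)"
proof -
  have rep: "L y w = (\<Sum>b\<in>Basis. (w \<bullet> b) *\<^sub>R L y b)" if "y \<in> S" for y w
  proof -
    have "L y w = L y (\<Sum>b\<in>Basis. (w \<bullet> b) *\<^sub>R b)" by (simp add: euclidean_representation)
    also have "\<dots> = (\<Sum>b\<in>Basis. (w \<bullet> b) *\<^sub>R L y b)"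
      using assms(3)[OF that] by (simp add: linear_sum linear_scale)
    finally show ?thesis .
  qed
  let ?D = "\<lambda>b. frechet_derivative (\<lambda>x. L x b) (at x)"
  have w: "((\<lambda>x. L x b) has_derivative ?D b) (at x)" for b
    using assms(4) by (rule frechet_works)
  have "((\<lambda>y. \<Sum>b\<in>Basis. (p y \<bullet> b) *\<^sub>R L y b) has_derivative
      (\<lambda>d. \<Sum>b\<in>Basis. (p x \<bullet> b) *\<^sub>R ?D b d + (p' d \<bullet> b) *\<^sub>R L x b)) (at x)"
    by (auto intro!: derivative_eq_intros w p)
  then have 1: "((\<lambda>y. L y (p y)) has_derivative
      (\<lambda>d. \<Sum>b\<in>Basis. (p x \<bullet> b) *\<^sub>R ?D b d + (p' d \<bullet> b) *\<^sub>R L x b)) (at x)"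
    by (rule has_derivative_transform_within_open[OF _ assms(1,2)]) (metis rep)
  have "((\<lambda>y. \<Sum>b\<in>Basis. (p x \<bullet> b) *\<^sub>R L y b) has_derivative
      (\<lambda>d. \<Sum>b\<in>Basis. (p x \<bullet> b) *\<^sub>R ?D b d)) (at x)"
    by (auto intro!: derivative_eq_intros w)
  then have "((\<lambda>y. L y (p x)) has_derivative (\<lambda>d. \<Sum>b\<in>Basis. (p x \<bullet> b) *\<^sub>R ?D b d)) (at x)"
    by (rule has_derivative_transform_within_open[OF _ assms(1,2)]) (metis rep)
  then have 2: "frechet_derivative (\<lambda>y. L y (p x)) (at x) = (\<lambda>d. \<Sum>b\<in>Basis. (p x \<bullet> b) *\<^sub>R ?D b d)"
    by (rule frechet_eqI)
  show ?thesis
    using 1 unfolding 2 rep[OF assms(2), of "p' _"] by (simp add: sum.distrib)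
qed

lemma frechet_apply_bilinear:
  fixes B :: "'b::real_normed_vector \<Rightarrow> 'v::euclidean_space \<Rightarrow> 'w::euclidean_space \<Rightarrow> 'c::real_normed_vector"
  assumes "open S" "x \<in> S" "\<And>x. x \<in> S \<Longrightarrow> bilinear (B x)"
    and diff: "\<And>u v. (\<lambda>x. B x u v) differentiable (at x)"
    and p: "(p has_derivative p') (at x)" and q: "(q has_derivative q') (at x)"
  shows "((\<lambda>x. B x (p x) (q x)) has_derivative
    (\<lambda>d. frechet_derivative (\<lambda>y. B y (p x) (q x)) (at x) d + B x (p' d) (q x) + B x (p x) (q' d))) (at x)"
proof -
  have lin: "linear (\<lambda>u. B y u v)" "linear (B y u)" if "y \<in> S" for y u v
    using assms(3)[OF that] by (auto simp: bilinear_def)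
  have 1: "((\<lambda>y. B y (p y) v) has_derivative
      (\<lambda>d. frechet_derivative (\<lambda>y. B y (p x) v) (at x) d + B x (p' d) v)) (at x)" for v
    by (rule frechet_apply_linear[OF assms(1,2), of "\<lambda>y u. B y u v"]) (auto intro: lin diff p)
  have "((\<lambda>y. B y (p y) (q y)) has_derivative
      (\<lambda>d. frechet_derivative (\<lambda>y. B y (p y) (q x)) (at x) d + B x (p x) (q' d))) (at x)"
    by (rule frechet_apply_linear[OF assms(1,2), of "\<lambda>y. B y (p y)"])
      (use 1 in \<open>auto intro: lin q simp: differentiable_def\<close>)
  then show ?thesis by (simp add: frechet_eqI[OF 1])
qed

lemma smooth_on_apply_bilinear:
  fixes B :: "'b::real_normed_vector \<Rightarrow> 'v::euclidean_space \<Rightarrow> 'w::euclidean_space \<Rightarrow> 'c::real_normed_vector"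
  assumes "open S" "\<And>x. x \<in> S \<Longrightarrow> bilinear (B x)" "\<And>u v. smooth_on S (\<lambda>x. B x u v)"
    "smooth_on S p" "smooth_on S q"
  shows "smooth_on S (\<lambda>x. B x (p x) (q x))"
proof -
  have lin: "linear (\<lambda>u. B y u v)" "linear (B y u)" if "y \<in> S" for y u v
    using assms(2)[OF that] by (auto simp: bilinear_def)
  have "smooth_on S (\<lambda>x. B x (p x) v)" for v
    by (rule smooth_on_apply_linear[OF assms(1) lin(1) assms(3,4)])
  then show ?thesis
    by (intro smooth_on_apply_linear[OF assms(1) lin(2) _ assms(5)])
qed

section \<open>Symmetry of second derivatives\<close>

lemma second_difference_limit:
  fixes f :: "'a::real_normed_vector \<Rightarrow> real"
  assumes "open S" "x \<in> S" "smooth_on S f" "0 < e"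
  shows "\<exists>d>0. \<forall>h. 0 < h \<and> h < d \<longrightarrow>
    \<bar>(f (x + h *\<^sub>R u + h *\<^sub>R v) - f (x + h *\<^sub>R u) - f (x + h *\<^sub>R v) + f x) -
      h\<^sup>2 * frechet_derivative (\<lambda>y. frechet_derivative f (at y) u) (at x) v\<bar> \<le> e * h\<^sup>2"
proof -
  let ?Du = "\<lambda>y. frechet_derivative f (at y) u"
  let ?D = "\<lambda>y. frechet_derivative ?Du (at y) v"
  have smu: "smooth_on S ?Du" by (rule smooth_on_frechet[OF assms(3)])
  have "continuous_on S ?D"
    by (intro smooth_on_continuous_on smooth_on_frechet assms(3))
  then have "isCont ?D x"
    using assms(1,2) continuous_on_eq_continuous_at by blast
  then obtain r1 where r1: "r1 > 0" "\<And>y. dist y x < r1 \<Longrightarrow> dist (?D y) (?D x) < e"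
    unfolding continuous_at_eps_delta using assms(4) by blast
  obtain r2 where r2: "r2 > 0" "ball x r2 \<subseteq> S"
    using assms(1,2) open_contains_ball by blast
  define r where "r = min r1 r2"
  \<comment> \<open>Keeps the parallelogram spanned by \<open>h *\<^sub>R u\<close> and
    \<open>h *\<^sub>R v\<close> inside the ball of radius \<open>r\<close>; the summand 1 covers
    the case u = v = 0.\<close>
  define d where "d = r / (norm u + norm v + 1)"
  have r: "r > 0" using r1 r2 by (simp add: r_def)
  have pos: "norm u + norm v + 1 > 0" using norm_ge_zero[of u] norm_ge_zero[of v] by linarith
  have "d > 0" using r pos by (simp add: d_def)
  moreover have "\<bar>(f (x + h *\<^sub>R u + h *\<^sub>R v) - f (x + h *\<^sub>R u) - f (x + h *\<^sub>R v) + f x) -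
      h\<^sup>2 * ?D x\<bar> \<le> e * h\<^sup>2" if h: "0 < h" "h < d" for h
  proof -
    have near: "dist (x + a *\<^sub>R u + b *\<^sub>R v) x < r" if "0 \<le> a" "a \<le> h" "0 \<le> b" "b \<le> h" for a b
    proof -
      have "norm (a *\<^sub>R u + b *\<^sub>R v) \<le> a * norm u + b * norm v"
        using norm_triangle_ineq[of "a *\<^sub>R u" "b *\<^sub>R v"] that by simp
      also have "\<dots> \<le> h * norm u + h * norm v"
        using that by (intro add_mono mult_right_mono) auto
      also have "\<dots> \<le> h * (norm u + norm v + 1)"
        using h by (simp add: distrib_left)
      also have "\<dots> < d * (norm u + norm v + 1)"
        using h pos by (intro mult_strict_right_mono)
      also have "\<dots> = r" using pos by (simp add: d_def)
      finally show ?thesis by (simp add: dist_norm add.assoc)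
    qed
    then have inS: "x + a *\<^sub>R u + b *\<^sub>R v \<in> S" if "0 \<le> a" "a \<le> h" "0 \<le> b" "b \<le> h" for a b
      using that r2 by (force simp: r_def dist_commute)
    have deru: "((\<lambda>a. f (x + a *\<^sub>R u + b *\<^sub>R v)) has_real_derivative ?Du (x + a *\<^sub>R u + b *\<^sub>R v)) (at a)"
      if "0 \<le> a" "a \<le> h" "0 \<le> b" "b \<le> h" for a b
    proof -
      have "((\<lambda>a. f (x + a *\<^sub>R u + b *\<^sub>R v)) has_derivative
          (\<lambda>t. frechet_derivative f (at (x + a *\<^sub>R u + b *\<^sub>R v)) (t *\<^sub>R u))) (at a)"
        by (rule has_derivative_compose[of "\<lambda>a. x + a *\<^sub>R u + b *\<^sub>R v" "\<lambda>t. t *\<^sub>R u" a UNIV f])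
          (use inS[OF that] assms(3) smooth_on_has_derivative in \<open>auto intro!: derivative_eq_intros\<close>)
      moreover have "linear (frechet_derivative f (at (x + a *\<^sub>R u + b *\<^sub>R v)))"
        using inS[OF that] assms(3) by (intro linear_frechet_derivative smooth_on_differentiable)
      ultimately show ?thesis
        by (auto simp: has_field_derivative_def linear_scale fun_eq_iff elim!: has_derivative_eq_rhs)
    qed
    have derv: "((\<lambda>b. ?Du (x + a *\<^sub>R u + b *\<^sub>R v)) has_real_derivative ?D (x + a *\<^sub>R u + b *\<^sub>R v)) (at b)"
      if "0 \<le> a" "a \<le> h" "0 \<le> b" "b \<le> h" for a b
    proof -
      have "((\<lambda>b. ?Du (x + a *\<^sub>R u + b *\<^sub>R v)) has_derivative
          (\<lambda>t. frechet_derivative ?Du (at (x + a *\<^sub>R u + b *\<^sub>R v)) (t *\<^sub>R v))) (at b)"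
        by (rule has_derivative_compose[of "\<lambda>b. x + a *\<^sub>R u + b *\<^sub>R v" "\<lambda>t. t *\<^sub>R v" b UNIV ?Du])
          (use inS[OF that] smu smooth_on_has_derivative in \<open>auto intro!: derivative_eq_intros\<close>)
      moreover have "linear (frechet_derivative ?Du (at (x + a *\<^sub>R u + b *\<^sub>R v)))"
        using inS[OF that] smu by (intro linear_frechet_derivative smooth_on_differentiable)
      ultimately show ?thesis
        by (auto simp: has_field_derivative_def linear_scale fun_eq_iff elim!: has_derivative_eq_rhs)
    qed
    \<comment> \<open>The mean value theorem, first along \<open>u\<close> and then along
      \<open>v\<close>, turns the second difference into h^2 times the iterated derivative at an
      intermediate point, where continuity gives the bound.\<close>
    obtain a where a: "0 < a" "a < h"
      "(f (x + h *\<^sub>R u + h *\<^sub>R v) - f (x + h *\<^sub>R u + 0 *\<^sub>R v)) -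
       (f (x + 0 *\<^sub>R u + h *\<^sub>R v) - f (x + 0 *\<^sub>R u + 0 *\<^sub>R v)) =
       (h - 0) * (?Du (x + a *\<^sub>R u + h *\<^sub>R v) - ?Du (x + a *\<^sub>R u + 0 *\<^sub>R v))"
      using MVT2[of 0 h "\<lambda>a. f (x + a *\<^sub>R u + h *\<^sub>R v) - f (x + a *\<^sub>R u + 0 *\<^sub>R v)"
          "\<lambda>a. ?Du (x + a *\<^sub>R u + h *\<^sub>R v) - ?Du (x + a *\<^sub>R u + 0 *\<^sub>R v)"]
        h deru by (force intro!: DERIV_diff)
    obtain b where b: "0 < b" "b < h"
      "?Du (x + a *\<^sub>R u + h *\<^sub>R v) - ?Du (x + a *\<^sub>R u + 0 *\<^sub>R v) = (h - 0) * ?D (x + a *\<^sub>R u + b *\<^sub>R v)"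
      using MVT2[of 0 h "\<lambda>b. ?Du (x + a *\<^sub>R u + b *\<^sub>R v)" "\<lambda>b. ?D (x + a *\<^sub>R u + b *\<^sub>R v)"]
        h derv a by force
    have "\<bar>?D (x + a *\<^sub>R u + b *\<^sub>R v) - ?D x\<bar> < e"
      using r1(2)[of "x + a *\<^sub>R u + b *\<^sub>R v"] near[of a b] a b by (simp add: r_def dist_real_def)
    moreover have "(f (x + h *\<^sub>R u + h *\<^sub>R v) - f (x + h *\<^sub>R u) - f (x + h *\<^sub>R v) + f x) - h\<^sup>2 * ?D x =
        h\<^sup>2 * (?D (x + a *\<^sub>R u + b *\<^sub>R v) - ?D x)"
      using a(3) b(3) by (simp add: algebra_simps power2_eq_square)
    ultimately show ?thesis
      by (simp add: abs_mult mult.commute[of e] mult_left_mono)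
  qed
  ultimately show ?thesis by blast
qed

text \<open>The second difference is symmetric in \<open>u\<close> and \<open>v\<close>, and divided
  by h^2 it tends to either iterated derivative.\<close>

lemma symmetric_second_derivative_real:
  fixes f :: "'a::real_normed_vector \<Rightarrow> real"
  assumes "open S" "x \<in> S" "smooth_on S f"
  shows "frechet_derivative (\<lambda>y. frechet_derivative f (at y) u) (at x) v =
         frechet_derivative (\<lambda>y. frechet_derivative f (at y) v) (at x) u" (is "?A = ?B")
proof (rule ccontr)
  assume ne: "?A \<noteq> ?B"
  \<comment> \<open>A third of the gap: two errors of size \<open>e\<close> cannot bridge a gap of
    \<open>3 * e\<close>.\<close>
  define e where "e = \<bar>?A - ?B\<bar> / 3"
  have e: "e > 0" using ne by (simp add: e_def)
  obtain d1 where d1: "d1 > 0" "\<And>h. 0 < h \<Longrightarrow> h < d1 \<Longrightarrow>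
    \<bar>(f (x + h *\<^sub>R u + h *\<^sub>R v) - f (x + h *\<^sub>R u) - f (x + h *\<^sub>R v) + f x) - h\<^sup>2 * ?A\<bar> \<le> e * h\<^sup>2"
    using second_difference_limit[OF assms e, of u v] by blast
  obtain d2 where d2: "d2 > 0" "\<And>h. 0 < h \<Longrightarrow> h < d2 \<Longrightarrow>
    \<bar>(f (x + h *\<^sub>R v + h *\<^sub>R u) - f (x + h *\<^sub>R v) - f (x + h *\<^sub>R u) + f x) - h\<^sup>2 * ?B\<bar> \<le> e * h\<^sup>2"
    using second_difference_limit[OF assms e, of v u] by blast
  define h where "h = min d1 d2 / 2"
  have h: "0 < h" "h < d1" "h < d2" using d1 d2 by (auto simp: h_def)
  have comm: "x + h *\<^sub>R v + h *\<^sub>R u = x + h *\<^sub>R u + h *\<^sub>R v" by (simp add: algebra_simps)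
  have "\<bar>h\<^sup>2 * ?A - h\<^sup>2 * ?B\<bar> \<le> 2 * (e * h\<^sup>2)"
    using d1(2)[OF h(1,2)] d2(2)[OF h(1,3)] unfolding comm abs_le_iff by linarith
  moreover have "\<bar>h\<^sup>2 * ?A - h\<^sup>2 * ?B\<bar> = h\<^sup>2 * (3 * e)"
    by (simp add: e_def abs_mult flip: right_diff_distrib)
  ultimately have "h\<^sup>2 * e \<le> 0" by (simp add: algebra_simps)
  then show False using h e by (simp add: mult_le_0_iff)
qed

lemma symmetric_second_derivative:
  fixes f :: "'a::real_normed_vector \<Rightarrow> 'b::euclidean_space"
  assumes "open S" "x \<in> S" "smooth_on S f"
  shows "frechet_derivative (\<lambda>y. frechet_derivative f (at y) u) (at x) v =
         frechet_derivative (\<lambda>y. frechet_derivative f (at y) v) (at x) u"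
proof (rule euclidean_eqI)
  fix b :: 'b
  have L: "bounded_linear (\<lambda>y::'b. y \<bullet> b)" by (rule bounded_linear_inner_left)
  have sm: "smooth_on S (\<lambda>x. f x \<bullet> b)" by (rule smooth_on_linear_comp[OF L assms(1,3)])
  have D1: "frechet_derivative (\<lambda>x. g x \<bullet> b) (at y) w = frechet_derivative g (at y) w \<bullet> b"
    if "y \<in> S" "smooth_on S g" for y w and g :: "'a \<Rightarrow> 'b"
    using frechet_eqI[OF bounded_linear.has_derivative[OF L smooth_on_has_derivative[OF that(2,1)]]]
    by simp
  have D2: "frechet_derivative (\<lambda>y. frechet_derivative (\<lambda>x. f x \<bullet> b) (at y) w) (at x) z =
      frechet_derivative (\<lambda>y. frechet_derivative f (at y) w) (at x) z \<bullet> b" for w z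
  proof -
    have "frechet_derivative (\<lambda>y. frechet_derivative (\<lambda>x. f x \<bullet> b) (at y) w) (at x) =
        frechet_derivative (\<lambda>y. frechet_derivative f (at y) w \<bullet> b) (at x)"
      by (rule frechet_cong_open[OF assms(1,2)]) (simp add: D1 assms(3))
    then show ?thesis by (simp add: D1[OF assms(2) smooth_on_frechet[OF assms(3)]])
  qed
  show "frechet_derivative (\<lambda>y. frechet_derivative f (at y) u) (at x) v \<bullet> b =
      frechet_derivative (\<lambda>y. frechet_derivative f (at y) v) (at x) u \<bullet> b"
    using symmetric_second_derivative_real[OF assms(1,2) sm, of u v] by (simp add: D2)
qed

subsection \<open>Pseudohermitian geometry in a coordinate domain\<close>

abbreviation pd :: "'a::real_normed_vector \<Rightarrow> ('a \<Rightarrow> 'b::real_normed_vector) \<Rightarrow> 'a \<Rightarrow> 'b"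
  where "pd e f z \<equiv> frechet_derivative f (at z) e"

text \<open>In the convention of the paper this is \<open>2 d\<theta>\<close>.\<close>

definition curl :: "('v::real_normed_vector \<Rightarrow> 'v \<Rightarrow> real) \<Rightarrow> 'v \<Rightarrow> 'v \<Rightarrow> 'v \<Rightarrow> real"
  where "curl th x u v = pd u (\<lambda>y. th y v) x - pd v (\<lambda>y. th y u) x"

lemma pd_linear: "smooth_on S f \<Longrightarrow> x \<in> S \<Longrightarrow> linear (\<lambda>e. pd e f x)"
  by (intro linear_frechet_derivative smooth_on_differentiable)

lemma curl_bilinear:
  fixes th :: "'v::real_normed_vector \<Rightarrow> 'v \<Rightarrow> real"
  assumes open_U: "open U" and "x \<in> U" and th_lin: "\<And>x. x \<in> U \<Longrightarrow> linear (th x)"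
    and th_smooth: "\<And>u. smooth_on U (\<lambda>x. th x u)"
  shows "bilinear (curl th x)"
proof -
  have D: "((\<lambda>y. th y u) has_derivative (\<lambda>e. pd e (\<lambda>y. th y u) x)) (at x)" for u
    using th_smooth assms(2) by (rule smooth_on_has_derivative)
  have a: "pd e (\<lambda>y. th y (u + v)) x = pd e (\<lambda>y. th y u) x + pd e (\<lambda>y. th y v) x" for e u v
  proof -
    have "pd e (\<lambda>y. th y (u + v)) x = pd e (\<lambda>y. th y u + th y v) x"
      by (rule arg_cong[where f="\<lambda>f. f e"], rule frechet_cong_open[OF open_U assms(2)])
        (simp add: linear_add[OF th_lin])
    also have "\<dots> = pd e (\<lambda>y. th y u) x + pd e (\<lambda>y. th y v) x"
      by (simp add: frechet_eqI[OF has_derivative_add[OF D D]])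
    finally show ?thesis .
  qed
  have b: "pd e (\<lambda>y. th y (k *\<^sub>R u)) x = k *\<^sub>R pd e (\<lambda>y. th y u) x" for e u k
  proof -
    have "pd e (\<lambda>y. th y (k *\<^sub>R u)) x = pd e (\<lambda>y. k *\<^sub>R th y u) x"
      by (rule arg_cong[where f="\<lambda>f. f e"], rule frechet_cong_open[OF open_U assms(2)])
        (simp add: linear_scale[OF th_lin])
    also have "\<dots> = k *\<^sub>R pd e (\<lambda>y. th y u) x"
      by (simp only: frechet_eqI[OF has_derivative_scaleR_right[OF D]])
    finally show ?thesis .
  qed
  note l = pd_linear[OF th_smooth assms(2)]
  show ?thesis
    unfolding bilinear_def curl_def
    by (auto intro!: linearI simp: a b linear_add[OF l] linear_scale[OF l] algebra_simps)
qed

lemma curl_self: "curl th x u u = 0"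
  by (simp add: curl_def)

text \<open>The coordinate form of a Sasakian structure: \<open>Ch\<close> stands for the
  Christoffel symbols and \<open>T\<close> for the Reeb field, and \<open>torsion\<close> is the
  shape that the torsion axioms take when \<tau> = 0. \<open>T10\<close> and \<open>J\<close> do not
  occur, since \<Omega> is minus half of \<open>curl th\<close>.\<close>

locale tw_chart =
  fixes U :: "'v::euclidean_space set" and G :: "'v \<Rightarrow> 'v \<Rightarrow> 'v \<Rightarrow> real"
    and Ch :: "'v \<Rightarrow> 'v \<Rightarrow> 'v \<Rightarrow> 'v" and th :: "'v \<Rightarrow> 'v \<Rightarrow> real" and T :: "'v \<Rightarrow> 'v"
  assumes open_U: "open U"
    and G_bil: "\<And>x. x \<in> U \<Longrightarrow> bilinear (G x)"
    and G_sym: "\<And>x u v. x \<in> U \<Longrightarrow> G x u v = G x v u"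
    and Ch_bil: "\<And>x. x \<in> U \<Longrightarrow> bilinear (Ch x)"
    and th_lin: "\<And>x. x \<in> U \<Longrightarrow> linear (th x)"
    and G_smooth: "\<And>u v. smooth_on U (\<lambda>x. G x u v)"
    and Ch_smooth: "\<And>u v. smooth_on U (\<lambda>x. Ch x u v)"
    and th_smooth: "\<And>u. smooth_on U (\<lambda>x. th x u)"
    and T_smooth: "smooth_on U T"
    and compat: "\<And>x u v w. x \<in> U \<Longrightarrow> pd w (\<lambda>y. G y u v) x = G x (Ch x w u) v + G x u (Ch x w v)"
    and torsion: "\<And>x u v. x \<in> U \<Longrightarrow> Ch x u v - Ch x v u = curl th x u v *\<^sub>R T x"
    and T_parallel: "\<And>x w. x \<in> U \<Longrightarrow> pd w T x + Ch x w (T x) = 0"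
    and T_dual: "\<And>x u. x \<in> U \<Longrightarrow> G x (T x) u = th x u"
    and th_T: "\<And>x. x \<in> U \<Longrightarrow> th x (T x) = 1"
begin

text \<open>The covariant derivative of a field \<open>p\<close> along a map \<open>h\<close>, in
  the direction \<open>e\<close> of the parameter space. One notion serves curves, variations with
  two parameters and, with the identity map, fields on \<open>U\<close>.\<close>

definition cov :: "('e::real_normed_vector \<Rightarrow> 'v) \<Rightarrow> 'e \<Rightarrow> ('e \<Rightarrow> 'v) \<Rightarrow> 'e \<Rightarrow> 'v"
  where "cov h e p z = pd e p z + Ch (h z) (pd e h z) (p z)"

text \<open>The curvature evaluated on coordinate fields, whose brackets vanish.\<close>

definition Rc :: "'v \<Rightarrow> 'v \<Rightarrow> 'v \<Rightarrow> 'v \<Rightarrow> 'v"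
  where "Rc x u v w = pd u (\<lambda>y. Ch y v w) x - pd v (\<lambda>y. Ch y u w) x
    + Ch x u (Ch x v w) - Ch x v (Ch x u w)"

lemmas G_simps = bilinear_ladd[OF G_bil] bilinear_radd[OF G_bil] bilinear_lmul[OF G_bil]
  bilinear_rmul[OF G_bil] bilinear_lsub[OF G_bil] bilinear_rsub[OF G_bil]
  bilinear_lzero[OF G_bil] bilinear_rzero[OF G_bil] bilinear_lneg[OF G_bil] bilinear_rneg[OF G_bil]

lemmas Ch_simps = bilinear_ladd[OF Ch_bil] bilinear_radd[OF Ch_bil] bilinear_lmul[OF Ch_bil]
  bilinear_rmul[OF Ch_bil] bilinear_lsub[OF Ch_bil] bilinear_rsub[OF Ch_bil]
  bilinear_lzero[OF Ch_bil] bilinear_rzero[OF Ch_bil] bilinear_lneg[OF Ch_bil] bilinear_rneg[OF Ch_bil]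

lemma curl_bil: "x \<in> U \<Longrightarrow> bilinear (curl th x)"
  by (rule curl_bilinear[OF open_U _ th_lin th_smooth])

lemma curl_smooth: "smooth_on U (\<lambda>x. curl th x u v)"
  unfolding curl_def by (intro smooth_on_diff open_U smooth_on_frechet th_smooth)

context
  fixes W :: "'e::real_normed_vector set" and h :: "'e \<Rightarrow> 'v"
  assumes open_W: "open W" and h_smooth: "smooth_on W h" and h_U: "h ` W \<subseteq> U"
begin

lemma in_U: "z \<in> W \<Longrightarrow> h z \<in> U" using h_U by blast

lemma smooth_along:
  assumes "smooth_on U f" shows "smooth_on W (\<lambda>z. f (h z))"
  by (rule smooth_on_compose[OF open_W open_U h_U assms h_smooth])

lemma pd_along:
  assumes "smooth_on U f" "z \<in> W" shows "pd e (\<lambda>z. f (h z)) z = pd (pd e h z) f (h z)"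
proof -
  have "((\<lambda>z. f (h z)) has_derivative (\<lambda>e. pd (pd e h z) f (h z))) (at z)"
    by (rule has_derivative_compose[of h _ z UNIV f, OF smooth_on_has_derivative[OF h_smooth assms(2)]
          smooth_on_has_derivative[OF assms(1) in_U[OF assms(2)]]])
  then show ?thesis by (simp add: frechet_eqI)
qed

lemma smooth_cov:
  assumes "smooth_on W p" shows "smooth_on W (cov h e p)"
proof -
  have "smooth_on W (\<lambda>z. Ch (h z) (pd e h z) (p z))"
    by (rule smooth_on_apply_bilinear[OF open_W Ch_bil[OF in_U] smooth_along[OF Ch_smooth]
          smooth_on_frechet[OF h_smooth] assms])
  then show ?thesis
    unfolding cov_def[abs_def] by (intro smooth_on_add open_W smooth_on_frechet assms)
qed

lemma smooth_G:
  assumes "smooth_on W p" "smooth_on W q" shows "smooth_on W (\<lambda>z. G (h z) (p z) (q z))"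
  by (rule smooth_on_apply_bilinear[OF open_W G_bil[OF in_U] smooth_along[OF G_smooth] assms])

lemma smooth_curl:
  assumes "smooth_on W p" "smooth_on W q" shows "smooth_on W (\<lambda>z. curl th (h z) (p z) (q z))"
  by (rule smooth_on_apply_bilinear[OF open_W curl_bil[OF in_U] smooth_along[OF curl_smooth] assms])

text \<open>By \<open>compat\<close>, differentiating the coefficients of \<open>G\<close> along
  \<open>h\<close> yields exactly the Christoffel terms that complete the derivatives of
  \<open>p\<close> and \<open>q\<close> to covariant ones.\<close>

lemma compat_along:
  assumes z: "z \<in> W" and p: "p differentiable (at z)" and q: "q differentiable (at z)"
  shows "((\<lambda>z. G (h z) (p z) (q z)) has_derivative
    (\<lambda>e. G (h z) (cov h e p z) (q z) + G (h z) (p z) (cov h e q z))) (at z)"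
proof -
  have "((\<lambda>z. G (h z) (p z) (q z)) has_derivative
    (\<lambda>e. pd e (\<lambda>y. G (h y) (p z) (q z)) z + G (h z) (pd e p z) (q z) + G (h z) (p z) (pd e q z))) (at z)"
    by (rule frechet_apply_bilinear[OF open_W z G_bil[OF in_U]
          smooth_on_differentiable[OF smooth_along[OF G_smooth] z] frechet_works[OF p] frechet_works[OF q]])
  moreover have "pd e (\<lambda>y. G (h y) u v) z = G (h z) (Ch (h z) (pd e h z) u) v + G (h z) u (Ch (h z) (pd e h z) v)"
    for e u v by (simp add: pd_along[OF G_smooth z] compat in_U z)
  ultimately show ?thesis
    by (simp add: cov_def G_simps in_U z algebra_simps)
qed

lemma cov_cong:
  assumes "open S" "z \<in> S" "\<And>y. y \<in> S \<Longrightarrow> p y = q y"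
  shows "cov h e p z = cov h e q z"
  using assms frechet_cong_open[OF assms] by (simp add: cov_def)

lemma cov_add:
  assumes "z \<in> W" "p differentiable (at z)" "q differentiable (at z)"
  shows "cov h e (\<lambda>y. p y + q y) z = cov h e p z + cov h e q z"
  using frechet_eqI[OF has_derivative_add[OF frechet_works[OF assms(2)] frechet_works[OF assms(3)]]]
  by (simp add: cov_def Ch_simps in_U assms(1))

lemma cov_scaleR:
  assumes "z \<in> W" "k differentiable (at z)" "p differentiable (at z)"
  shows "cov h e (\<lambda>y. k y *\<^sub>R p y) z = pd e k z *\<^sub>R p z + k z *\<^sub>R cov h e p z"
  using frechet_eqI[OF has_derivative_scaleR[OF frechet_works[OF assms(2)] frechet_works[OF assms(3)]]]
  by (simp add: cov_def Ch_simps in_U assms(1) algebra_simps)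

text \<open>\<open>T\<close> is parallel, so only the coefficient is differentiated.\<close>

lemma cov_T:
  assumes "z \<in> W" "k differentiable (at z)"
  shows "cov h e (\<lambda>y. k y *\<^sub>R T (h y)) z = pd e k z *\<^sub>R T (h z)"
proof -
  have "cov h e (\<lambda>y. T (h y)) z = 0"
    by (simp add: cov_def pd_along[OF T_smooth] assms T_parallel in_U)
  then show ?thesis
    by (subst cov_scaleR) (use assms smooth_on_differentiable[OF smooth_along[OF T_smooth]] in auto)
qed

text \<open>The mixed second derivatives of \<open>h\<close> agree, so only the antisymmetric part
  of \<open>Ch\<close> survives.\<close>

lemma torsion_along:
  assumes "z \<in> W"
  shows "cov h e1 (pd e2 h) z - cov h e2 (pd e1 h) z = curl th (h z) (pd e1 h z) (pd e2 h z) *\<^sub>R T (h z)"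
  using symmetric_second_derivative[OF open_W assms h_smooth, of e2 e1] torsion[OF in_U[OF assms]]
  by (simp add: cov_def)

lemma curvature_along:
  assumes z: "z \<in> W" and p: "smooth_on W p"
  shows "cov h e1 (cov h e2 p) z - cov h e2 (cov h e1 p) z = Rc (h z) (pd e1 h z) (pd e2 h z) (p z)"
proof -
  have "cov h e1 (cov h e2 p) z = pd e1 (pd e2 p) z
      + (pd (pd e1 h z) (\<lambda>y. Ch y (pd e2 h z) (p z)) (h z) + Ch (h z) (pd e1 (pd e2 h) z) (p z)
        + Ch (h z) (pd e2 h z) (pd e1 p z))
      + Ch (h z) (pd e1 h z) (pd e2 p z + Ch (h z) (pd e2 h z) (p z))" for e1 e2
  proof -
    have "((\<lambda>z. Ch (h z) (pd e2 h z) (p z)) has_derivative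
      (\<lambda>e. pd e (\<lambda>y. Ch (h y) (pd e2 h z) (p z)) z + Ch (h z) (pd e (pd e2 h) z) (p z) +
        Ch (h z) (pd e2 h z) (pd e p z))) (at z)"
      by (rule frechet_apply_bilinear[OF open_W z Ch_bil[OF in_U]
            smooth_on_differentiable[OF smooth_along[OF Ch_smooth] z]
            smooth_on_has_derivative[OF smooth_on_frechet[OF h_smooth] z] smooth_on_has_derivative[OF p z]])
    from frechet_eqI[OF has_derivative_add[OF smooth_on_has_derivative[OF smooth_on_frechet[OF p] z] this], of e2]
    have "pd e1 (cov h e2 p) z = pd e1 (pd e2 p) z + (pd e1 (\<lambda>y. Ch (h y) (pd e2 h z) (p z)) z
        + Ch (h z) (pd e1 (pd e2 h) z) (p z) + Ch (h z) (pd e2 h z) (pd e1 p z))"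
      unfolding cov_def[abs_def] by simp
    then show ?thesis
      by (simp add: cov_def pd_along[OF Ch_smooth z])
  qed
  \<comment> \<open>The mixed second derivatives of \<open>h\<close> and of \<open>p\<close> cancel
    in the commutator, and the terms with one derivative of \<open>p\<close> are symmetric in the
    two directions.\<close>
  then show ?thesis
    using symmetric_second_derivative[OF open_W z h_smooth, of e2 e1]
      symmetric_second_derivative[OF open_W z p, of e2 e1]
    by (simp add: Rc_def Ch_simps in_U z)
qed

end

section \<open>Symmetries of the curvature\<close>

lemma Rc_linear:
  assumes x: "x \<in> U"
  shows "linear (\<lambda>u. Rc x u v w)" "linear (\<lambda>w. Rc x u v w)"
proof -
  have D: "((\<lambda>y. Ch y u v) has_derivative (\<lambda>e. pd e (\<lambda>y. Ch y u v) x)) (at x)" for u v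
    using Ch_smooth x by (rule smooth_on_has_derivative)
  have c: "pd e f x = pd e g x" if "\<And>y. y \<in> U \<Longrightarrow> f y = g y" for f g :: "'v \<Rightarrow> 'v" and e
    using frechet_cong_open[OF open_U x that] by simp
  have a: "pd e (\<lambda>y. Ch y (u + u') v) x = pd e (\<lambda>y. Ch y u v) x + pd e (\<lambda>y. Ch y u' v) x"
    "pd e (\<lambda>y. Ch y v (u + u')) x = pd e (\<lambda>y. Ch y v u) x + pd e (\<lambda>y. Ch y v u') x" for e u u' v
    using c[of "\<lambda>y. Ch y (u + u') v" "\<lambda>y. Ch y u v + Ch y u' v" e]
      c[of "\<lambda>y. Ch y v (u + u')" "\<lambda>y. Ch y v u + Ch y v u'" e]
    by (simp_all add: Ch_simps frechet_eqI[OF has_derivative_add[OF D D]])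
  have b: "pd e (\<lambda>y. Ch y (k *\<^sub>R u) v) x = k *\<^sub>R pd e (\<lambda>y. Ch y u v) x"
    "pd e (\<lambda>y. Ch y v (k *\<^sub>R u)) x = k *\<^sub>R pd e (\<lambda>y. Ch y v u) x" for e u k v
    using c[of "\<lambda>y. Ch y (k *\<^sub>R u) v" "\<lambda>y. k *\<^sub>R Ch y u v" e]
      c[of "\<lambda>y. Ch y v (k *\<^sub>R u)" "\<lambda>y. k *\<^sub>R Ch y v u" e]
    by (simp_all add: Ch_simps frechet_eqI[OF has_derivative_scaleR_right[OF D]])
  note l = pd_linear[OF Ch_smooth x]
  show "linear (\<lambda>u. Rc x u v w)" "linear (\<lambda>w. Rc x u v w)"
    unfolding Rc_def
    by (auto intro!: linearI simp: a b linear_add[OF l] linear_scale[OF l] Ch_simps x algebra_simps)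
qed

lemma Rc_antisym: "Rc x u v w = - Rc x v u w"
  by (simp add: Rc_def)

text \<open>The second derivatives of \<open>G y w w\<close> commute, and by metric compatibility
  their commutator is \<open>2 * G x (Rc x u v w) w\<close>.\<close>

lemma Rc_skew_diag:
  assumes x: "x \<in> U" shows "G x (Rc x u v w) w = 0"
proof -
  have pid: "pd e (\<lambda>y. y) y = e" for e y :: 'v
    by (simp add: frechet_eqI[OF has_derivative_ident])
  have pc: "pd e (\<lambda>y. c) y = 0" for e y :: 'v and c :: 'v
    by (simp add: frechet_eqI[OF has_derivative_const])
  \<comment> \<open>A field with constant coefficients is regarded as a field along the identity map
    of \<open>U\<close>, so that \<open>compat_along\<close> applies to it.\<close>
  have covc: "cov (\<lambda>y. y) e (\<lambda>y. c) y = Ch y e c" for e c y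
    by (simp add: cov_def pid pc)
  note ca = compat_along[OF open_U smooth_on_id, simplified]
  have d: "pd v (\<lambda>y. G y w w) y = 2 * G y (Ch y v w) w" if "y \<in> U" for v y
    using compat[OF that] G_sym[OF that] by simp
  have sm: "smooth_on U (\<lambda>y. G y (Ch y v w) w)" for v
    by (rule smooth_G[OF open_U smooth_on_id]) (auto intro: Ch_smooth smooth_on_const)
  have dd: "pd u (pd v (\<lambda>y. G y w w)) x = 2 * (G x (cov (\<lambda>y. y) u (\<lambda>y. Ch y v w) x) w + G x (Ch x v w) (Ch x u w))"
    for u v
  proof -
    have "pd u (pd v (\<lambda>y. G y w w)) x = pd u (\<lambda>y. 2 * G y (Ch y v w) w) x"
      using frechet_cong_open[OF open_U x d] by simp
    also have "\<dots> = 2 * pd u (\<lambda>y. G y (Ch y v w) w) x"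
      using frechet_eqI[OF has_derivative_mult_right[OF smooth_on_has_derivative[OF sm x]]] by simp
    also have "pd u (\<lambda>y. G y (Ch y v w) w) x = G x (cov (\<lambda>y. y) u (\<lambda>y. Ch y v w) x) w + G x (Ch x v w) (Ch x u w)"
      using frechet_eqI[OF ca[OF x, of "\<lambda>y. Ch y v w" "\<lambda>y. w"]] smooth_on_differentiable[OF Ch_smooth x]
      by (simp add: covc)
    finally show ?thesis .
  qed
  have "G x (cov (\<lambda>y. y) u (\<lambda>y. Ch y v w) x) w + G x (Ch x v w) (Ch x u w) =
      G x (cov (\<lambda>y. y) v (\<lambda>y. Ch y u w) x) w + G x (Ch x u w) (Ch x v w)"
    using symmetric_second_derivative[OF open_U x G_smooth, of w w v u] unfolding dd by simp
  then show ?thesis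
    by (simp add: Rc_def cov_def pid G_simps x G_sym[OF x, of "Ch x u w" "Ch x v w"])
qed

text \<open>Polarization of \<open>Rc_skew_diag\<close>.\<close>

lemma Rc_skew:
  assumes x: "x \<in> U" shows "G x (Rc x u v w) z = - G x (Rc x u v z) w"
  using Rc_skew_diag[OF x, of u v "w + z"] Rc_skew_diag[OF x, of u v w] Rc_skew_diag[OF x, of u v z]
  by (simp add: linear_add[OF Rc_linear(2)] G_simps x)

text \<open>Differentiating the torsion identity gives the derivative terms of the cyclic sum. The
  derivative of \<open>T\<close> in it equals minus a Christoffel term, because \<open>T\<close> is
  parallel, and cancels against the terms quadratic in \<open>Ch\<close>. A multiple of
  \<open>T\<close> remains whose factor is the cyclic derivative of \<open>curl th\<close>.\<close>

lemma Rc_bianchi: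
  assumes x: "x \<in> U" shows "Rc x u v w + Rc x v w u + Rc x w u v = 0"
proof -
  have k: "pd u (\<lambda>y. Ch y v w) x - pd u (\<lambda>y. Ch y w v) x =
      pd u (\<lambda>y. curl th y v w) x *\<^sub>R T x - curl th x v w *\<^sub>R Ch x u (T x)" for u v w
  proof -
    have "((\<lambda>y. Ch y v w - Ch y w v) has_derivative
        (\<lambda>e. pd e (\<lambda>y. Ch y v w) x - pd e (\<lambda>y. Ch y w v) x)) (at x)"
      by (intro has_derivative_diff smooth_on_has_derivative[OF Ch_smooth x])
    then have "pd u (\<lambda>y. Ch y v w) x - pd u (\<lambda>y. Ch y w v) x = pd u (\<lambda>y. Ch y v w - Ch y w v) x"
      by (simp add: frechet_eqI)
    also have "\<dots> = pd u (\<lambda>y. curl th y v w *\<^sub>R T y) x"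
      by (subst frechet_cong_open[OF open_U x torsion]) auto
    also have "\<dots> = pd u (\<lambda>y. curl th y v w) x *\<^sub>R T x + curl th x v w *\<^sub>R pd u T x"
      using frechet_eqI[OF has_derivative_scaleR[OF smooth_on_has_derivative[OF curl_smooth x]
            smooth_on_has_derivative[OF T_smooth x]], of v w]
      by (simp add: algebra_simps)
    also have "pd u T x = - Ch x u (T x)"
      using T_parallel[OF x, of u] by (simp add: eq_neg_iff_add_eq_0)
    finally show ?thesis by simp
  qed
  have l: "Ch x u (Ch x v w) - Ch x u (Ch x w v) = curl th x v w *\<^sub>R Ch x u (T x)" for u v w
  proof -
    have "Ch x u (Ch x v w) - Ch x u (Ch x w v) = Ch x u (Ch x v w - Ch x w v)"
      by (simp add: Ch_simps x)
    then show ?thesis by (simp add: torsion Ch_simps x)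
  qed
  have c: "pd u (\<lambda>y. curl th y v w) x = pd u (pd v (\<lambda>y. th y w)) x - pd u (pd w (\<lambda>y. th y v)) x" for u v w
    unfolding curl_def
    by (simp add: frechet_eqI[OF has_derivative_diff[OF smooth_on_has_derivative[OF smooth_on_frechet[OF th_smooth] x]
            smooth_on_has_derivative[OF smooth_on_frechet[OF th_smooth] x]]])
  \<comment> \<open>The exterior derivative of \<open>curl th\<close> vanishes: its six second
    derivatives of \<open>th\<close> cancel in pairs.\<close>
  have "pd u (\<lambda>y. curl th y v w) x + pd v (\<lambda>y. curl th y w u) x + pd w (\<lambda>y. curl th y u v) x = 0"
    using symmetric_second_derivative[OF open_U x th_smooth, of u w v]
      symmetric_second_derivative[OF open_U x th_smooth, of v u w]
      symmetric_second_derivative[OF open_U x th_smooth, of w v u]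
    by (simp add: c)
  then have "(pd u (\<lambda>y. curl th y v w) x + pd v (\<lambda>y. curl th y w u) x + pd w (\<lambda>y. curl th y u v) x) *\<^sub>R T x = 0"
    by simp
  moreover have "Rc x u v w + Rc x v w u + Rc x w u v =
      (pd u (\<lambda>y. Ch y v w) x - pd u (\<lambda>y. Ch y w v) x) + (pd v (\<lambda>y. Ch y w u) x - pd v (\<lambda>y. Ch y u w) x)
      + (pd w (\<lambda>y. Ch y u v) x - pd w (\<lambda>y. Ch y v u) x)
      + (Ch x u (Ch x v w) - Ch x u (Ch x w v)) + (Ch x v (Ch x w u) - Ch x v (Ch x u w))
      + (Ch x w (Ch x u v) - Ch x w (Ch x v u))"
    by (simp add: Rc_def)
  ultimately show ?thesis
    unfolding k l by (simp add: scaleR_add_left)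
qed

text \<open>In the Bianchi sum paired with \<open>v\<close>, the summand with \<open>v\<close> in
  both of the last two places drops out by skewness. The other two summands are the two sides of the
  claim, up to sign, after skewness is applied once more.\<close>

lemma Rc_pair_symmetric:
  assumes x: "x \<in> U" shows "G x (Rc x u v v) w = G x (Rc x w v v) u"
proof -
  have "G x (Rc x v w u + Rc x w u v + Rc x u v w) v = 0"
    by (simp add: Rc_bianchi x G_simps)
  then have "G x (Rc x v w u) v + G x (Rc x u v w) v = 0"
    by (simp add: G_simps x Rc_skew_diag)
  moreover have "G x (Rc x v w u) v = G x (Rc x w v v) u"
    using Rc_skew[OF x, of v w u v] Rc_antisym[of x v w v] by (simp add: G_simps x)
  ultimately show ?thesis using Rc_skew[OF x, of u v w v] by simp
qed

text \<open>\<open>t\<close> is the curve parameter and \<open>s\<close> the variation parameter of \<open>h (t, s)\<close>.\<close>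

lemma second_variation_point:
  fixes h :: "real \<times> real \<Rightarrow> 'v" and W z
  defines "ht \<equiv> pd (1, 0) h" and "hs \<equiv> pd (0, 1) h"
  defines "F \<equiv> \<lambda>z. G (h z) (ht z) (ht z)" and "phi \<equiv> \<lambda>z. G (h z) (cov h (0, 1) hs z) (ht z)"
  defines "D \<equiv> cov h (1, 0) hs z"
  assumes W: "open W" "smooth_on W h" "h ` W \<subseteq> U" and z: "z \<in> W"
    and hor: "th (h z) (ht z) = 0" and geo: "cov h (1, 0) ht z = 0"
  shows "pd (0, 1) F z = 2 * G (h z) D (ht z)"
    and "pd (0, 1) (pd (0, 1) F) z = 2 * (pd (1, 0) phi z + G (h z) (Rc (h z) (hs z) (ht z) (hs z)) (ht z)
      + G (h z) (D + curl th (h z) (hs z) (ht z) *\<^sub>R T (h z)) (D + curl th (h z) (hs z) (ht z) *\<^sub>R T (h z)))"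
proof -
  note al = compat_along[OF W] and sc = smooth_cov[OF W]
  have sm: "smooth_on W ht" "smooth_on W hs"
    unfolding ht_def hs_def by (rule smooth_on_frechet[OF W(2)])+
  have U: "h y \<in> U" if "y \<in> W" for y using W(3) that by blast
  define k where "k y = curl th (h y) (hs y) (ht y)" for y
  have sk: "smooth_on W k" unfolding k_def by (rule smooth_curl[OF W sm(2,1)])
  \<comment> \<open>This holds on all of \<open>W\<close>, so it can be differentiated once more in
    \<open>s\<close>; horizontality and the geodesic equation are used at \<open>z\<close>
    alone.\<close>
  have tor: "cov h (0, 1) ht y = cov h (1, 0) hs y + k y *\<^sub>R T (h y)" if "y \<in> W" for y
    using torsion_along[OF W that, of "(0, 1)" "(1, 0)"] by (simp add: hs_def ht_def k_def algebra_simps)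
  have F1: "pd (0, 1) F y = 2 * G (h y) (cov h (0, 1) ht y) (ht y)" if "y \<in> W" for y
    using frechet_eqI[OF al[OF that, of ht ht]] smooth_on_differentiable[OF sm(1) that] G_sym[OF U[OF that]]
    by (simp add: F_def)
  show "pd (0, 1) F z = 2 * G (h z) D (ht z)"
    using hor by (simp add: F1[OF z] tor[OF z] G_simps U z T_dual D_def)
  have "pd (0, 1) (pd (0, 1) F) z = pd (0, 1) (\<lambda>y. 2 * G (h y) (cov h (0, 1) ht y) (ht y)) z"
    using frechet_cong_open[OF W(1) z F1] by simp
  also have "\<dots> = 2 * (G (h z) (cov h (0, 1) (cov h (0, 1) ht) z) (ht z)
      + G (h z) (cov h (0, 1) ht z) (cov h (0, 1) ht z))"
    using frechet_eqI[OF has_derivative_mult_right[OF al[OF z, of "cov h (0, 1) ht" ht], of 2]]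
      smooth_on_differentiable[OF sc[OF sm(1)] z] smooth_on_differentiable[OF sm(1) z] by simp
  also have "cov h (0, 1) (cov h (0, 1) ht) z = cov h (0, 1) (\<lambda>y. cov h (1, 0) hs y + k y *\<^sub>R T (h y)) z"
    by (rule cov_cong[OF W W(1) z tor])
  also have "\<dots> = cov h (0, 1) (cov h (1, 0) hs) z + pd (0, 1) k z *\<^sub>R T (h z)"
    using smooth_on_differentiable[OF sc[OF sm(2)] z] smooth_on_differentiable[OF sk z]
      smooth_on_differentiable[OF smooth_along[OF W T_smooth] z]
    by (simp add: cov_add[OF W z] cov_T[OF W z])
  also have "cov h (0, 1) (cov h (1, 0) hs) z = cov h (1, 0) (cov h (0, 1) hs) z + Rc (h z) (hs z) (ht z) (hs z)"
    using curvature_along[OF W z sm(2), of "(0, 1)" "(1, 0)"] by (simp add: hs_def ht_def algebra_simps)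
  \<comment> \<open>The derivative of \<open>k\<close> multiplies \<open>T\<close>, which is
    orthogonal to the velocity by \<open>hor\<close>. The derivative of \<open>phi\<close> has a
    second term, with the covariant derivative of the velocity, and \<open>geo\<close> removes
    it.\<close>
  also have "G (h z) (cov h (1, 0) (cov h (0, 1) hs) z + Rc (h z) (hs z) (ht z) (hs z) + pd (0, 1) k z *\<^sub>R T (h z)) (ht z)
      = pd (1, 0) phi z + G (h z) (Rc (h z) (hs z) (ht z) (hs z)) (ht z)"
    using frechet_eqI[OF al[OF z, of "cov h (0, 1) hs" ht]] smooth_on_differentiable[OF sc[OF sm(2)] z]
      smooth_on_differentiable[OF sm(1) z] geo hor
    by (simp add: phi_def G_simps U z T_dual)
  finally show "pd (0, 1) (pd (0, 1) F) z = 2 * (pd (1, 0) phi z + G (h z) (Rc (h z) (hs z) (ht z) (hs z)) (ht z)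
      + G (h z) (D + curl th (h z) (hs z) (ht z) *\<^sub>R T (h z)) (D + curl th (h z) (hs z) (ht z) *\<^sub>R T (h z)))"
    by (simp add: tor[OF z] D_def k_def)
qed

text \<open>Here \<open>- curl th x P c / 2\<close> is \<Omega>(P, c). Replacing \<open>v\<close> by
  its normal part \<open>P\<close> changes neither \<open>curl\<close> nor the curvature term,
  because both vanish on the tangential part. The subtracted square reduces the norm of
  \<open>D\<close> to that of its normal part \<open>DP\<close>, while \<theta> agrees on
  \<open>D\<close> and \<open>DP\<close> by \<open>hor\<close>.\<close>

lemma index_integrand_algebra:
  fixes D v c :: 'v and r :: real
  assumes x: "x \<in> U" and hor: "th x c = 0" and r: "r > 0" and len: "G x c c = r\<^sup>2"
  defines "P \<equiv> v - (1 / r\<^sup>2 * G x v c) *\<^sub>R c" and "DP \<equiv> D - (1 / r\<^sup>2 * G x D c) *\<^sub>R c"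
  shows "G x (Rc x v c v) c + G x (D + curl th x v c *\<^sub>R T x) (D + curl th x v c *\<^sub>R T x) - (G x D c)\<^sup>2 / r\<^sup>2 =
    G x DP DP - G x (Rc x P c c) P - 2 * (- curl th x P c / 2) * th x DP
      - 2 * (th x DP - 2 * (- curl th x P c / 2)) * (- curl th x P c / 2)"
proof -
  have cP: "curl th x P c = curl th x v c"
    by (simp add: P_def bilinear_lsub[OF curl_bil] bilinear_lmul[OF curl_bil] x curl_self)
  have tP: "th x DP = th x D"
    by (simp add: DP_def linear_diff[OF th_lin] linear_scale[OF th_lin] x hor)
  have Rcc: "Rc x c c w = 0" for w by (simp add: Rc_def)
  have RP: "Rc x P c c = Rc x v c c"
    by (simp add: P_def linear_diff[OF Rc_linear(1)] linear_scale[OF Rc_linear(1)] x Rcc)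
  have "G x (Rc x P c c) P = G x (Rc x v c c) v"
    unfolding RP by (simp add: P_def G_simps x Rc_skew_diag)
  then have R: "G x (Rc x P c c) P = - G x (Rc x v c v) c"
    using Rc_skew[OF x, of v c c v] by simp
  have DD: "G x DP DP = G x D D - (G x D c)\<^sup>2 / r\<^sup>2"
    using r by (simp add: DP_def G_simps x len G_sym[OF x, of c D] field_simps power2_eq_square)
  have A: "G x (D + a *\<^sub>R T x) (D + a *\<^sub>R T x) = G x D D + 2 * a * th x D + a\<^sup>2" for a
    using T_dual[OF x] th_T[OF x] G_sym[OF x, of D "T x"]
    by (simp add: G_simps x power2_eq_square algebra_simps)
  show ?thesis unfolding cP tP R DD A by (simp add: algebra_simps power2_eq_square)
qed

end

subsection \<open>Charts, fields and connections\<close>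

lemma sum_fun_apply: "(\<Sum>i\<in>I. f i) c = (\<Sum>i\<in>I. f i c)"
  for f :: "'i \<Rightarrow> 'a \<Rightarrow> 'b::comm_monoid_add"
  by (induction I rule: infinite_finite_induct) auto

lemma scaleR_fun_apply [simp]: "(r *\<^sub>R f) x = r *\<^sub>R f x"
  by (simp add: scaleR_fun_def)

locale atlas =
  fixes A :: "('p::topological_space, 'm::finite) chart set"
  assumes smooth_atlas: "smooth_atlas A"
begin

abbreviation J :: "('p, 'm) chart \<Rightarrow> ('p, 'm) chart \<Rightarrow> real^'m \<Rightarrow> real^'m \<Rightarrow> real^'m"
  where "J c c' x \<equiv> frechet_derivative (transition c c') (at x)"

lemma is_chart: "c \<in> A \<Longrightarrow> is_chart c"
  using smooth_atlas by (simp add: smooth_atlas_def)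

lemma open_chart: "c \<in> A \<Longrightarrow> open (fst c)" "c \<in> A \<Longrightarrow> open (snd c ` fst c)"
  using is_chart by (auto simp: is_chart_def)

lemma chart_inv_snd: "c \<in> A \<Longrightarrow> p \<in> fst c \<Longrightarrow> chart_inv c (snd c p) = p"
  using is_chart by (auto simp: is_chart_def homeomorphism_def)

lemma chart_inv_image:
  assumes "c \<in> A" "x \<in> snd c ` (V \<inter> fst c)"
  shows "chart_inv c x \<in> V" "chart_inv c x \<in> fst c" "snd c (chart_inv c x) = x"
  using assms chart_inv_snd[OF assms(1)] by auto

lemma chart_inv_dom:
  assumes "c \<in> A" "x \<in> snd c ` fst c"
  shows "chart_inv c x \<in> fst c" "snd c (chart_inv c x) = x"
  using assms chart_inv_snd[OF assms(1)] by auto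

lemma continuous_chart: "c \<in> A \<Longrightarrow> continuous_on (fst c) (snd c)"
  "c \<in> A \<Longrightarrow> continuous_on (snd c ` fst c) (chart_inv c)"
  using is_chart by (auto simp: is_chart_def homeomorphism_def)

lemma open_chart_image:
  assumes "c \<in> A" "open V" shows "open (snd c ` (V \<inter> fst c))"
proof -
  have "snd c ` (V \<inter> fst c) = snd c ` fst c \<inter> chart_inv c -` V"
    using chart_inv_snd[OF assms(1)] by auto
  then show ?thesis
    using continuous_open_preimage continuous_chart(2) open_chart(2) assms by metis
qed

lemma chart_at: "chart_at A p \<in> A" "p \<in> fst (chart_at A p)"
proof -
  have "\<exists>c. c \<in> A \<and> p \<in> fst c"
    using smooth_atlas unfolding smooth_atlas_def by blast
  then show "chart_at A p \<in> A" "p \<in> fst (chart_at A p)"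
    unfolding chart_at_def by (metis (mono_tags, lifting) someI_ex)+
qed

lemma transition_smooth:
  "c \<in> A \<Longrightarrow> c' \<in> A \<Longrightarrow> smooth_on (snd c ` (fst c' \<inter> fst c)) (transition c c')"
  using smooth_atlas by (simp add: smooth_atlas_def Int_commute)

lemma transition_snd: "c \<in> A \<Longrightarrow> p \<in> fst c \<Longrightarrow> transition c c' (snd c p) = snd c' p"
  by (simp add: transition_def chart_inv_snd)

lemma transition_eq: "transition c c' x = snd c' (chart_inv c x)"
  by (simp add: transition_def)

lemma transition_has_derivative:
  assumes "c \<in> A" "c' \<in> A" "p \<in> fst c" "p \<in> fst c'"
  shows "(transition c c' has_derivative J c c' (snd c p)) (at (snd c p))"
  by (rule smooth_on_has_derivative[OF transition_smooth[OF assms(1,2)]]) (use assms in auto)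

lemma J_linear:
  assumes "c \<in> A" "c' \<in> A" "p \<in> fst c" "p \<in> fst c'"
  shows "linear (J c c' (snd c p))"
  using transition_has_derivative[OF assms] by (rule has_derivative_linear)

lemma J_chain:
  assumes "c \<in> A" "c' \<in> A" "c'' \<in> A" "p \<in> fst c" "p \<in> fst c'" "p \<in> fst c''"
  shows "J c c'' (snd c p) u = J c' c'' (snd c' p) (J c c' (snd c p) u)"
proof -
  let ?S = "snd c ` ((fst c' \<inter> fst c'') \<inter> fst c)"
  have S: "open ?S" "snd c p \<in> ?S"
    using assms by (auto intro: open_chart_image open_chart)
  have "((\<lambda>y. transition c' c'' (transition c c' y)) has_derivative
      (\<lambda>u. J c' c'' (snd c' p) (J c c' (snd c p) u))) (at (snd c p))"
    by (rule has_derivative_compose[of "transition c c'" _ "snd c p" UNIV "transition c' c''"])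
      (use transition_has_derivative assms transition_snd in auto)
  then have "(transition c c'' has_derivative (\<lambda>u. J c' c'' (snd c' p) (J c c' (snd c p) u))) (at (snd c p))"
    by (rule has_derivative_transform_within_open[OF _ S])
      (use assms in \<open>auto simp: transition_snd\<close>)
  then show ?thesis by (simp add: frechet_eqI)
qed

lemma J_id:
  assumes "c \<in> A" "p \<in> fst c" shows "J c c (snd c p) u = u"
proof -
  have "(transition c c has_derivative (\<lambda>u. u)) (at (snd c p))"
    by (rule has_derivative_transform_within_open[OF has_derivative_ident open_chart(2)[OF assms(1)]])
      (use assms in \<open>auto simp: transition_snd\<close>)
  then show ?thesis by (simp add: frechet_eqI)
qed

lemma coord_vec_apply: "c' \<in> A \<Longrightarrow> p \<in> fst c' \<Longrightarrow> coord_vec A c u p c' = J c c' (snd c p) u"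
  by (simp add: coord_vec_def)

lemma coord_vec_self: "c \<in> A \<Longrightarrow> p \<in> fst c \<Longrightarrow> coord_vec A c u p c = u"
  by (simp add: coord_vec_apply J_id)

lemma coord_vec_tangent:
  assumes "c \<in> A" "p \<in> fst c" shows "coord_vec A c u p \<in> tangent_space A p"
  unfolding tangent_space_def
proof (safe)
  fix d e assume "d \<in> A" "e \<in> A" "p \<in> fst d" "p \<in> fst e"
  then show "coord_vec A c u p e = J d e (snd d p) (coord_vec A c u p d)"
    using assms by (simp add: coord_vec_apply J_chain[of c d e p])
qed (auto simp: coord_vec_def split: if_splits)

lemma tangentD:
  assumes "v \<in> tangent_space A p" "c \<in> A" "c' \<in> A" "p \<in> fst c" "p \<in> fst c'"
  shows "v c' = J c c' (snd c p) (v c)"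
  using assms unfolding tangent_space_def by blast

lemma tangent_0D: "v \<in> tangent_space A p \<Longrightarrow> \<not> (c \<in> A \<and> p \<in> fst c) \<Longrightarrow> v c = 0"
  unfolding tangent_space_def by blast

lemma tangentI:
  assumes "\<And>c c'. c \<in> A \<Longrightarrow> c' \<in> A \<Longrightarrow> p \<in> fst c \<Longrightarrow> p \<in> fst c' \<Longrightarrow> v c' = J c c' (snd c p) (v c)"
    "\<And>c. \<not> (c \<in> A \<and> p \<in> fst c) \<Longrightarrow> v c = 0"
  shows "v \<in> tangent_space A p"
  using assms unfolding tangent_space_def by blast

lemma tangent_coord_vec:
  assumes "v \<in> tangent_space A p" "c \<in> A" "p \<in> fst c"
  shows "coord_vec A c (v c) p = v"
proof
  fix d show "coord_vec A c (v c) p d = v d"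
  proof (cases "d \<in> A \<and> p \<in> fst d")
    case True
    then show ?thesis using tangentD[OF assms(1,2) _ assms(3), of d] by (simp add: coord_vec_apply)
  next
    case False
    then show ?thesis by (simp add: coord_vec_def tangent_0D[OF assms(1) False] del: de_Morgan_conj)
  qed
qed

lemma tangent_eqI:
  assumes "u \<in> tangent_space A p" "v \<in> tangent_space A p" "c \<in> A" "p \<in> fst c" "u c = v c"
  shows "u = v"
  using tangent_coord_vec assms by metis

lemma coord_vec_add: 
  assumes "c \<in> A" "p \<in> fst c"
  shows "coord_vec A c (u + v) p = coord_vec A c u p + coord_vec A c v p"
  using J_linear[OF assms(1) _ assms(2)] by (auto simp: coord_vec_def linear_add fun_eq_iff)

lemma coord_vec_scaleR:
  assumes "c \<in> A" "p \<in> fst c"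
  shows "coord_vec A c (k *\<^sub>R u) p = k *\<^sub>R coord_vec A c u p"
  using J_linear[OF assms(1) _ assms(2)] by (auto simp: coord_vec_def linear_scale fun_eq_iff)

lemma coord_vec_sum:
  assumes "c \<in> A" "p \<in> fst c"
  shows "coord_vec A c (\<Sum>i\<in>I. u i) p = (\<Sum>i\<in>I. coord_vec A c (u i) p)"
  using J_linear[OF assms(1) _ assms(2)]
  by (auto simp: coord_vec_def linear_sum fun_eq_iff sum_fun_apply)

lemma subspace_tangent: "subspace (tangent_space A p)"
proof (rule subspaceI)
  have lin: "linear (J c c' (snd c p))" if "c \<in> A" "c' \<in> A" "p \<in> fst c" "p \<in> fst c'" for c c'
    using J_linear that by blast
  show "0 \<in> tangent_space A p"
    by (rule tangentI) (simp_all add: linear_0[OF lin])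
  show "x + y \<in> tangent_space A p" if "x \<in> tangent_space A p" "y \<in> tangent_space A p" for x y
  proof (rule tangentI)
    fix c c' assume c: "c \<in> A" "c' \<in> A" "p \<in> fst c" "p \<in> fst c'"
    show "(x + y) c' = J c c' (snd c p) ((x + y) c)"
      using tangentD[OF that(1) c] tangentD[OF that(2) c] linear_add[OF lin[OF c]] by simp
  qed (simp add: tangent_0D[OF that(1)] tangent_0D[OF that(2)])
  show "k *\<^sub>R x \<in> tangent_space A p" if "x \<in> tangent_space A p" for k x
  proof (rule tangentI)
    fix c c' assume c: "c \<in> A" "c' \<in> A" "p \<in> fst c" "p \<in> fst c'"
    show "(k *\<^sub>R x) c' = J c c' (snd c p) ((k *\<^sub>R x) c)"
      using tangentD[OF that c] linear_scale[OF lin[OF c]] by simp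
  qed (simp add: tangent_0D[OF that])
qed

lemmas tangent_add = subspace_add[OF subspace_tangent]
  and tangent_diff = subspace_diff[OF subspace_tangent]
  and tangent_scaleR = subspace_scale[OF subspace_tangent]
  and tangent_neg = subspace_neg[OF subspace_tangent]
  and tangent_0 = subspace_0[OF subspace_tangent]

section \<open>Vector fields, brackets and directional derivatives in charts\<close>

lemma vector_field_tangent: "vector_field A V X \<Longrightarrow> p \<in> V \<Longrightarrow> X p \<in> tangent_space A p"
  by (simp add: vector_field_def)

lemma vector_field_comp:
  "vector_field A V X \<Longrightarrow> c \<in> A \<Longrightarrow> smooth_on (snd c ` (V \<inter> fst c)) (\<lambda>x. X (chart_inv c x) c)"
  by (simp add: vector_field_def smooth_comps_def)

lemma vector_field_subset:
  assumes "vector_field A V X" "open V'" "V' \<subseteq> V" shows "vector_field A V' X"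
proof -
  have "smooth_on (snd c ` (V' \<inter> fst c)) (\<lambda>x. X (chart_inv c x) c)" if "c \<in> A" for c
    by (rule smooth_on_subset[OF vector_field_comp[OF assms(1) that]]) (use assms(3) in blast)
  then show ?thesis using assms by (auto simp: vector_field_def smooth_comps_def)
qed

lemma smooth_in_other_chart:
  fixes f :: "real^'m \<Rightarrow> 'b::real_normed_vector"
  assumes "c \<in> A" "c' \<in> A" "open V" "V \<subseteq> fst c" "smooth_on (snd c ` V) f"
  shows "smooth_on (snd c' ` (V \<inter> fst c')) (\<lambda>x. f (transition c' c x))"
proof (rule smooth_on_compose[of _ "snd c ` V"])
  show "open (snd c' ` (V \<inter> fst c'))" by (intro open_chart_image assms)
  show "open (snd c ` V)" using open_chart_image[OF assms(1,3)] assms(4) by (simp add: Int_absorb2)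
  show "transition c' c ` (snd c' ` (V \<inter> fst c')) \<subseteq> snd c ` V"
    using assms by (auto simp: transition_snd)
  show "smooth_on (snd c' ` (V \<inter> fst c')) (transition c' c)"
    by (rule smooth_on_subset[OF transition_smooth[OF assms(2,1)]]) (use assms(4) in auto)
qed (fact assms(5))

lemma J_smooth:
  assumes "c \<in> A" "c' \<in> A"
  shows "smooth_on (snd c' ` (fst c \<inter> fst c')) (\<lambda>x. J c c' (transition c' c x) u)"
proof -
  have "smooth_on (snd c' ` ((fst c' \<inter> fst c) \<inter> fst c')) (\<lambda>x. J c c' (transition c' c x) u)"
    by (rule smooth_in_other_chart[OF assms, where f="\<lambda>y. J c c' y u"])
      (use assms in \<open>auto intro: open_chart smooth_on_frechet[OF transition_smooth]\<close>)
  then show ?thesis by (simp add: Int_commute Int_left_commute)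
qed

lemma vector_field_coord:
  assumes "c \<in> A" "open V" "V \<subseteq> fst c" "smooth_on (snd c ` V) y"
  shows "vector_field A V (\<lambda>q. coord_vec A c (y (snd c q)) q)"
  unfolding vector_field_def smooth_comps_def
proof (intro conjI ballI)
  show "coord_vec A c (y (snd c p)) p \<in> tangent_space A p" if "p \<in> V" for p
    using that assms by (auto intro: coord_vec_tangent)
  fix c' assume c': "c' \<in> A"
  let ?S = "snd c' ` (V \<inter> fst c')"
  have o: "open ?S" by (intro open_chart_image assms c')
  have "smooth_on ?S (\<lambda>x. J c c' (transition c' c x) (y (transition c' c x)))"
  proof (rule smooth_on_apply_linear[OF o, where L="\<lambda>x. J c c' (transition c' c x)" and p="\<lambda>x. y (transition c' c x)"])
    show "linear (J c c' (transition c' c x))" if x: "x \<in> ?S" for x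
    proof -
      obtain q where q: "x = snd c' q" "q \<in> V" "q \<in> fst c'" using x by blast
      then have "q \<in> fst c" using assms(3) by blast
      then show ?thesis using q assms(1) c' by (simp add: transition_snd J_linear)
    qed
    show "smooth_on ?S (\<lambda>x. J c c' (transition c' c x) u)" for u
      by (rule smooth_on_subset[OF J_smooth[OF assms(1) c']]) (use assms(3) in auto)
    show "smooth_on ?S (\<lambda>x. y (transition c' c x))"
      by (rule smooth_in_other_chart[OF assms(1) c' assms(2-4)])
  qed
  then show "smooth_on ?S (\<lambda>x. coord_vec A c (y (snd c (chart_inv c' x))) (chart_inv c' x) c')"
    by (rule smooth_on_cong[OF _ o])
      (use assms c' in \<open>auto simp: coord_vec_apply transition_snd chart_inv_snd\<close>)
qed (fact assms(2))

lemma vector_field_coord_const: "c \<in> A \<Longrightarrow> vector_field A (fst c) (coord_vec A c u)"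
  using vector_field_coord[of c "fst c" "\<lambda>_. u"] by (simp add: open_chart smooth_on_const)

lemma vector_field_add:
  assumes "vector_field A V X" "vector_field A V Y"
  shows "vector_field A V (\<lambda>q. X q + Y q)"
  using assms unfolding vector_field_def smooth_comps_def
  by (auto intro!: tangent_add smooth_on_add open_chart_image)

lemma smooth_fun_chart:
  assumes "c \<in> A" "open V" "V \<subseteq> fst c" "smooth_on (snd c ` V) f" "\<And>q. q \<in> V \<Longrightarrow> F q = f (snd c q)"
  shows "smooth_fun A V F"
  unfolding smooth_fun_def
proof
  fix c' assume c': "c' \<in> A"
  show "smooth_on (snd c' ` (V \<inter> fst c')) (F \<circ> chart_inv c')"
    by (rule smooth_on_cong[OF smooth_in_other_chart[OF assms(1) c' assms(2-4)] open_chart_image[OF c' assms(2)]])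
      (use assms c' in \<open>auto simp: transition_snd chart_inv_snd\<close>)
qed

lemma vector_field_scaleR:
  assumes "vector_field A V X" "smooth_fun A V f"
  shows "vector_field A V (\<lambda>q. f q *\<^sub>R X q)"
  using assms unfolding vector_field_def smooth_comps_def smooth_fun_def
  by (auto intro!: tangent_scaleR smooth_on_scaleR open_chart_image simp: comp_def)

lemma vector_field_0: "open V \<Longrightarrow> vector_field A V (\<lambda>q. 0)"
  by (auto simp: vector_field_def smooth_comps_def tangent_0 intro: smooth_on_const)

text \<open>In any other chart the bracket is a commutator of second derivatives of the transition
  map. Since \<open>ext_field\<close> extends by coordinate fields, the bracket disappears from
  torsion, curvature and exterior derivative.\<close>

lemma bracket_coord:
  assumes c: "c \<in> A" "p \<in> fst c"
  shows "bracket A (coord_vec A c u) (coord_vec A c v) p = 0"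
proof
  fix c'
  show "bracket A (coord_vec A c u) (coord_vec A c v) p c' = 0 c'"
  proof (cases "c' \<in> A \<and> p \<in> fst c'")
    case True
    let ?S = "snd c' ` (fst c \<inter> fst c')"
    have S: "open ?S" "snd c' p \<in> ?S"
      using True c by (auto intro: open_chart_image open_chart)
    have T: "smooth_on (snd c ` (fst c' \<inter> fst c)) (transition c c')"
      using True c by (intro transition_smooth) auto
    have oT: "open (snd c ` (fst c' \<inter> fst c))" "snd c p \<in> snd c ` (fst c' \<inter> fst c)"
      using True c by (auto intro: open_chart_image open_chart)
    have D: "frechet_derivative (\<lambda>x. coord_vec A c v (chart_inv c' x) c') (at (snd c' p)) (coord_vec A c u p c')
        = pd u (pd v (transition c c')) (snd c p)" for u v
    proof -
      have "((\<lambda>x. J c c' (transition c' c x) v) has_derivative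
          (\<lambda>w. pd (J c' c (snd c' p) w) (pd v (transition c c')) (snd c p))) (at (snd c' p))"
        by (rule has_derivative_compose[of "transition c' c" _ "snd c' p" UNIV "\<lambda>y. J c c' y v"])
          (use True c smooth_on_has_derivative[OF smooth_on_frechet[OF T] oT(2)] in
            \<open>auto simp: transition_snd intro: transition_has_derivative\<close>)
      then have "((\<lambda>x. coord_vec A c v (chart_inv c' x) c') has_derivative
          (\<lambda>w. pd (J c' c (snd c' p) w) (pd v (transition c c')) (snd c p))) (at (snd c' p))"
        by (rule has_derivative_transform_within_open[OF _ S])
          (use True c in \<open>auto simp: coord_vec_apply transition_snd chart_inv_snd\<close>)
      moreover have "J c' c (snd c' p) (coord_vec A c u p c') = u"
        using True c by (simp add: coord_vec_apply J_id flip: J_chain)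
      ultimately show ?thesis by (simp add: frechet_eqI)
    qed
    show ?thesis
      using True D[of v u] D[of u v] symmetric_second_derivative[OF oT T, of v u]
      by (simp add: bracket_def)
  next
    case False
    show ?thesis unfolding bracket_def by (simp only: False if_False zero_fun_apply)
  qed
qed

text \<open>The definition uses the chart selected at \<open>p\<close>; the chain rule through a
  transition map gives the same value in any chart around \<open>p\<close>.\<close>

lemma dir_deriv_chart:
  assumes c: "c \<in> A" "p \<in> fst c" and v: "v \<in> tangent_space A p"
    and f: "(f \<circ> chart_inv c) differentiable (at (snd c p))"
  shows "dir_deriv A p v f = frechet_derivative (f \<circ> chart_inv c) (at (snd c p)) (v c)"
proof -
  let ?c = "chart_at A p"
  let ?S = "snd ?c ` (fst c \<inter> fst ?c)"
  have S: "open ?S" "snd ?c p \<in> ?S"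
    using c chart_at by (auto intro: open_chart_image open_chart)
  have "((\<lambda>x. (f \<circ> chart_inv c) (transition ?c c x)) has_derivative
      (\<lambda>w. pd (J ?c c (snd ?c p) w) (f \<circ> chart_inv c) (snd c p))) (at (snd ?c p))"
    by (rule has_derivative_compose[of "transition ?c c" _ "snd ?c p" UNIV "f \<circ> chart_inv c"])
      (use chart_at c frechet_works[OF f] in \<open>auto simp: transition_snd comp_def intro: transition_has_derivative\<close>)
  then have "((f \<circ> chart_inv ?c) has_derivative
      (\<lambda>w. pd (J ?c c (snd ?c p) w) (f \<circ> chart_inv c) (snd c p))) (at (snd ?c p))"
    by (rule has_derivative_transform_within_open[OF _ S])
      (use chart_at c in \<open>auto simp: transition_snd chart_inv_snd\<close>)
  then show ?thesis
    by (simp add: dir_deriv_def Let_def frechet_eqI tangentD[OF v chart_at(1) c(1) chart_at(2) c(2)])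
qed

lemma ext_field:
  assumes "v \<in> tangent_space A p"
  shows "vector_field A (fst (chart_at A p)) (ext_field A p v)" "ext_field A p v p = v"
    "ext_field A p v = coord_vec A (chart_at A p) (v (chart_at A p))"
  using assms chart_at by (simp_all add: ext_field_def vector_field_coord_const tangent_coord_vec)

end

section \<open>Linear connections in charts\<close>

locale connection_atlas = atlas A for A :: "('p::topological_space, 'm::finite) chart set" +
  fixes nabla :: "('p, 'm) connection"
  assumes linear_connection: "linear_connection A nabla"
begin

text \<open>The Christoffel symbols of \<open>nabla\<close> in the chart \<open>c\<close>, as a
  bilinear map on component vectors.\<close>

definition Chr :: "('p, 'm) chart \<Rightarrow> real^'m \<Rightarrow> real^'m \<Rightarrow> real^'m \<Rightarrow> real^'m"
  where "Chr c x u w = nabla (chart_inv c x) (coord_vec A c u (chart_inv c x)) (coord_vec A c w) c"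

lemma
  assumes "vector_field A V Y" "p \<in> V" "v \<in> tangent_space A p"
  shows nabla_tangent: "nabla p v Y \<in> tangent_space A p"
    and nabla_add_left: "\<And>w. w \<in> tangent_space A p \<Longrightarrow> nabla p (v + w) Y = nabla p v Y + nabla p w Y"
    and nabla_scaleR_left: "\<And>k. nabla p (k *\<^sub>R v) Y = k *\<^sub>R nabla p v Y"
    and nabla_add: "\<And>Y'. vector_field A V Y' \<Longrightarrow> nabla p v (\<lambda>q. Y q + Y' q) = nabla p v Y + nabla p v Y'"
    and nabla_leibniz: "\<And>f. smooth_fun A V f \<Longrightarrow>
      nabla p v (\<lambda>q. f q *\<^sub>R Y q) = dir_deriv A p v f *\<^sub>R Y p + f p *\<^sub>R nabla p v Y"
    and nabla_cong: "\<And>Y'. (\<And>q. q \<in> V \<Longrightarrow> Y' q = Y q) \<Longrightarrow> nabla p v Y' = nabla p v Y"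
proof -
  note L = linear_connection[unfolded linear_connection_def, THEN conjunct1, THEN spec, THEN spec, THEN mp,
      OF assms(1), THEN bspec, OF assms(2), THEN bspec, OF assms(3)]
  note L1 = L[THEN conjunct2] note L2 = L1[THEN conjunct2] note L3 = L2[THEN conjunct2]
  note L4 = L3[THEN conjunct2] note L5 = L4[THEN conjunct2]
  show "nabla p v Y \<in> tangent_space A p" using L by (rule conjunct1)
  show "nabla p (v + w) Y = nabla p v Y + nabla p w Y" if "w \<in> tangent_space A p" for w
    using L1[THEN conjunct1] that by (rule bspec)
  show "nabla p (k *\<^sub>R v) Y = k *\<^sub>R nabla p v Y" for k
    using L2[THEN conjunct1] by (rule spec)
  show "nabla p v (\<lambda>q. Y q + Y' q) = nabla p v Y + nabla p v Y'" if "vector_field A V Y'" for Y'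
    using L3[THEN conjunct1, THEN spec, THEN mp, OF that] .
  show "nabla p v (\<lambda>q. f q *\<^sub>R Y q) = dir_deriv A p v f *\<^sub>R Y p + f p *\<^sub>R nabla p v Y"
    if "smooth_fun A V f" for f
    using L4[THEN conjunct1, THEN spec, THEN mp, OF that] .
  show "nabla p v Y' = nabla p v Y" if "\<And>q. q \<in> V \<Longrightarrow> Y' q = Y q" for Y'
    by (rule L5[THEN spec, THEN mp]) (use that in blast)
qed

lemma nabla_field: "vector_field A V X \<Longrightarrow> vector_field A V Y \<Longrightarrow> vector_field A V (\<lambda>q. nabla q (X q) Y)"
  using linear_connection[unfolded linear_connection_def, THEN conjunct2, THEN spec, THEN spec, THEN spec, THEN mp]
  by (simp only:)

text \<open>Additivity of \<open>nabla\<close> is given for vector fields only, so the induction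
  must also carry that the partial sums are vector fields. The empty sum is settled by 0 = 0 +
  0.\<close>

lemma nabla_sum:
  assumes "open V" "p \<in> V" "v \<in> tangent_space A p" "finite I" "\<And>i. i \<in> I \<Longrightarrow> vector_field A V (Z i)"
  shows "vector_field A V (\<lambda>q. \<Sum>i\<in>I. Z i q) \<and> nabla p v (\<lambda>q. \<Sum>i\<in>I. Z i q) = (\<Sum>i\<in>I. nabla p v (Z i))"
  using assms(4,5)
proof (induction I)
  case empty
  have z: "vector_field A V (\<lambda>q. 0)" using assms(1) by (rule vector_field_0)
  have "nabla p v (\<lambda>q. 0) = nabla p v (\<lambda>q. 0) + nabla p v (\<lambda>q. 0)"
    using nabla_add[OF z assms(2,3) z] by simp
  then have "nabla p v (\<lambda>q. 0) = 0" by simp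
  then show ?case using z by (simp only: sum.empty)
next
  case (insert i I)
  then have f: "vector_field A V (Z i)" "vector_field A V (\<lambda>q. \<Sum>i\<in>I. Z i q)"
    and n: "nabla p v (\<lambda>q. \<Sum>i\<in>I. Z i q) = (\<Sum>i\<in>I. nabla p v (Z i))" by blast+
  show ?case
    unfolding sum.insert[OF insert.hyps] using vector_field_add[OF f] nabla_add[OF f(1) assms(2,3) f(2)] n
    by (simp only:)
qed

lemma Chr_bilinear:
  assumes c: "c \<in> A" "x \<in> snd c ` fst c" shows "bilinear (Chr c x)"
proof -
  let ?p = "chart_inv c x"
  have p: "?p \<in> fst c" using chart_inv_dom[OF c] by blast
  note f = vector_field_coord_const[OF c(1)] and t = coord_vec_tangent[OF c(1) p]
  have "Chr c x (u + v) w = Chr c x u w + Chr c x v w" for u v w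
    by (simp add: Chr_def coord_vec_add c p nabla_add_left[OF f p t t])
  moreover have "Chr c x (k *\<^sub>R u) w = k *\<^sub>R Chr c x u w" for u w k
    by (simp add: Chr_def coord_vec_scaleR c p nabla_scaleR_left[OF f p t])
  moreover have "Chr c x u (v + w) = Chr c x u v + Chr c x u w" for u v w
  proof -
    have "nabla ?p (coord_vec A c u ?p) (coord_vec A c (v + w)) =
        nabla ?p (coord_vec A c u ?p) (\<lambda>q. coord_vec A c v q + coord_vec A c w q)"
      by (rule nabla_cong[OF vector_field_add[OF f f] p t]) (rule coord_vec_add[OF c(1)])
    then show ?thesis by (simp add: Chr_def nabla_add[OF f p t f])
  qed
  moreover have "Chr c x u (k *\<^sub>R w) = k *\<^sub>R Chr c x u w" for u w k
  proof -
    have s: "smooth_fun A (fst c) (\<lambda>q. k)"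
      by (auto simp: smooth_fun_def comp_def intro: smooth_on_const)
    have "nabla ?p (coord_vec A c u ?p) (coord_vec A c (k *\<^sub>R w)) =
        nabla ?p (coord_vec A c u ?p) (\<lambda>q. k *\<^sub>R coord_vec A c w q)"
      by (rule nabla_cong[OF vector_field_scaleR[OF f s] p t]) (rule coord_vec_scaleR[OF c(1)])
    moreover have "dir_deriv A ?p v (\<lambda>q. k) = 0" for v
      by (simp add: dir_deriv_def comp_def Let_def frechet_eqI[OF has_derivative_const])
    ultimately show ?thesis by (simp add: Chr_def nabla_leibniz[OF f p t s])
  qed
  ultimately show ?thesis by (simp add: bilinear_def linear_iff)
qed

lemma Chr_smooth: assumes "c \<in> A" shows "smooth_on (snd c ` fst c) (\<lambda>x. Chr c x u w)"
  unfolding Chr_def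
  using vector_field_comp[OF nabla_field[OF vector_field_coord_const vector_field_coord_const] assms, OF assms assms, of u w]
  by simp

text \<open>Near \<open>p\<close> the field is expanded in the coordinate fields of
  \<open>c\<close>; the Leibniz rule differentiates the components, and the derivatives of the
  coordinate fields form the Christoffel term.\<close>

lemma nabla_chart:
  assumes Y: "vector_field A V Y" and p: "p \<in> V" and c: "c \<in> A" "p \<in> fst c"
    and v: "v \<in> tangent_space A p"
  shows "nabla p v Y c =
    frechet_derivative (\<lambda>x. Y (chart_inv c x) c) (at (snd c p)) (v c) + Chr c (snd c p) (v c) (Y p c)"
proof -
  let ?V = "V \<inter> fst c"
  let ?y = "\<lambda>x. Y (chart_inv c x) c"
  have oV: "open V" using Y by (simp add: vector_field_def)
  have V: "open ?V" "p \<in> ?V" "?V \<subseteq> fst c" using oV p c by (simp_all add: open_Int open_chart)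
  have ys: "smooth_on (snd c ` ?V) ?y" by (rule vector_field_comp[OF Y c(1)])
  have o: "open (snd c ` ?V)" by (rule open_chart_image[OF c(1) oV])
  have ym: "smooth_on (snd c ` ?V) (\<lambda>x. ?y x \<bullet> b)" for b
    by (rule smooth_on_linear_comp[OF bounded_linear_inner_left o ys])
  have s: "smooth_fun A ?V (\<lambda>q. Y q c \<bullet> b)" for b
    by (rule smooth_fun_chart[OF c(1) V(1,3) ym]) (simp add: chart_inv_snd c)
  have f: "vector_field A ?V (coord_vec A c b)" for b
    by (rule vector_field_subset[OF vector_field_coord_const[OF c(1)] V(1,3)])
  have fs: "vector_field A ?V (\<lambda>q. (Y q c \<bullet> b) *\<^sub>R coord_vec A c b q)" for b
    by (rule vector_field_scaleR[OF f s])
  have "Y q = (\<Sum>b\<in>Basis. (Y q c \<bullet> b) *\<^sub>R coord_vec A c b q)" if "q \<in> ?V" for q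
  proof -
    have "Y q = coord_vec A c (\<Sum>b\<in>Basis. (Y q c \<bullet> b) *\<^sub>R b) q"
      using that tangent_coord_vec[OF vector_field_tangent[OF Y] c(1)] by (simp add: euclidean_representation)
    then show ?thesis using that c by (simp add: coord_vec_sum coord_vec_scaleR)
  qed
  then have "nabla p v Y = nabla p v (\<lambda>q. \<Sum>b\<in>Basis. (Y q c \<bullet> b) *\<^sub>R coord_vec A c b q)"
    by (rule nabla_cong[OF conjunct1[OF nabla_sum[OF V(1,2) v finite_Basis fs]] V(2) v])
  also have "\<dots> = (\<Sum>b\<in>Basis. nabla p v (\<lambda>q. (Y q c \<bullet> b) *\<^sub>R coord_vec A c b q))"
    by (rule conjunct2[OF nabla_sum[OF V(1,2) v finite_Basis fs]])
  also have "\<dots> = (\<Sum>b\<in>Basis. dir_deriv A p v (\<lambda>q. Y q c \<bullet> b) *\<^sub>R coord_vec A c b p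
      + (Y p c \<bullet> b) *\<^sub>R nabla p v (coord_vec A c b))"
    by (simp add: nabla_leibniz[OF f V(2) v s])
  finally have "nabla p v Y c = (\<Sum>b\<in>Basis. dir_deriv A p v (\<lambda>q. Y q c \<bullet> b) *\<^sub>R b
      + (Y p c \<bullet> b) *\<^sub>R nabla p v (coord_vec A c b) c)"
    by (simp add: sum_fun_apply coord_vec_self c)
  also have "\<dots> = (\<Sum>b\<in>Basis. (frechet_derivative ?y (at (snd c p)) (v c) \<bullet> b) *\<^sub>R b)
      + (\<Sum>b\<in>Basis. (Y p c \<bullet> b) *\<^sub>R Chr c (snd c p) (v c) b)"
  proof -
    have x: "snd c p \<in> snd c ` ?V" using V by blast
    have "dir_deriv A p v (\<lambda>q. Y q c \<bullet> b) = frechet_derivative ?y (at (snd c p)) (v c) \<bullet> b" for b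
      using dir_deriv_chart[OF c v, of "\<lambda>q. Y q c \<bullet> b"] smooth_on_differentiable[OF ym[of b] x]
        frechet_eqI[OF bounded_linear.has_derivative[OF bounded_linear_inner_left smooth_on_has_derivative[OF ys x]], of b]
      by (simp add: comp_def)
    then show ?thesis
      by (simp add: sum.distrib Chr_def chart_inv_snd c tangent_coord_vec v)
  qed
  also have "(\<Sum>b\<in>Basis. (Y p c \<bullet> b) *\<^sub>R Chr c (snd c p) (v c) b) = Chr c (snd c p) (v c) (Y p c)"
  proof -
    have "linear (Chr c (snd c p) (v c))"
      using Chr_bilinear[of c "snd c p"] c by (auto simp: bilinear_def)
    then have "Chr c (snd c p) (v c) (\<Sum>b\<in>Basis. (Y p c \<bullet> b) *\<^sub>R b) =
        (\<Sum>b\<in>Basis. (Y p c \<bullet> b) *\<^sub>R Chr c (snd c p) (v c) b)"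
      by (simp add: linear_sum linear_scale)
    then show ?thesis by (simp add: euclidean_representation)
  qed
  finally show ?thesis by (simp add: euclidean_representation)
qed

text \<open>The bracket of the two extensions vanishes, so in the chart \<open>c\<close> the
  derivatives of their components agree and cancel in the torsion. Only the Christoffel terms
  survive.\<close>

lemma torsion_chart:
  assumes c: "c \<in> A" "p \<in> fst c" and u: "u \<in> tangent_space A p" and v: "v \<in> tangent_space A p"
  shows "torsion A nabla p u v c = Chr c (snd c p) (u c) (v c) - Chr c (snd c p) (v c) (u c)"
proof -
  let ?c = "chart_at A p"
  let ?X = "coord_vec A ?c (u ?c)" and ?Y = "coord_vec A ?c (v ?c)"
  have p: "?X p = u" "?Y p = v" using tangent_coord_vec chart_at u v by auto
  have b: "bracket A ?X ?Y p = 0" by (rule bracket_coord[OF chart_at])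
  then have "bracket A ?X ?Y p c = 0" by simp
  then have "frechet_derivative (\<lambda>x. ?Y (chart_inv c x) c) (at (snd c p)) (u c) =
      frechet_derivative (\<lambda>x. ?X (chart_inv c x) c) (at (snd c p)) (v c)"
    using c p by (simp add: bracket_def)
  then show ?thesis
    using nabla_chart[OF vector_field_coord_const[OF chart_at(1)] chart_at(2) c u, of "v ?c"]
      nabla_chart[OF vector_field_coord_const[OF chart_at(1)] chart_at(2) c v, of "u ?c"] p
    by (simp add: torsion_def ext_field_def b)
qed

text \<open>The extensions in the definition of curvature have constant components in the selected
  chart. The formula is stated there only, and this is why the geodesic is later described in the
  chart selected at the parameter in question.\<close>

lemma curvature_chart:
  fixes p
  defines "c \<equiv> chart_at A p"
  assumes u: "u \<in> tangent_space A p" and v: "v \<in> tangent_space A p" and w: "w \<in> tangent_space A p"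
  shows "curvature A nabla p u v w \<in> tangent_space A p"
    and "curvature A nabla p u v w c =
      pd (u c) (\<lambda>y. Chr c y (v c) (w c)) (snd c p) - pd (v c) (\<lambda>y. Chr c y (u c) (w c)) (snd c p)
      + Chr c (snd c p) (u c) (Chr c (snd c p) (v c) (w c))
      - Chr c (snd c p) (v c) (Chr c (snd c p) (u c) (w c))"
proof -
  have c: "c \<in> A" "p \<in> fst c" using chart_at by (auto simp: c_def)
  let ?X = "coord_vec A c (u c)" and ?Y = "coord_vec A c (v c)" and ?Z = "coord_vec A c (w c)"
  note f = vector_field_coord_const[OF c(1)]
  have n: "vector_field A (fst c) (\<lambda>q. nabla q (coord_vec A c u q) (coord_vec A c w))" for u w
    by (intro nabla_field f)
  have b: "bracket A ?X ?Y p = 0" by (rule bracket_coord[OF c])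
  have z: "nabla p 0 ?Z = 0"
    using nabla_scaleR_left[OF f c(2) u, of 0] by simp
  have R: "curvature A nabla p u v w = nabla p u (\<lambda>q. nabla q (?Y q) ?Z) - nabla p v (\<lambda>q. nabla q (?X q) ?Z)"
    by (simp add: curvature_def ext_field_def b z Let_def flip: c_def)
  show "curvature A nabla p u v w \<in> tangent_space A p"
    unfolding R by (intro tangent_diff nabla_tangent[OF n c(2)] u v)
  have *: "nabla p u (\<lambda>q. nabla q (coord_vec A c v q) ?Z) c =
      pd (u c) (\<lambda>y. Chr c y v (w c)) (snd c p) + Chr c (snd c p) (u c) (Chr c (snd c p) v (w c))"
    if "u \<in> tangent_space A p" for u v
    using nabla_chart[OF n c(2) c that, of v "w c"] c by (simp add: Chr_def chart_inv_snd)
  show "curvature A nabla p u v w c =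
      pd (u c) (\<lambda>y. Chr c y (v c) (w c)) (snd c p) - pd (v c) (\<lambda>y. Chr c y (u c) (w c)) (snd c p)
      + Chr c (snd c p) (u c) (Chr c (snd c p) (v c) (w c))
      - Chr c (snd c p) (v c) (Chr c (snd c p) (u c) (w c))"
    unfolding R using *[OF u, of "v c"] *[OF v, of "u c"] by simp
qed

text \<open>The derivative of a coordinate field of \<open>c\<close> is a tangent vector, and its
  components are computed in both charts. In \<open>c'\<close> the field has variable components,
  and differentiating them produces the second derivative of the transition map.\<close>

lemma Chr_transition:
  assumes c: "c \<in> A" "p \<in> fst c" and c': "c' \<in> A" "p \<in> fst c'"
  shows "Chr c' (snd c' p) (J c c' (snd c p) u) (J c c' (snd c p) v) =
    J c c' (snd c p) (Chr c (snd c p) u v) - pd u (pd v (transition c c')) (snd c p)"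
proof -
  let ?Y = "coord_vec A c v" and ?u = "coord_vec A c u p"
  note f = vector_field_coord_const[OF c(1)]
  have u: "?u \<in> tangent_space A p" by (rule coord_vec_tangent[OF c])
  have "nabla p ?u ?Y c' = J c c' (snd c p) (nabla p ?u ?Y c)"
    using tangentD[OF nabla_tangent[OF f c(2) u] c(1) c'(1) c(2) c'(2)] .
  also have "nabla p ?u ?Y c = Chr c (snd c p) u v"
    using c by (simp add: Chr_def chart_inv_snd)
  finally have 1: "nabla p ?u ?Y c' = J c c' (snd c p) (Chr c (snd c p) u v)" .
  let ?S = "snd c' ` (fst c \<inter> fst c')"
  have S: "open ?S" "snd c' p \<in> ?S" using c c' by (auto intro: open_chart_image open_chart)
  have T: "smooth_on (snd c ` (fst c' \<inter> fst c)) (transition c c')" "snd c p \<in> snd c ` (fst c' \<inter> fst c)"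
    using c c' by (auto intro: transition_smooth)
  have "((\<lambda>x. J c c' (transition c' c x) v) has_derivative
      (\<lambda>w. pd (J c' c (snd c' p) w) (pd v (transition c c')) (snd c p))) (at (snd c' p))"
    by (rule has_derivative_compose[of "transition c' c" _ "snd c' p" UNIV "\<lambda>y. J c c' y v"])
      (use c c' smooth_on_has_derivative[OF smooth_on_frechet[OF T(1)] T(2)] in
        \<open>auto simp: transition_snd intro: transition_has_derivative\<close>)
  then have "((\<lambda>x. ?Y (chart_inv c' x) c') has_derivative
      (\<lambda>w. pd (J c' c (snd c' p) w) (pd v (transition c c')) (snd c p))) (at (snd c' p))"
    by (rule has_derivative_transform_within_open[OF _ S])
      (use c c' in \<open>auto simp: coord_vec_apply transition_snd chart_inv_snd\<close>)
  moreover have "J c' c (snd c' p) (J c c' (snd c p) u) = u"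
    using c c' by (simp add: J_id flip: J_chain)
  ultimately show ?thesis
    using nabla_chart[OF f c(2) c' u, of v] 1 c c'
    by (simp add: frechet_eqI coord_vec_apply algebra_simps)
qed

end

subsection \<open>Sasakian manifolds in charts\<close>

lemma cvec_simps:
  "re_part (Z + W) = re_part Z + re_part W" "im_part (Z + W) = im_part Z + im_part W"
  "re_part (cscale a Z) = Re a *\<^sub>R re_part Z - Im a *\<^sub>R im_part Z"
  "im_part (cscale a Z) = Re a *\<^sub>R im_part Z + Im a *\<^sub>R re_part Z"
  "re_part (conj_vec Z) = re_part Z" "im_part (conj_vec Z) = - im_part Z"
  "re_part (cplx v) = v" "im_part (cplx v) = 0" "re_part 0 = 0" "im_part 0 = 0"
  "re_part (Z - W) = re_part Z - re_part W" "im_part (Z - W) = im_part Z - im_part W"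
  by (auto simp: re_part_def im_part_def cscale_def conj_vec_def cplx_def fun_eq_iff vec_eq_iff)

lemma cvec_eq_iff: "Z = W \<longleftrightarrow> re_part Z = re_part W \<and> im_part Z = im_part W"
  by (auto simp: re_part_def im_part_def fun_eq_iff vec_eq_iff complex_eq_iff)

lemma cscale_add_left: "cscale (a + b) Z = cscale a Z + cscale b Z"
  by (auto simp: cscale_def fun_eq_iff vec_eq_iff algebra_simps)

lemma cscale_cscale: "cscale a (cscale b Z) = cscale (a * b) Z"
  by (auto simp: cscale_def fun_eq_iff vec_eq_iff algebra_simps)

lemma cscale_0 [simp]: "cscale 0 Z = 0" and cscale_1 [simp]: "cscale 1 Z = Z"
  by (auto simp: cscale_def fun_eq_iff vec_eq_iff)

lemma cscale_sum: "cscale a (\<Sum>i\<in>I. Z i) = (\<Sum>i\<in>I. cscale a (Z i))"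
  by (auto simp: cscale_def fun_eq_iff vec_eq_iff sum_fun_apply sum_distrib_left)

lemma chart_sum: "(\<Sum>i\<in>I. Z i) c $ j = (\<Sum>i\<in>I. Z i c $ j)" for Z :: "'i \<Rightarrow> 'a \<Rightarrow> 'b::comm_monoid_add^'m"
  by (simp add: sum_fun_apply)

locale sasaki =
  fixes A :: "('p::topological_space, 'm::finite) chart set" and n :: nat
    and T10 :: "'p \<Rightarrow> ('p, 'm) ctvec set"
    and \<theta> :: "'p \<Rightarrow> ('p, 'm) tvec \<Rightarrow> real"
    and nabla :: "('p, 'm) connection"
  assumes sasakian: "sasakian A n T10 \<theta> nabla"

sublocale sasaki \<subseteq> connection_atlas A nabla
proof
  show "smooth_atlas A" using sasakian unfolding sasakian_def by blast
  have "tanaka_webster A T10 \<theta> nabla" using sasakian unfolding sasakian_def by blast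
  then show "linear_connection A nabla" unfolding tanaka_webster_def Let_def by blast
qed

context sasaki
begin

abbreviation "TM \<equiv> tangent_space A"
abbreviation "gW \<equiv> webster_metric A T10 \<theta>"
abbreviation "dth \<equiv> ext_deriv A \<theta>"
abbreviation "Tr \<equiv> reeb A \<theta>"

definition thc :: "('p, 'm) chart \<Rightarrow> real^'m \<Rightarrow> real^'m \<Rightarrow> real"
  where "thc c x u = \<theta> (chart_inv c x) (coord_vec A c u (chart_inv c x))"

definition Gc :: "('p, 'm) chart \<Rightarrow> real^'m \<Rightarrow> real^'m \<Rightarrow> real^'m \<Rightarrow> real"
  where "Gc c x u v = gW (chart_inv c x) (coord_vec A c u (chart_inv c x)) (coord_vec A c v (chart_inv c x))"

definition Tc :: "('p, 'm) chart \<Rightarrow> real^'m \<Rightarrow> real^'m"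
  where "Tc c x = Tr (chart_inv c x) c"

lemma
  shows card_m: "CARD('m) = 2 * n + 1"
    and cr: "cr_structure A n T10"
    and ph: "pseudohermitian A T10 \<theta>"
    and spc: "strictly_pseudoconvex A T10 \<theta>"
    and tw: "tanaka_webster A T10 \<theta> nabla"
    and pseudo_torsion_0: "\<And>p v. v \<in> TM p \<Longrightarrow> torsion A nabla p (Tr p) v = 0"
  using sasakian unfolding sasakian_def pseudo_torsion_def by blast+

lemma one_form: "one_form A \<theta>"
  using ph unfolding pseudohermitian_def by blast

lemma theta_add: "v \<in> TM p \<Longrightarrow> w \<in> TM p \<Longrightarrow> \<theta> p (v + w) = \<theta> p v + \<theta> p w"
  and theta_scaleR: "v \<in> TM p \<Longrightarrow> \<theta> p (k *\<^sub>R v) = k * \<theta> p v"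
  and theta_field: "vector_field A V X \<Longrightarrow> smooth_fun A V (\<lambda>p. \<theta> p (X p))"
  using one_form unfolding one_form_def by blast+

lemma levi_eq: "levi T10 p = {v \<in> TM p. \<theta> p v = 0}"
  using ph unfolding pseudohermitian_def by blast

lemma theta_chart: "c \<in> A \<Longrightarrow> p \<in> fst c \<Longrightarrow> v \<in> TM p \<Longrightarrow> \<theta> p v = thc c (snd c p) (v c)"
  by (simp add: thc_def chart_inv_snd tangent_coord_vec)

lemma Gc_chart: "c \<in> A \<Longrightarrow> p \<in> fst c \<Longrightarrow> u \<in> TM p \<Longrightarrow> v \<in> TM p \<Longrightarrow> gW p u v = Gc c (snd c p) (u c) (v c)"
  by (simp add: Gc_def chart_inv_snd tangent_coord_vec)

lemma thc_linear:
  assumes "c \<in> A" "x \<in> snd c ` fst c" shows "linear (thc c x)"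
  using chart_inv_dom[OF assms] assms(1) coord_vec_tangent[OF assms(1)]
  by (auto intro!: linearI simp: thc_def coord_vec_add coord_vec_scaleR theta_add theta_scaleR)

lemma thc_smooth: "c \<in> A \<Longrightarrow> smooth_on (snd c ` fst c) (\<lambda>x. thc c x u)"
  using theta_field[OF vector_field_coord_const[of c u]] by (force simp: smooth_fun_def thc_def comp_def)

lemma curl_bil: "c \<in> A \<Longrightarrow> x \<in> snd c ` fst c \<Longrightarrow> bilinear (curl (thc c) x)"
  by (rule curl_bilinear[OF open_chart(2) _ thc_linear thc_smooth])

text \<open>The extensions in the definition have variable components in a chart other than the
  selected one. Their vanishing bracket makes the two resulting terms equal, so they cancel. The
  factor 1/2 is the convention in \<open>ext_deriv\<close>.\<close>

lemma ext_deriv_chart: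
  assumes c: "c \<in> A" "p \<in> fst c" and u: "u \<in> TM p" and v: "v \<in> TM p"
  shows "dth p u v = curl (thc c) (snd c p) (u c) (v c) / 2"
proof -
  let ?c = "chart_at A p"
  let ?X = "\<lambda>u. coord_vec A ?c (u ?c)"
  let ?y = "\<lambda>u x. ?X u (chart_inv c x) c"
  let ?S = "snd c ` (fst ?c \<inter> fst c)"
  have S: "open ?S" "snd c p \<in> ?S"
    using c chart_at by (auto intro: open_chart_image open_chart)
  have Xp: "?X u p = u" if "u \<in> TM p" for u using tangent_coord_vec chart_at that by auto
  have b: "bracket A (?X u) (?X v) p = 0" by (rule bracket_coord[OF chart_at])
  then have "bracket A (?X u) (?X v) p c = 0" by simp
  then have sym: "frechet_derivative (?y v) (at (snd c p)) (u c) = frechet_derivative (?y u) (at (snd c p)) (v c)"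
    using c Xp u v by (simp add: bracket_def)
  have dd: "dir_deriv A p w (\<lambda>q. \<theta> q (?X z q)) =
      pd (w c) (\<lambda>x. thc c x (z c)) (snd c p) + thc c (snd c p) (frechet_derivative (?y z) (at (snd c p)) (w c))"
    if w: "w \<in> TM p" and z: "z \<in> TM p" for w z
  proof -
    have yd: "(?y z has_derivative frechet_derivative (?y z) (at (snd c p))) (at (snd c p))"
      by (rule smooth_on_has_derivative[OF vector_field_comp[OF vector_field_coord_const[OF chart_at(1)] c(1)] S(2)])
    have "((\<lambda>x. thc c x (?y z x)) has_derivative
        (\<lambda>w. pd w (\<lambda>x. thc c x (?y z (snd c p))) (snd c p) +
          thc c (snd c p) (frechet_derivative (?y z) (at (snd c p)) w))) (at (snd c p))"
      by (rule frechet_apply_linear[OF open_chart(2)[OF c(1)] _ thc_linear[OF c(1)]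
            smooth_on_differentiable[OF thc_smooth[OF c(1)]] yd]) (use c in auto)
    then have "(((\<lambda>q. \<theta> q (?X z q)) \<circ> chart_inv c) has_derivative
        (\<lambda>w. pd w (\<lambda>x. thc c x (?y z (snd c p))) (snd c p) +
          thc c (snd c p) (frechet_derivative (?y z) (at (snd c p)) w))) (at (snd c p))"
    proof (rule has_derivative_transform_within_open[OF _ S])
      fix x assume x: "x \<in> ?S"
      note i = chart_inv_image[OF c(1) x]
      show "thc c x (?y z x) = ((\<lambda>q. \<theta> q (?X z q)) \<circ> chart_inv c) x"
        using theta_chart[OF c(1) i(2) coord_vec_tangent[OF chart_at(1) i(1)], of "z ?c"] i by simp
    qed
    then show ?thesis
      using dir_deriv_chart[OF c w, of "\<lambda>q. \<theta> q (?X z q)"] Xp[OF z] c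
      by (simp add: frechet_eqI differentiable_def chart_inv_snd) blast
  qed
  have "\<theta> p 0 = 0" using theta_scaleR[OF u, of 0] by simp
  then show ?thesis
    using dd[OF u v] dd[OF v u] sym
    by (simp add: ext_deriv_def ext_field_def b curl_def)
qed

lemma snd_in [simp]: "p \<in> fst c \<Longrightarrow> snd c p \<in> snd c ` fst c" by blast

lemma
  assumes u: "u \<in> TM p" and v: "v \<in> TM p"
  shows dth_skew: "dth p u v = - dth p v u"
    and dth_scaleR: "dth p (k *\<^sub>R u) v = k * dth p u v" "dth p u (k *\<^sub>R v) = k * dth p u v"
    and dth_neg: "dth p u (- v) = - dth p u v"
proof -
  note b = curl_bil[OF chart_at(1) snd_in[OF chart_at(2)]]
  note e = ext_deriv_chart[OF chart_at]
  show "dth p u v = - dth p v u" by (simp add: e u v curl_def field_simps)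
  show "dth p (k *\<^sub>R u) v = k * dth p u v" "dth p u (k *\<^sub>R v) = k * dth p u v"
    by (simp_all add: e u v tangent_scaleR bilinear_lmul[OF b] bilinear_rmul[OF b])
  show "dth p u (- v) = - dth p u v"
    by (simp add: e u v tangent_neg bilinear_rneg[OF b])
qed

lemma
  assumes u: "u \<in> TM p" and v: "v \<in> TM p" and w: "w \<in> TM p"
  shows dth_add: "dth p (u + v) w = dth p u w + dth p v w" "dth p w (u + v) = dth p w u + dth p w v"
    and dth_diff: "dth p (u - v) w = dth p u w - dth p v w" "dth p w (u - v) = dth p w u - dth p w v"
proof -
  note b = curl_bil[OF chart_at(1) snd_in[OF chart_at(2)]]
  note e = ext_deriv_chart[OF chart_at]
  show "dth p (u + v) w = dth p u w + dth p v w" "dth p w (u + v) = dth p w u + dth p w v"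
    "dth p (u - v) w = dth p u w - dth p v w" "dth p w (u - v) = dth p w u - dth p w v"
    by (simp_all add: e assms tangent_add tangent_diff bilinear_ladd[OF b] bilinear_radd[OF b]
        bilinear_lsub[OF b] bilinear_rsub[OF b] add_divide_distrib diff_divide_distrib)
qed

section \<open>Algebra of the CR structure and of \<open>J\<close>\<close>

lemma T10_frame:
  obtains V F where "p \<in> V" "\<And>i. i < n \<Longrightarrow> cvector_field A V (F i)"
    "\<And>q. q \<in> V \<Longrightarrow> T10 q = {\<Sum>i<n. cscale (a i) (F i q) | a. True}"
    "\<And>q a i. q \<in> V \<Longrightarrow> (\<Sum>i<n. cscale (a i) (F i q)) = 0 \<Longrightarrow> i < n \<Longrightarrow> a i = 0"
proof -
  obtain V F where F: "p \<in> V" "\<forall>i<n. cvector_field A V (F i)"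
    "\<forall>q\<in>V. T10 q = {\<Sum>i<n. cscale (a i) (F i q) | a. True} \<and>
        (\<forall>a. (\<Sum>i<n. cscale (a i) (F i q)) = 0 \<longrightarrow> (\<forall>i<n. a i = 0))"
    using cr[unfolded cr_structure_def, THEN conjunct1, THEN spec, of p] by (elim exE conjE) (rule that)
  show ?thesis
  proof (rule that[OF F(1)])
    show "cvector_field A V (F i)" if "i < n" for i using F(2) that by simp
    fix q assume q: "q \<in> V"
    show "T10 q = {\<Sum>i<n. cscale (a i) (F i q) | a. True}" using F(3)[THEN bspec, OF q, THEN conjunct1] .
    show "a i = 0" if "(\<Sum>i<n. cscale (a i) (F i q)) = 0" "i < n" for a i
      using F(3)[THEN bspec, OF q, THEN conjunct2, THEN spec, THEN mp, OF that(1)] that(2) by simp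
  qed
qed

lemma T10_add: "Z \<in> T10 p \<Longrightarrow> W \<in> T10 p \<Longrightarrow> Z + W \<in> T10 p"
  and T10_cscale: "Z \<in> T10 p \<Longrightarrow> cscale k Z \<in> T10 p"
proof -
  obtain V F where F: "p \<in> V" "\<And>q. q \<in> V \<Longrightarrow> T10 q = {\<Sum>i<n. cscale (a i) (F i q) | a. True}"
    by (rule T10_frame[of p]) (rule that)
  note T = F(2)[OF F(1)]
  have TI: "(\<Sum>i<n. cscale (a i) (F i p)) \<in> T10 p" for a unfolding T by blast
  show "Z + W \<in> T10 p" if ZW: "Z \<in> T10 p" "W \<in> T10 p"
  proof -
    obtain a b where "Z = (\<Sum>i<n. cscale (a i) (F i p))" "W = (\<Sum>i<n. cscale (b i) (F i p))"
      using ZW unfolding T by blast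
    then have "Z + W = (\<Sum>i<n. cscale (a i + b i) (F i p))"
      by (simp only: cscale_add_left sum.distrib)
    then show ?thesis by (simp only: TI)
  qed
  show "cscale k Z \<in> T10 p" if Z: "Z \<in> T10 p"
  proof -
    obtain a where "Z = (\<Sum>i<n. cscale (a i) (F i p))" using Z unfolding T by blast
    then have "cscale k Z = (\<Sum>i<n. cscale (k * a i) (F i p))"
      by (simp only: cscale_sum cscale_cscale)
    then show ?thesis by (simp only: TI)
  qed
qed

text \<open>Replaces the pair Z, W in the definition by a single vector: a real vector of the form Z
  + conj W is the real part of Z + W. Conversely, Re Z is the sum of Z/2 and its conjugate.\<close>

lemma levi_re: "levi T10 p = re_part ` T10 p"
proof (intro equalityI subsetI)
  fix v assume "v \<in> levi T10 p"
  then obtain Z W where ZW: "Z \<in> T10 p" "W \<in> T10 p" "cplx v = Z + conj_vec W"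
    unfolding levi_def by blast
  from ZW(3) have "v = re_part (Z + W)"
    unfolding cvec_eq_iff[of "cplx v"] by (simp only: cvec_simps)
  then show "v \<in> re_part ` T10 p" using T10_add[OF ZW(1,2)] by blast
next
  fix v assume "v \<in> re_part ` T10 p"
  then obtain Z where Z: "Z \<in> T10 p" "v = re_part Z" by blast
  let ?W = "cscale (1/2) Z"
  have "cplx v = ?W + conj_vec ?W"
    unfolding cvec_eq_iff cvec_simps Z(2) by (auto simp: fun_eq_iff vec_eq_iff)
  then show "v \<in> levi T10 p"
    using T10_cscale[OF Z(1)] unfolding levi_def by blast
qed

text \<open>A purely imaginary \<open>Z\<close> is the conjugate of \<open>- Z\<close>, and
  \<open>T10\<close> meets its conjugate in 0 only. Hence the real part determines a vector of
  \<open>T10\<close>, which makes \<open>levi_J\<close> well defined.\<close>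

lemma T10_re_0:
  assumes "Z \<in> T10 p" "re_part Z = 0" shows "Z = 0"
proof -
  have "Z = conj_vec (cscale (-1) Z)"
    unfolding cvec_eq_iff cvec_simps assms(2) by (auto simp: fun_eq_iff)
  then have "Z \<in> T10 p \<inter> conj_vec ` T10 p" using assms T10_cscale by blast
  moreover have "T10 p \<inter> conj_vec ` T10 p = {0}"
    using cr unfolding cr_structure_def by blast
  ultimately show ?thesis by blast
qed

lemma levi_J_re:
  assumes Z: "Z \<in> T10 p" shows "levi_J T10 p (re_part Z) = - im_part Z"
  unfolding levi_J_def
proof (rule the_equality)
  \<comment> \<open>The decomposition behind the definition of \<open>J\<close> is Re Z = Z/2 +
    conj(Z/2), and i(Z/2 - conj(Z/2)) = - Im Z.\<close>
  let ?W = "cscale (1/2) Z"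
  have "cplx (re_part Z) = ?W + conj_vec ?W \<and> cplx (- im_part Z) = cscale \<i> (?W - conj_vec ?W)"
    unfolding cvec_eq_iff cvec_simps by (auto simp: fun_eq_iff vec_eq_iff)
  then show "\<exists>W\<in>T10 p. cplx (re_part Z) = W + conj_vec W \<and> cplx (- im_part Z) = cscale \<i> (W - conj_vec W)"
    using T10_cscale[OF Z] by blast
next
  fix w assume "\<exists>W\<in>T10 p. cplx (re_part Z) = W + conj_vec W \<and> cplx w = cscale \<i> (W - conj_vec W)"
  then obtain W where W: "W \<in> T10 p" "cplx (re_part Z) = W + conj_vec W" "cplx w = cscale \<i> (W - conj_vec W)"
    by blast
  have re: "re_part Z = re_part W + re_part W"
    using W(2) unfolding cvec_eq_iff[of "cplx _"] cvec_simps by blast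
  have "Z + cscale (-2) W \<in> T10 p" using T10_add[OF Z T10_cscale[OF W(1)]] .
  moreover have "re_part (Z + cscale (-2) W) = 0"
    unfolding cvec_simps re by (rule ext) (simp add: scaleR_2)
  ultimately have "Z + cscale (-2) W = 0" by (rule T10_re_0)
  then have "im_part (Z + cscale (-2) W) = 0" by (simp only: cvec_simps)
  then have im: "im_part Z c = 2 *\<^sub>R im_part W c" for c
    unfolding cvec_simps fun_eq_iff by (cases c) (simp add: algebra_simps)
  have "w = re_part (cscale \<i> (W - conj_vec W))"
    using W(3) by (metis cvec_simps(7))
  then show "w = - im_part Z"
    unfolding cvec_simps by (auto simp: fun_eq_iff im vec_eq_iff)
qed

lemma T10_re_levi: "Z \<in> T10 p \<Longrightarrow> re_part Z \<in> levi T10 p" by (auto simp: levi_re)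

lemma T10_im_levi:
  assumes "Z \<in> T10 p" shows "im_part Z \<in> levi T10 p"
proof -
  have "im_part Z = re_part (cscale (-\<i>) Z)"
    unfolding cvec_simps by (auto simp: fun_eq_iff)
  then show ?thesis using T10_re_levi[OF T10_cscale[OF assms]] by metis
qed

lemma levi_J_im:
  assumes "Z \<in> T10 p" shows "levi_J T10 p (im_part Z) = re_part Z"
proof -
  have "im_part Z = re_part (cscale (-\<i>) Z)" "- im_part (cscale (-\<i>) Z) = re_part Z"
    unfolding cvec_simps by (auto simp: fun_eq_iff)
  then show ?thesis using levi_J_re[OF T10_cscale[OF assms]] by metis
qed

lemma levi_tangent: "v \<in> levi T10 p \<Longrightarrow> v \<in> TM p" "v \<in> levi T10 p \<Longrightarrow> \<theta> p v = 0"
  unfolding levi_eq by blast+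

lemmas T10_tangent = levi_tangent(1)[OF T10_re_levi] levi_tangent(1)[OF T10_im_levi]

lemma levi_J_levi: "v \<in> levi T10 p \<Longrightarrow> levi_J T10 p v \<in> levi T10 p"
proof -
  assume "v \<in> levi T10 p"
  then obtain Z where Z: "Z \<in> T10 p" "v = re_part Z" unfolding levi_re by blast
  have "- im_part Z = im_part (cscale (-1) Z)" unfolding cvec_simps by (auto simp: fun_eq_iff)
  then show ?thesis using T10_im_levi[OF T10_cscale[OF Z(1)]] levi_J_re[OF Z(1)] Z(2) by metis
qed

lemma levi_J_J:
  assumes "v \<in> levi T10 p" shows "levi_J T10 p (levi_J T10 p v) = - v"
proof -
  obtain Z where Z: "Z \<in> T10 p" "v = re_part Z" using assms unfolding levi_re by blast
  have "- im_part Z = im_part (cscale (-1) Z)" "re_part (cscale (-1) Z) = - v"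
    unfolding cvec_simps Z by (auto simp: fun_eq_iff)
  then show ?thesis using levi_J_im[OF T10_cscale[OF Z(1)]] levi_J_re[OF Z(1)] Z(2) by metis
qed

lemma levi_J_add:
  assumes "v \<in> levi T10 p" "w \<in> levi T10 p"
  shows "levi_J T10 p (v + w) = levi_J T10 p v + levi_J T10 p w"
proof -
  obtain Z W where Z: "Z \<in> T10 p" "v = re_part Z" and W: "W \<in> T10 p" "w = re_part W"
    using assms unfolding levi_re by blast
  have "levi_J T10 p (re_part (Z + W)) = - im_part (Z + W)" by (rule levi_J_re[OF T10_add[OF Z(1) W(1)]])
  then show ?thesis
    unfolding Z(2) W(2) levi_J_re[OF Z(1)] levi_J_re[OF W(1)] cvec_simps by (simp only: minus_add_distrib)
qed

lemma levi_J_scaleR: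
  assumes "v \<in> levi T10 p" shows "levi_J T10 p (k *\<^sub>R v) = k *\<^sub>R levi_J T10 p v"
proof -
  obtain Z where Z: "Z \<in> T10 p" "v = re_part Z" using assms unfolding levi_re by blast
  have "levi_J T10 p (re_part (cscale (of_real k) Z)) = - im_part (cscale (of_real k) Z)"
    by (rule levi_J_re[OF T10_cscale[OF Z(1)]])
  moreover have "re_part (cscale (of_real k) Z) = k *\<^sub>R re_part Z" "im_part (cscale (of_real k) Z) = k *\<^sub>R im_part Z"
    unfolding cvec_simps by (auto simp: fun_eq_iff)
  ultimately show ?thesis unfolding Z(2) levi_J_re[OF Z(1)] by (metis scaleR_minus_right)
qed

section \<open>The Reeb field and the Webster metric\<close>

lemma levi_pos: "v \<in> levi T10 p \<Longrightarrow> v \<noteq> 0 \<Longrightarrow> dth p v (levi_J T10 p v) > 0"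
  using spc unfolding strictly_pseudoconvex_def levi_form_def by blast

text \<open>The skew form \<open>d\<theta>\<close> is degenerate because the dimension is odd; a kernel vector cannot be
  horizontal.\<close>

lemma reeb_exists: "\<exists>v. v \<in> TM p \<and> \<theta> p v = 1 \<and> (\<forall>w\<in>TM p. dth p v w = 0)"
proof -
  let ?c = "chart_at A p" let ?x = "snd ?c p"
  note c = chart_at[of p]
  note bil = curl_bil[OF c(1) snd_in[OF c(2)]]
  define B :: "real^'m^'m" where "B = (\<chi> i j. curl (thc ?c) ?x (axis i 1) (axis j 1))"
  have "transpose B = (\<chi> i. (-1) *s B $ i)"
    by (auto simp: vec_eq_iff B_def transpose_def curl_def)
  then have "det B = (-1) ^ CARD('m) * det B"
    using det_rows_mul[of "\<lambda>i. -1" "\<lambda>i. B $ i"] by (metis det_transpose prod_constant vec_nth_inverse)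
  then have "det B = 0" by (simp add: card_m)
  then have "\<not> invertible B" by (simp add: invertible_det_nz)
  then obtain k where k: "B *v k = 0" "k \<noteq> 0"
    using matrix_left_invertible_ker[of B] invertible_left_inverse[of B] by blast
  have curl0: "curl (thc ?c) ?x u k = 0" for u
  proof -
    have ax: "curl (thc ?c) ?x (axis i 1) k = 0" for i
    proof -
      have "curl (thc ?c) ?x (axis i 1) k = curl (thc ?c) ?x (axis i 1) (\<Sum>j\<in>UNIV. k $ j *\<^sub>R axis j 1)"
        using basis_expansion[of k] by (simp add: scalar_mult_eq_scaleR)
      also have "\<dots> = (\<Sum>j\<in>UNIV. k $ j * curl (thc ?c) ?x (axis i 1) (axis j 1))"
        using bil by (simp add: bilinear_def linear_sum linear_scale)
      also have "\<dots> = (B *v k) $ i" by (simp add: B_def matrix_vector_mult_def mult.commute)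
      finally show ?thesis by (simp add: k)
    qed
    have "curl (thc ?c) ?x u k = curl (thc ?c) ?x (\<Sum>j\<in>UNIV. u $ j *\<^sub>R axis j 1) k"
      using basis_expansion[of u] by (simp add: scalar_mult_eq_scaleR)
    also have "\<dots> = (\<Sum>j\<in>UNIV. u $ j * curl (thc ?c) ?x (axis j 1) k)"
      using linear_sum[OF bil[unfolded bilinear_def, THEN conjunct2, THEN spec, of k], of "\<lambda>j. u $ j *\<^sub>R axis j 1" UNIV]
        linear_scale[OF bil[unfolded bilinear_def, THEN conjunct2, THEN spec, of k]] by simp
    finally show ?thesis by (simp add: ax)
  qed
  define K where "K = coord_vec A ?c k p"
  have K: "K \<in> TM p" "K ?c = k" using c by (auto simp: K_def coord_vec_tangent coord_vec_self)
  have dK: "dth p K w = 0" if "w \<in> TM p" for w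
    using ext_deriv_chart[OF c that K(1)] curl0 K dth_skew[OF K(1) that] by simp
  have "\<theta> p K \<noteq> 0"
  proof
    assume "\<theta> p K = 0"
    then have L: "K \<in> levi T10 p" using K(1) by (simp add: levi_eq)
    have "K \<noteq> 0" using K(2) k(2) by auto
    from levi_pos[OF L this] dK[OF levi_tangent(1)[OF levi_J_levi[OF L]]] show False by simp
  qed
  then have "(1 / \<theta> p K) *\<^sub>R K \<in> TM p \<and> \<theta> p ((1 / \<theta> p K) *\<^sub>R K) = 1 \<and>
      (\<forall>w\<in>TM p. dth p ((1 / \<theta> p K) *\<^sub>R K) w = 0)"
    using K(1) dK by (auto simp: theta_scaleR tangent_scaleR dth_scaleR)
  then show ?thesis by blast
qed

text \<open>The difference of two candidates is horizontal and is annihilated by d\<theta>, so it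
  vanishes by strict pseudoconvexity. With \<open>reeb_exists\<close> this justifies the definite
  description.\<close>

lemma reeb: "Tr p \<in> TM p" "\<theta> p (Tr p) = 1" "w \<in> TM p \<Longrightarrow> dth p (Tr p) w = 0"
proof -
  have "\<exists>!v. v \<in> TM p \<and> \<theta> p v = 1 \<and> (\<forall>w\<in>TM p. dth p v w = 0)"
  proof (rule ex_ex1I[OF reeb_exists])
    fix u v assume u: "u \<in> TM p \<and> \<theta> p u = 1 \<and> (\<forall>w\<in>TM p. dth p u w = 0)"
      and v: "v \<in> TM p \<and> \<theta> p v = 1 \<and> (\<forall>w\<in>TM p. dth p v w = 0)"
    have "\<theta> p (u + (-1) *\<^sub>R v) = 0" using u v by (simp only: theta_add theta_scaleR tangent_scaleR)
    moreover have "u + (-1) *\<^sub>R v = u - v" by simp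
    ultimately have L: "u - v \<in> levi T10 p" using u v tangent_diff by (simp add: levi_eq)
    have t: "levi_J T10 p (u - v) \<in> TM p" using levi_tangent(1)[OF levi_J_levi[OF L]] .
    have "dth p (u - v) (levi_J T10 p (u - v)) = 0" using u v t by (simp add: dth_diff)
    then have "u - v = 0" using levi_pos[OF L] by fastforce
    then show "u = v" by (simp only: right_minus_eq)
  qed
  from theI'[OF this] show "Tr p \<in> TM p" "\<theta> p (Tr p) = 1" "w \<in> TM p \<Longrightarrow> dth p (Tr p) w = 0"
    unfolding reeb_def by blast+
qed

lemma horiz_levi: "u \<in> TM p \<Longrightarrow> horiz A \<theta> p u \<in> levi T10 p"
  using reeb(1,2)[of p] theta_add[of u p "(- \<theta> p u) *\<^sub>R Tr p"] theta_scaleR[of "Tr p" p "- \<theta> p u"]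
    tangent_diff[of u p "\<theta> p u *\<^sub>R Tr p"]
  by (simp add: levi_eq horiz_def tangent_scaleR tangent_neg)

lemma horiz_apply: "horiz A \<theta> p u c = u c - \<theta> p u *\<^sub>R Tr p c"
  by (simp add: horiz_def)

lemma horiz_add: "u \<in> TM p \<Longrightarrow> v \<in> TM p \<Longrightarrow> horiz A \<theta> p (u + v) = horiz A \<theta> p u + horiz A \<theta> p v"
  by (rule ext) (simp add: horiz_apply theta_add algebra_simps)

lemma horiz_scaleR: "u \<in> TM p \<Longrightarrow> horiz A \<theta> p (k *\<^sub>R u) = k *\<^sub>R horiz A \<theta> p u"
  by (rule ext) (simp add: horiz_apply theta_scaleR algebra_simps)

lemma horiz_levi_id: "u \<in> levi T10 p \<Longrightarrow> horiz A \<theta> p u = u"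
  by (rule ext) (simp add: horiz_apply levi_tangent)

lemma horiz_reeb: "horiz A \<theta> p (Tr p) = 0"
  by (rule ext) (simp add: horiz_apply reeb)

lemma levi_0: "0 \<in> levi T10 p"
  by (simp add: levi_eq tangent_0) (metis theta_scaleR[OF tangent_0] mult_zero_left scaleR_zero_left)

lemma levi_J_0: "levi_J T10 p 0 = 0"
  using levi_J_scaleR[OF levi_0, of p 0] by simp

lemma dth_0: "u \<in> TM p \<Longrightarrow> dth p u 0 = 0" "u \<in> TM p \<Longrightarrow> dth p 0 u = 0"
  using dth_scaleR[OF tangent_0, of u p 0] dth_scaleR[of u p 0 0] tangent_0[of p] by auto

lemma gW_eq: "gW p u v = dth p (horiz A \<theta> p u) (levi_J T10 p (horiz A \<theta> p v)) + \<theta> p u * \<theta> p v"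
  by (simp add: webster_metric_def levi_form_def)

lemmas horiz_tangent = levi_tangent(1)[OF horiz_levi]
lemmas levi_J_tangent = levi_tangent(1)[OF levi_J_levi]

lemma gW_add: 
  assumes "u \<in> TM p" "v \<in> TM p" "w \<in> TM p"
  shows "gW p (u + v) w = gW p u w + gW p v w" "gW p w (u + v) = gW p w u + gW p w v"
  using assms horiz_tangent levi_J_tangent[OF horiz_levi]
  by (simp_all add: gW_eq horiz_add dth_add levi_J_add horiz_levi theta_add algebra_simps)

lemma gW_scaleR:
  assumes "u \<in> TM p" "w \<in> TM p"
  shows "gW p (k *\<^sub>R u) w = k * gW p u w" "gW p w (k *\<^sub>R u) = k * gW p w u"
  using assms horiz_tangent levi_J_tangent[OF horiz_levi]
  by (simp_all add: gW_eq horiz_scaleR dth_scaleR levi_J_scaleR horiz_levi theta_scaleR algebra_simps)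

lemma gW_reeb:
  assumes "v \<in> TM p" shows "gW p (Tr p) v = \<theta> p v" "gW p v (Tr p) = \<theta> p v"
  using assms reeb(2) levi_J_tangent[OF horiz_levi] horiz_tangent
  by (simp_all add: gW_eq horiz_reeb levi_J_0 dth_0)

lemma gW_pos:
  assumes "v \<in> TM p" "v \<noteq> 0" shows "gW p v v > 0"
proof (cases "horiz A \<theta> p v = 0")
  case True
  then have "v c = \<theta> p v *\<^sub>R Tr p c" for c
    using horiz_apply[of p v c] by simp
  then have "\<theta> p v \<noteq> 0" using assms(2) by (auto simp: fun_eq_iff)
  then show ?thesis by (simp add: gW_eq True levi_J_0 dth_0 tangent_0 flip: power2_eq_square)
next
  case False
  then show ?thesis
    using levi_pos[OF horiz_levi[OF assms(1)]] by (simp add: gW_eq add_pos_nonneg)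
qed

lemma Gc_bilinear:
  assumes "c \<in> A" "x \<in> snd c ` fst c" shows "bilinear (Gc c x)"
  using chart_inv_dom[OF assms] assms(1) coord_vec_tangent[OF assms(1)]
  by (simp add: bilinear_def linear_iff Gc_def coord_vec_add coord_vec_scaleR gW_add gW_scaleR)

lemma cvector_field_smooth:
  assumes "cvector_field A V Z" "c \<in> A"
  shows "smooth_on (snd c ` (V \<inter> fst c)) (\<lambda>x. re_part (Z (chart_inv c x)) c)"
    "smooth_on (snd c ` (V \<inter> fst c)) (\<lambda>x. im_part (Z (chart_inv c x)) c)"
proof -
  have S: "open (snd c ` (V \<inter> fst c))" "smooth_on (snd c ` (V \<inter> fst c)) (\<lambda>x. Z (chart_inv c x) c)"
    using assms by (auto simp: cvector_field_def smooth_comps_def intro: open_chart_image)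
  have "bounded_linear (\<lambda>v::complex^'m. \<chi> i. Re (v $ i))" "bounded_linear (\<lambda>v::complex^'m. \<chi> i. Im (v $ i))"
    unfolding linear_conv_bounded_linear[symmetric] by (auto simp: linear_iff vec_eq_iff)
  from this[THEN smooth_on_linear_comp, OF S] show
    "smooth_on (snd c ` (V \<inter> fst c)) (\<lambda>x. re_part (Z (chart_inv c x)) c)"
    "smooth_on (snd c ` (V \<inter> fst c)) (\<lambda>x. im_part (Z (chart_inv c x)) c)"
    by (simp_all add: re_part_def im_part_def)
qed

section \<open>The torsion axioms in real form\<close>

lemma cext_vec_parts:
  "re_part (cext_vec B Z W) = B (re_part Z) (re_part W) - B (im_part Z) (im_part W)"
  "im_part (cext_vec B Z W) = B (re_part Z) (im_part W) + B (im_part Z) (re_part W)"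
  unfolding cext_vec_def cvec_simps by (auto simp: fun_eq_iff)

definition tor :: "('p, 'm) chart \<Rightarrow> real^'m \<Rightarrow> real^'m \<Rightarrow> real^'m \<Rightarrow> real^'m"
  where "tor c x u v = Chr c x u v - Chr c x v u"

lemma tor_bilinear:
  assumes "c \<in> A" "x \<in> snd c ` fst c" shows "bilinear (tor c x)"
  using Chr_bilinear[OF assms] unfolding bilinear_def tor_def
  by (auto intro!: linear_compose_sub)

text \<open>Real and imaginary parts of the two torsion axioms give linear equations for the
  torsions of the real vectors. The axiom for a pair from \<open>T10\<close> identifies these
  torsions up to sign; the axiom with a conjugate then determines their common value as a multiple
  of the Reeb field.\<close>

lemma torsion_T10:
  assumes Z: "Z \<in> T10 p" and W: "W \<in> T10 p" and c: "c \<in> A" "p \<in> fst c"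
  defines "x \<equiv> snd c p"
  shows "tor c x (re_part Z c) (re_part W c) = tor c x (im_part Z c) (im_part W c)"
    and "tor c x (re_part Z c) (im_part W c) = - tor c x (im_part Z c) (re_part W c)"
    and "tor c x (re_part Z c) (re_part W c) = (dth p (re_part Z) (re_part W) + dth p (im_part Z) (im_part W)) *\<^sub>R Tr p c"
    and "tor c x (re_part Z c) (im_part W c) = (dth p (re_part Z) (im_part W) - dth p (im_part Z) (re_part W)) *\<^sub>R Tr p c"
proof -
  note t = T10_tangent[OF Z] T10_tangent[OF W]
  note b = tor_bilinear[OF c(1) snd_in[OF c(2)]]
  have B: "torsion A nabla p u v c = tor c x (u c) (v c)" if "u \<in> TM p" "v \<in> TM p" for u v
    using torsion_chart[OF c that] by (simp add: tor_def x_def)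
  have TW: "cext_vec (torsion A nabla p) Z W = 0"
    "cext_vec (torsion A nabla p) Z (conj_vec W) =
      cscale (2 * cext_scalar (dth p) Z (conj_vec W)) (cplx (Tr p))"
    using tw Z W unfolding tanaka_webster_def Let_def by blast+
  have "re_part (cext_vec (torsion A nabla p) Z W) c = 0" "im_part (cext_vec (torsion A nabla p) Z W) c = 0"
    unfolding TW(1) cvec_simps by simp_all
  then have 1: "tor c x (re_part Z c) (re_part W c) = tor c x (im_part Z c) (im_part W c)"
    and 2: "tor c x (re_part Z c) (im_part W c) = - tor c x (im_part Z c) (re_part W c)"
    unfolding cext_vec_parts by (simp_all add: B t eq_neg_iff_add_eq_0)
  have s: "cext_scalar (dth p) Z (conj_vec W) = Complex
     (dth p (re_part Z) (re_part W) + dth p (im_part Z) (im_part W))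
     (dth p (im_part Z) (re_part W) - dth p (re_part Z) (im_part W))"
    unfolding cext_scalar_def cvec_simps by (simp add: dth_neg t)
  have "re_part (cext_vec (torsion A nabla p) Z (conj_vec W)) c =
      (2 * (dth p (re_part Z) (re_part W) + dth p (im_part Z) (im_part W))) *\<^sub>R Tr p c"
    "im_part (cext_vec (torsion A nabla p) Z (conj_vec W)) c =
      (2 * (dth p (im_part Z) (re_part W) - dth p (re_part Z) (im_part W))) *\<^sub>R Tr p c"
    unfolding TW(2) s cvec_simps by simp_all
  then have 3: "tor c x (re_part Z c) (re_part W c) + tor c x (im_part Z c) (im_part W c) =
      (2 * (dth p (re_part Z) (re_part W) + dth p (im_part Z) (im_part W))) *\<^sub>R Tr p c"
    and 4: "tor c x (im_part Z c) (re_part W c) - tor c x (re_part Z c) (im_part W c) =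
      (2 * (dth p (im_part Z) (re_part W) - dth p (re_part Z) (im_part W))) *\<^sub>R Tr p c"
    unfolding cext_vec_parts cvec_simps
    by (simp_all add: B t tangent_neg bilinear_rneg[OF b[folded x_def]])
  show "tor c x (re_part Z c) (re_part W c) = tor c x (im_part Z c) (im_part W c)" by (fact 1)
  show "tor c x (re_part Z c) (im_part W c) = - tor c x (im_part Z c) (re_part W c)" by (fact 2)
  \<comment> \<open>Both axioms together give twice each torsion, and the factor 2 in the second
    axiom cancels this.\<close>
  have half: "v = k *\<^sub>R w" if "v + v = (2 * k) *\<^sub>R w" for v w :: "real^'m" and k
    using arg_cong[OF that, of "\<lambda>v. (1/2) *\<^sub>R v"] by (simp add: scaleR_2[symmetric] del: scaleR_2)
  show "tor c x (re_part Z c) (re_part W c) = (dth p (re_part Z) (re_part W) + dth p (im_part Z) (im_part W)) *\<^sub>R Tr p c"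
    by (rule half) (use 1 3 in simp)
  show "tor c x (re_part Z c) (im_part W c) = (dth p (re_part Z) (im_part W) - dth p (im_part Z) (re_part W)) *\<^sub>R Tr p c"
    by (rule half) (use 2 4 in \<open>simp add: algebra_simps\<close>)
qed

lemma Chr_apply_smooth:
  assumes "c \<in> A" "open S" "S \<subseteq> snd c ` fst c" "smooth_on S p" "smooth_on S q"
  shows "smooth_on S (\<lambda>x. Chr c x (p x) (q x))" "smooth_on S (\<lambda>x. curl (thc c) x (p x) (q x))"
    "smooth_on S (\<lambda>x. thc c x (q x))"
proof -
  show "smooth_on S (\<lambda>x. Chr c x (p x) (q x))"
    by (rule smooth_on_apply_bilinear[OF assms(2) Chr_bilinear[OF assms(1)] smooth_on_subset[OF Chr_smooth[OF assms(1)] assms(3)] assms(4,5)])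
      (use assms(3) in blast)
  have curls: "smooth_on (snd c ` fst c) (\<lambda>x. curl (thc c) x u v)" for u v
    unfolding curl_def by (intro smooth_on_diff open_chart(2) smooth_on_frechet thc_smooth assms)
  show "smooth_on S (\<lambda>x. curl (thc c) x (p x) (q x))"
    by (rule smooth_on_apply_bilinear[OF assms(2) curl_bil[OF assms(1)] smooth_on_subset[OF curls assms(3)] assms(4,5)])
      (use assms(3) in blast)
  show "smooth_on S (\<lambda>x. thc c x (q x))"
    by (rule smooth_on_apply_linear[OF assms(2) thc_linear[OF assms(1)] smooth_on_subset[OF thc_smooth[OF assms(1)] assms(3)] assms(5)])
      (use assms(3) in blast)
qed

end

text \<open>For positive \<open>n\<close> a frame of \<open>T10\<close> has a member. This makes the
  domain of the frame open, and it supplies the nonzero horizontal field from which smoothness of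
  the Reeb field is read off. For n = 0 there are no lengthy curves of positive speed.\<close>

locale sasaki_pos = sasaki A n T10 \<theta> nabla
  for A :: "('p::topological_space, 'm::finite) chart set" and n :: nat
    and T10 :: "'p \<Rightarrow> ('p, 'm) ctvec set"
    and \<theta> :: "'p \<Rightarrow> ('p, 'm) tvec \<Rightarrow> real"
    and nabla :: "('p, 'm) connection" +
  assumes n_pos: "0 < n"
begin

section \<open>Smoothness of the Reeb field and of the Webster metric\<close>

lemma T10_frame_open:
  obtains V F where "p \<in> V" "open V" "\<And>i. i < n \<Longrightarrow> cvector_field A V (F i)"
    "\<And>q. q \<in> V \<Longrightarrow> T10 q = {\<Sum>i<n. cscale (a i) (F i q) | a. True}"
    "\<And>q a i. q \<in> V \<Longrightarrow> (\<Sum>i<n. cscale (a i) (F i q)) = 0 \<Longrightarrow> i < n \<Longrightarrow> a i = 0"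
proof (rule T10_frame[of p])
  fix V F
  assume F: "p \<in> V" "\<And>i. i < n \<Longrightarrow> cvector_field A V (F i)"
    "\<And>q. q \<in> V \<Longrightarrow> T10 q = {\<Sum>i<n. cscale (a i) (F i q) | a. True}"
    "\<And>q a i. q \<in> V \<Longrightarrow> (\<Sum>i<n. cscale (a i) (F i q)) = 0 \<Longrightarrow> i < n \<Longrightarrow> a i = 0"
  have "open V" using F(2)[OF n_pos] by (simp add: cvector_field_def)
  show thesis
  proof (rule that[of V F])
    show "p \<in> V" "open V" by fact+
    show "cvector_field A V (F i)" if "i < n" for i using that by (rule F(2))
    show "T10 q = {\<Sum>i<n. cscale (a i) (F i q) | a. True}" if "q \<in> V" for q using that by (rule F(3))
    show "a i = 0" if "q \<in> V" "(\<Sum>i<n. cscale (a i) (F i q)) = 0" "i < n" for q a i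
      using F(4)[of q a i] that by blast
  qed
qed

text \<open>For \<open>Z\<close> in \<open>T10\<close> the torsion of \<open>Re Z\<close> and \<open>Im Z\<close> is the multiple
  \<open>2 d\<theta>(Re Z, Im Z) \<noteq> 0\<close> of the Reeb field, which exhibits that field as a quotient of smooth
  expressions.\<close>

lemma Tc_smooth: assumes c: "c \<in> A" shows "smooth_on (snd c ` fst c) (Tc c)"
proof (rule smooth_on_local[OF open_chart(2)[OF c]])
  fix x0 assume "x0 \<in> snd c ` fst c"
  then obtain p where p: "p \<in> fst c" "x0 = snd c p" by blast
  obtain V F where F: "p \<in> V" "open V" "\<And>i. i < n \<Longrightarrow> cvector_field A V (F i)"
    "\<And>q. q \<in> V \<Longrightarrow> T10 q = {\<Sum>i<n. cscale (a i) (F i q) | a. True}"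
    "\<And>q a i. q \<in> V \<Longrightarrow> (\<Sum>i<n. cscale (a i) (F i q)) = 0 \<Longrightarrow> i < n \<Longrightarrow> a i = 0"
    by (rule T10_frame_open[of p]) (rule that)
  let ?Z = "F 0"
  have Z: "?Z q \<in> T10 q" "re_part (?Z q) \<noteq> 0" if q: "q \<in> V" for q
  proof -
    have e: "(\<Sum>i<n. cscale (if i = 0 then 1 else 0) (F i q)) = ?Z q"
    proof -
      have "(\<Sum>i<n. cscale (if i = 0 then 1 else 0) (F i q)) = (\<Sum>i<n. if i = 0 then F i q else 0)"
        by (rule sum.cong) auto
      also have "\<dots> = ?Z q" using n_pos by (simp only: sum.delta finite_lessThan lessThan_iff if_True)
      finally show ?thesis .
    qed
    show "?Z q \<in> T10 q" unfolding F(4)[OF q] mem_Collect_eq by (intro exI conjI TrueI) (rule e[symmetric])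
    then show "re_part (?Z q) \<noteq> 0"
      using F(5)[OF q, of "\<lambda>i. if i = 0 then 1 else 0" 0] T10_re_0 e n_pos by auto
  qed
  let ?S = "snd c ` (V \<inter> fst c)"
  define a where "a x = re_part (?Z (chart_inv c x)) c" for x
  define b where "b x = im_part (?Z (chart_inv c x)) c" for x
  have S: "open ?S" "?S \<subseteq> snd c ` fst c" "x0 \<in> ?S" using open_chart_image[OF c F(2)] p F(1) by auto
  have ab: "smooth_on ?S a" "smooth_on ?S b"
    using cvector_field_smooth[OF F(3)[OF n_pos] c] by (simp_all add: a_def[abs_def] b_def[abs_def])
  note sm = Chr_apply_smooth[OF c S(1,2)]
  have key: "curl (thc c) x (a x) (b x) \<noteq> 0 \<and> tor c x (a x) (b x) = curl (thc c) x (a x) (b x) *\<^sub>R Tc c x"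
    if x: "x \<in> ?S" for x
  proof -
    let ?q = "chart_inv c x"
    note q = chart_inv_image[OF c x]
    note t = T10_tangent[OF Z(1)[OF q(1)]]
    have cu: "curl (thc c) x (a x) (b x) = 2 * dth ?q (re_part (?Z ?q)) (im_part (?Z ?q))"
      using ext_deriv_chart[OF c q(2) t] q(3) by (simp add: a_def b_def)
    \<comment> \<open>\<open>J\<close> maps Re Z to - Im Z, so this is the Levi form on Re Z. Hence
      \<open>curl\<close> of the pair is negative and may be divided by.\<close>
    have "dth ?q (re_part (?Z ?q)) (- im_part (?Z ?q)) > 0"
      using levi_pos[OF T10_re_levi[OF Z(1)[OF q(1)]] Z(2)[OF q(1)]] levi_J_re[OF Z(1)[OF q(1)]] by simp
    moreover have "tor c x (a x) (b x) = (2 * dth ?q (re_part (?Z ?q)) (im_part (?Z ?q))) *\<^sub>R Tc c x"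
      using torsion_T10(4)[OF Z(1)[OF q(1)] Z(1)[OF q(1)] c q(2)] dth_skew[OF t] q(3)
      by (simp add: a_def b_def Tc_def)
    ultimately show ?thesis using cu by (simp add: dth_neg t)
  qed
  have "smooth_on ?S (\<lambda>x. (1 / curl (thc c) x (a x) (b x)) *\<^sub>R tor c x (a x) (b x))"
    unfolding tor_def using key
    by (intro smooth_on_scaleR smooth_on_divide smooth_on_diff S sm ab smooth_on_const) auto
  then have "smooth_on ?S (Tc c)"
    by (rule smooth_on_cong[OF _ S(1)]) (use key in simp)
  then show "\<exists>T. open T \<and> x0 \<in> T \<and> smooth_on (T \<inter> snd c ` fst c) (Tc c)"
    using S by (intro exI[of _ ?S]) (auto simp: Int_absorb2)
qed

lemma reeb_field: "vector_field A UNIV Tr"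
  using Tc_smooth reeb(1) by (auto simp: vector_field_def smooth_comps_def Tc_def[abs_def])

text \<open>\<open>N\<close> is a local extension of \<open>u\<close>, and \<open>M\<close> is \<open>J\<close> of its horizontal part. Smoothness of \<open>J\<close> is thus
  read off from the frame of \<open>T10\<close>, and that of the metric follows by Cramer's rule.\<close>

lemma J_extension:
  assumes c: "c \<in> A" and p: "p \<in> fst c"
  obtains S where "open S" "snd c p \<in> S" "S \<subseteq> snd c ` fst c"
    "\<And>u. \<exists>N M. smooth_on S N \<and> smooth_on S M \<and> N (snd c p) = u \<and>
      (\<forall>x\<in>S. \<forall>v. Gc c x v (N x) =
        curl (thc c) x (v - thc c x v *\<^sub>R Tc c x) (M x) / 2 + thc c x v * thc c x (N x))"
proof -
  obtain V F where F: "p \<in> V" "open V" "\<And>i. i < n \<Longrightarrow> cvector_field A V (F i)"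
    "\<And>q. q \<in> V \<Longrightarrow> T10 q = {\<Sum>i<n. cscale (a i) (F i q) | a. True}"
    by (rule T10_frame_open[of p]) (rule that)
  let ?S = "snd c ` (V \<inter> fst c)"
  have S: "open ?S" "snd c p \<in> ?S" "?S \<subseteq> snd c ` fst c" using open_chart_image[OF c F(2)] p F(1) by auto
  have "\<exists>N M. smooth_on ?S N \<and> smooth_on ?S M \<and> N (snd c p) = u \<and>
      (\<forall>x\<in>?S. \<forall>v. Gc c x v (N x) =
        curl (thc c) x (v - thc c x v *\<^sub>R Tc c x) (M x) / 2 + thc c x v * thc c x (N x))" for u
  proof -
    let ?u = "coord_vec A c u p"
    have ut: "?u \<in> TM p" by (rule coord_vec_tangent[OF c p])
    obtain W where W: "W \<in> T10 p" "horiz A \<theta> p ?u = re_part W"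
      using horiz_levi[OF ut] unfolding levi_re by blast
    obtain a where a: "W = (\<Sum>i<n. cscale (a i) (F i p))"
      using W(1) unfolding F(4)[OF F(1)] by blast
    \<comment> \<open>The coefficients \<open>a\<close> are frozen at \<open>p\<close>, so
      \<open>Z\<close> is a section of \<open>T10\<close> through \<open>W\<close> that is as smooth
      as the frame.\<close>
    define Z where "Z q = (\<Sum>i<n. cscale (a i) (F i q))" for q
    have ZT: "Z q \<in> T10 q" if "q \<in> V" for q unfolding F(4)[OF that] Z_def by blast
    define k where "k = \<theta> p ?u"
    define N where "N x = k *\<^sub>R Tc c x + re_part (Z (chart_inv c x)) c" for x
    define M where "M x = - im_part (Z (chart_inv c x)) c" for x
    have comp: "re_part (Z q) c = (\<Sum>i<n. Re (a i) *\<^sub>R re_part (F i q) c - Im (a i) *\<^sub>R im_part (F i q) c)"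
      "im_part (Z q) c = (\<Sum>i<n. Re (a i) *\<^sub>R im_part (F i q) c + Im (a i) *\<^sub>R re_part (F i q) c)" for q
      by (simp_all add: Z_def re_part_def im_part_def vec_eq_iff chart_sum cscale_def)
    have "smooth_on ?S (\<lambda>x. re_part (Z (chart_inv c x)) c)" "smooth_on ?S (\<lambda>x. im_part (Z (chart_inv c x)) c)"
      unfolding comp
      by (intro smooth_on_sum smooth_on_diff smooth_on_add smooth_on_scaleR smooth_on_const S cvector_field_smooth F(3) c; simp)+
    then have "smooth_on ?S N" "smooth_on ?S M"
      unfolding N_def[abs_def] M_def[abs_def]
      by (auto intro!: smooth_on_add smooth_on_minus smooth_on_scaleR smooth_on_const S(1)
          smooth_on_subset[OF Tc_smooth[OF c] S(3)])
    moreover have "N (snd c p) = u"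
    proof -
      have "u = ?u c" by (simp add: coord_vec_self c p)
      also have "\<dots> = horiz A \<theta> p ?u c + k *\<^sub>R Tr p c" by (simp add: horiz_apply k_def)
      finally show ?thesis by (simp add: N_def W(2) a Z_def Tc_def chart_inv_snd c p)
    qed
    moreover have "Gc c x v (N x) =
        curl (thc c) x (v - thc c x v *\<^sub>R Tc c x) (M x) / 2 + thc c x v * thc c x (N x)" if x: "x \<in> ?S" for x v
    proof -
      let ?q = "chart_inv c x"
      note q = chart_inv_image[OF c x]
      let ?v = "coord_vec A c v ?q"
      note t = T10_tangent[OF ZT[OF q(1)]]
      have vt: "?v \<in> TM ?q" by (rule coord_vec_tangent[OF c q(2)])
      have Nt: "coord_vec A c (N x) ?q = k *\<^sub>R Tr ?q + re_part (Z ?q)" (is "_ = ?N")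
      proof (rule tangent_eqI[OF _ _ c q(2)])
        show "?N \<in> TM ?q" by (intro tangent_add tangent_scaleR reeb t)
      qed (auto simp: coord_vec_tangent coord_vec_self c q N_def Tc_def)
      have "\<theta> ?q ?N = k"
        using levi_tangent(2)[OF T10_re_levi[OF ZT[OF q(1)]]]
        by (simp add: theta_add theta_scaleR tangent_scaleR reeb t)
      then have "horiz A \<theta> ?q ?N = re_part (Z ?q)" by (auto simp: horiz_apply fun_eq_iff)
      then have J: "levi_J T10 ?q (horiz A \<theta> ?q ?N) = - im_part (Z ?q)" using levi_J_re[OF ZT[OF q(1)]] by simp
      have "thc c x v = \<theta> ?q ?v" "thc c x (N x) = \<theta> ?q ?N" by (simp_all add: thc_def Nt)
      moreover have "horiz A \<theta> ?q ?v c = v - thc c x v *\<^sub>R Tc c x"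
        by (simp add: horiz_apply thc_def Tc_def coord_vec_self c q)
      ultimately show ?thesis
        unfolding Gc_def Nt gW_eq J
        using ext_deriv_chart[OF c q(2) horiz_tangent[OF vt] tangent_neg[OF t(2)]] q(3)
        by (simp add: M_def)
    qed
    ultimately show ?thesis by blast
  qed
  with that S show ?thesis by blast
qed

lemma Gc_smooth: assumes c: "c \<in> A" shows "smooth_on (snd c ` fst c) (\<lambda>x. Gc c x u v)"
proof (rule smooth_on_local[OF open_chart(2)[OF c]])
  fix x0 assume "x0 \<in> snd c ` fst c"
  then obtain p where p: "p \<in> fst c" "x0 = snd c p" by blast
  obtain S where S: "open S" "x0 \<in> S" "S \<subseteq> snd c ` fst c"
    and ex: "\<And>u. \<exists>N M. smooth_on S N \<and> smooth_on S M \<and> N x0 = u \<and>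
      (\<forall>x\<in>S. \<forall>v. Gc c x v (N x) =
        curl (thc c) x (v - thc c x v *\<^sub>R Tc c x) (M x) / 2 + thc c x v * thc c x (N x))"
    using J_extension[OF c p(1)] p(2) by metis
  obtain N M where NM: "\<And>j. smooth_on S (N j)" "\<And>j. smooth_on S (M j)" "\<And>j. N j x0 = axis j 1"
    "\<And>j x v. x \<in> S \<Longrightarrow> Gc c x v (N j x) =
        curl (thc c) x (v - thc c x v *\<^sub>R Tc c x) (M j x) / 2 + thc c x v * thc c x (N j x)"
    using ex[of "axis _ 1 :: real^'m"] by metis
  \<comment> \<open>The columns are the extensions of the standard basis vectors. They form the
    identity matrix at \<open>x0\<close> and therefore remain a frame near it.\<close>
  define B :: "real^'m \<Rightarrow> real^'m^'m" where "B x = (\<chi> i j. N j x $ i)" for x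
  have sB: "smooth_on S (\<lambda>x. B x $ i $ j)" for i j
    by (simp add: B_def smooth_on_vec_nth S NM)
  have sdet: "smooth_on S (\<lambda>x. det (B x))" by (rule smooth_on_det[OF S(1) sB])
  have "B x0 = mat 1" by (auto simp: B_def NM vec_eq_iff mat_def axis_def)
  then have d0: "det (B x0) = 1" by simp
  let ?S = "S \<inter> (\<lambda>x. det (B x)) -` (- {0})"
  have "open ?S"
    by (rule continuous_open_preimage[OF smooth_on_continuous_on[OF sdet] S(1)]) auto
  then have S': "open ?S" "x0 \<in> ?S" "?S \<subseteq> S" using S d0 by auto
  \<comment> \<open>The coefficients of the constant vector \<open>v\<close> in the moving frame
    \<open>N\<close>. They are needed because the metric is so far expressed only when its second
    argument is one of the extensions.\<close>
  define al where "al k x = det (\<chi> i j. if j = k then v $ i else B x $ i $ j) / det (B x)" for k x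
  have sal: "smooth_on ?S (al k)" for k
    unfolding al_def[abs_def]
  proof (rule smooth_on_divide[OF S'(1) _ smooth_on_subset[OF sdet S'(3)]])
    show "smooth_on ?S (\<lambda>x. det (\<chi> i j. if j = k then v $ i else B x $ i $ j))"
    proof (rule smooth_on_det[OF S'(1)])
      show "smooth_on ?S (\<lambda>x. (\<chi> i j. if j = k then v $ i else B x $ i $ j) $ i $ j)" for i j
        by (cases "j = k") (simp_all add: smooth_on_const smooth_on_subset[OF sB S'(3)])
    qed
  qed auto
  have rep: "v = (\<Sum>k\<in>UNIV. al k x *\<^sub>R N k x)" if "x \<in> ?S" for x
  proof -
    have "B x *v (\<chi> k. al k x) = v"
      using that cramer[of "B x" "\<chi> k. al k x" v] by (simp add: al_def)
    then show ?thesis by (simp add: vec_eq_iff matrix_vector_mult_def B_def mult.commute)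
  qed
  have G: "Gc c x u v = (\<Sum>k\<in>UNIV. al k x * (curl (thc c) x (u - thc c x u *\<^sub>R Tc c x) (M k x) / 2 + thc c x u * thc c x (N k x)))"
    if x: "x \<in> ?S" for x
  proof -
    have "linear (Gc c x u)" using Gc_bilinear[OF c, of x] S x by (auto simp: bilinear_def)
    then have "Gc c x u v = (\<Sum>k\<in>UNIV. al k x * Gc c x u (N k x))"
      by (subst rep[OF x]) (simp add: linear_sum linear_scale)
    then show ?thesis using NM(4) x by simp
  qed
  have S'': "?S \<subseteq> snd c ` fst c" using S(3) by blast
  note sm = Chr_apply_smooth[OF c S'(1) S'']
  have s: "smooth_on ?S (Tc c)" "smooth_on ?S (N k)" "smooth_on ?S (M k)" for k
    using smooth_on_subset[OF Tc_smooth[OF c] S''] smooth_on_subset[OF NM(1) S'(3)] smooth_on_subset[OF NM(2) S'(3)]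
    by auto
  have tu: "smooth_on ?S (\<lambda>x. thc c x u)" by (rule sm(3)[OF smooth_on_const smooth_on_const])
  have "smooth_on ?S (\<lambda>x. \<Sum>k\<in>UNIV. al k x * (curl (thc c) x (u - thc c x u *\<^sub>R Tc c x) (M k x) / 2 + thc c x u * thc c x (N k x)))"
    by (intro smooth_on_sum smooth_on_mult smooth_on_add smooth_on_divide sm(2) sm(3)[OF smooth_on_const]
        smooth_on_diff smooth_on_scaleR smooth_on_const S'(1) sal s tu) simp_all
  then have "smooth_on ?S (\<lambda>x. Gc c x u v)"
    by (rule smooth_on_cong[OF _ S'(1)]) (simp only: G)
  then show "\<exists>T. open T \<and> x0 \<in> T \<and> smooth_on (T \<inter> snd c ` fst c) (\<lambda>x. Gc c x u v)"
    using S' S'' by (intro exI[of _ ?S]) (simp add: Int_absorb2)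
qed

section \<open>The Tanaka-Webster axioms in coordinates\<close>

lemma tw_metric:
  assumes "vector_field A V Y" "vector_field A V W" "p \<in> V" "v \<in> TM p"
  shows "dir_deriv A p v (\<lambda>q. gW q (Y q) (W q)) = gW p (nabla p v Y) (W p) + gW p (Y p) (nabla p v W)"
  using tw assms unfolding tanaka_webster_def Let_def by blast

lemma tw_levi:
  assumes "vector_field A V Y" "\<And>q. q \<in> V \<Longrightarrow> Y q \<in> levi T10 q" "p \<in> V" "v \<in> TM p"
  shows "nabla p v Y \<in> levi T10 p"
  using tw[unfolded tanaka_webster_def Let_def, THEN conjunct2, THEN conjunct1, THEN spec, of V, THEN spec, of Y, THEN mp]
    assms by simp

lemma Gc_compat:
  assumes c: "c \<in> A" and x: "x \<in> snd c ` fst c"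
  shows "pd w (\<lambda>y. Gc c y u v) x = Gc c x (Chr c x w u) v + Gc c x u (Chr c x w v)"
proof -
  let ?p = "chart_inv c x"
  note p = chart_inv_dom[OF c x]
  note f = vector_field_coord_const[OF c] and t = coord_vec_tangent[OF c p(1)]
  have e: "(\<lambda>q. gW q (coord_vec A c u q) (coord_vec A c v q)) \<circ> chart_inv c = (\<lambda>y. Gc c y u v)"
    by (simp add: comp_def Gc_def)
  have "dir_deriv A ?p (coord_vec A c w ?p) (\<lambda>q. gW q (coord_vec A c u q) (coord_vec A c v q)) = pd w (\<lambda>y. Gc c y u v) x"
    using dir_deriv_chart[OF c p(1) t, of "\<lambda>q. gW q (coord_vec A c u q) (coord_vec A c v q)" w]
      smooth_on_differentiable[OF Gc_smooth[OF c] x] p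
    by (simp add: e coord_vec_self c)
  moreover have "gW ?p (nabla ?p (coord_vec A c w ?p) (coord_vec A c u)) (coord_vec A c v ?p) = Gc c x (Chr c x w u) v"
    "gW ?p (coord_vec A c u ?p) (nabla ?p (coord_vec A c w ?p) (coord_vec A c v)) = Gc c x u (Chr c x w v)"
    using p Gc_chart[OF c p(1) nabla_tangent[OF f p(1) t] t] Gc_chart[OF c p(1) t nabla_tangent[OF f p(1) t]]
    by (simp_all add: coord_vec_self c Chr_def)
  ultimately show ?thesis
    using tw_metric[OF f f p(1) t, of w u v] by simp
qed

lemma Tc_nabla:
  assumes c: "c \<in> A" and p: "p \<in> fst c" and v: "v \<in> TM p"
  shows "nabla p v Tr c = pd (v c) (Tc c) (snd c p) + Chr c (snd c p) (v c) (Tc c (snd c p))"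
  using nabla_chart[OF reeb_field UNIV_I c p v] by (simp add: Tc_def[abs_def] chart_inv_snd c p)

text \<open>Half of the derivative of g(T, T) = 1.\<close>

lemma theta_nabla_reeb:
  assumes v: "v \<in> TM p" shows "\<theta> p (nabla p v Tr) = 0"
proof -
  have "(\<lambda>q. gW q (Tr q) (Tr q)) = (\<lambda>q. 1)" by (simp add: gW_reeb reeb)
  then have "dir_deriv A p v (\<lambda>q. gW q (Tr q) (Tr q)) = 0"
    by (simp add: dir_deriv_def comp_def Let_def frechet_eqI[OF has_derivative_const])
  then show ?thesis
    using tw_metric[OF reeb_field reeb_field UNIV_I v] nabla_tangent[OF reeb_field UNIV_I v]
    by (simp add: gW_reeb)
qed

text \<open>This says that \<theta> is parallel. The horizontal part \<open>y\<close> of a constant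
  coefficient field stays horizontal under \<open>nabla\<close>. The rest is a multiple of T, and
  since \<theta> vanishes on \<nabla>T, its derivative contributes only the derivative of the
  coefficient.\<close>

lemma thc_parallel:
  assumes c: "c \<in> A" and x: "x \<in> snd c ` fst c"
  shows "thc c x (Chr c x w u) = pd w (\<lambda>y. thc c y u) x"
proof -
  let ?p = "chart_inv c x" and ?w = "coord_vec A c w (chart_inv c x)"
  note p = chart_inv_dom[OF c x]
  note t = coord_vec_tangent[OF c p(1)]
  define y where "y x = u - thc c x u *\<^sub>R Tc c x" for x
  have ys: "smooth_on (snd c ` fst c) y"
    unfolding y_def[abs_def]
    by (intro smooth_on_diff smooth_on_scaleR smooth_on_const open_chart(2)[OF c] thc_smooth[OF c] Tc_smooth[OF c])
  let ?Y = "\<lambda>q. coord_vec A c (y (snd c q)) q"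
  have f: "vector_field A (fst c) ?Y"
    by (rule vector_field_coord[OF c open_chart(1)[OF c] order_refl ys])
  have hor: "?Y q \<in> levi T10 q" if q: "q \<in> fst c" for q
  proof -
    have "?Y q = horiz A \<theta> q (coord_vec A c u q)"
    proof (rule tangent_eqI[OF _ _ c q])
      show "horiz A \<theta> q (coord_vec A c u q) \<in> TM q"
        by (rule horiz_tangent[OF coord_vec_tangent[OF c q]])
    qed (auto simp: coord_vec_tangent coord_vec_self c q horiz_apply y_def thc_def Tc_def chart_inv_snd)
    then show ?thesis using horiz_levi[OF coord_vec_tangent[OF c q]] by simp
  qed
  have "\<theta> ?p (nabla ?p ?w ?Y) = 0"
    by (rule levi_tangent(2)[OF tw_levi[OF f hor p(1) t]])
  moreover have "frechet_derivative (\<lambda>x. ?Y (chart_inv c x) c) (at x) = frechet_derivative y (at x)"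
    by (rule frechet_cong_open[OF open_chart(2)[OF c] x]) (use chart_inv_dom[OF c] c in \<open>auto simp: coord_vec_self\<close>)
  ultimately have 0: "thc c x (pd w y x + Chr c x w (y x)) = 0"
    using nabla_chart[OF f p(1) c p(1) t, of w] theta_chart[OF c p(1) nabla_tangent[OF f p(1) t]] p
    by (simp add: coord_vec_self c)
  have "(y has_derivative (\<lambda>w. 0 - (thc c x u *\<^sub>R pd w (Tc c) x + pd w (\<lambda>x. thc c x u) x *\<^sub>R Tc c x))) (at x)"
    unfolding y_def[abs_def]
    by (intro has_derivative_diff has_derivative_const has_derivative_scaleR smooth_on_has_derivative[OF Tc_smooth[OF c] x]
        smooth_on_has_derivative[OF thc_smooth[OF c] x])
  then have D: "pd w y x = - thc c x u *\<^sub>R pd w (Tc c) x - pd w (\<lambda>x. thc c x u) x *\<^sub>R Tc c x"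
    by (simp add: frechet_eqI)
  have T0: "thc c x (pd w (Tc c) x + Chr c x w (Tc c x)) = 0"
    using theta_nabla_reeb[OF t] theta_chart[OF c p(1) nabla_tangent[OF reeb_field UNIV_I t]]
      Tc_nabla[OF c p(1) t] p by (simp add: coord_vec_self c)
  have T1: "thc c x (Tc c x) = 1"
    using theta_chart[OF c p(1) reeb(1)] reeb(2)[of ?p] p by (simp add: Tc_def)
  note l = thc_linear[OF c x] and b = Chr_bilinear[OF c x]
  have "pd w y x + Chr c x w (y x) = Chr c x w u - pd w (\<lambda>x. thc c x u) x *\<^sub>R Tc c x
      - thc c x u *\<^sub>R (pd w (Tc c) x + Chr c x w (Tc c x))"
    by (simp add: D y_def bilinear_rsub[OF b] bilinear_rmul[OF b] algebra_simps)
  with 0 show ?thesis by (simp add: linear_diff[OF l] linear_scale[OF l] T0 T1)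
qed

text \<open>As \<theta> is parallel, its value on the torsion is its own antisymmetrized
  derivative.\<close>

lemma theta_tor:
  assumes c: "c \<in> A" and x: "x \<in> snd c ` fst c"
  shows "thc c x (tor c x u v) = curl (thc c) x u v"
  by (simp add: tor_def linear_diff[OF thc_linear[OF c x]] thc_parallel[OF c x] curl_def)

text \<open>d\<theta> is half of \<theta> applied to the torsion, and the torsion of two vectors of
  \<open>T10\<close> is zero. Hence d\<theta> has type (1,1).\<close>

lemma dth_T10:
  assumes Z: "Z \<in> T10 p" and W: "W \<in> T10 p"
  shows "dth p (re_part Z) (re_part W) = dth p (im_part Z) (im_part W)"
    and "dth p (re_part Z) (im_part W) = - dth p (im_part Z) (re_part W)"
proof -
  let ?c = "chart_at A p"
  note c = chart_at[of p] and t = T10_tangent[OF Z] T10_tangent[OF W]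
  have e: "dth p u v = thc ?c (snd ?c p) (tor ?c (snd ?c p) (u ?c) (v ?c)) / 2" if "u \<in> TM p" "v \<in> TM p" for u v
    using ext_deriv_chart[OF c that] theta_tor[OF c(1) snd_in[OF c(2)]] by simp
  show "dth p (re_part Z) (re_part W) = dth p (im_part Z) (im_part W)"
    by (simp add: e t torsion_T10(1)[OF Z W c])
  show "dth p (re_part Z) (im_part W) = - dth p (im_part Z) (re_part W)"
    by (simp add: e t torsion_T10(2)[OF Z W c] linear_neg[OF thc_linear[OF c(1) snd_in[OF c(2)]]])
qed

text \<open>That d\<theta> has type (1,1), rewritten through J Re Z = - Im Z. It makes the Webster
  metric symmetric.\<close>

lemma levi_J_dth_sym:
  assumes "u \<in> levi T10 p" "v \<in> levi T10 p"
  shows "dth p u (levi_J T10 p v) = dth p v (levi_J T10 p u)"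
proof -
  obtain Z W where Z: "Z \<in> T10 p" "u = re_part Z" and W: "W \<in> T10 p" "v = re_part W"
    using assms unfolding levi_re by blast
  note t = T10_tangent[OF Z(1)] T10_tangent[OF W(1)]
  show ?thesis
    unfolding Z(2) W(2) levi_J_re[OF Z(1)] levi_J_re[OF W(1)]
    using dth_T10(2)[OF Z(1) W(1)] dth_skew[OF t(2,3)] by (simp add: dth_neg t)
qed

lemma gW_sym: "u \<in> TM p \<Longrightarrow> v \<in> TM p \<Longrightarrow> gW p u v = gW p v u"
  by (simp add: gW_eq levi_J_dth_sym[OF horiz_levi horiz_levi])

text \<open>Differentiating g(T, U) = \<theta>(U) with \<theta> parallel leaves g(\<nabla>T, U) = 0.
  With \<open>?U\<close> extending \<nabla>T itself, positivity of the metric excludes a nonzero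
  value.\<close>

lemma nabla_reeb:
  assumes v: "v \<in> TM p" shows "nabla p v Tr = 0"
proof (rule ccontr)
  let ?c = "chart_at A p"
  note c = chart_at[of p]
  let ?N = "nabla p v Tr"
  assume "?N \<noteq> 0"
  have Nt: "?N \<in> TM p" by (rule nabla_tangent[OF reeb_field UNIV_I v])
  define u where "u = ?N ?c"
  let ?U = "coord_vec A ?c u"
  have U: "?U p = ?N" unfolding u_def by (rule tangent_coord_vec[OF Nt c])
  note f = vector_field_coord_const[OF c(1)]
  have rf: "vector_field A (fst ?c) Tr"
    by (rule vector_field_subset[OF reeb_field open_chart(1)[OF c(1)]]) simp
  have "frechet_derivative ((\<lambda>q. gW q (Tr q) (?U q)) \<circ> chart_inv ?c) (at (snd ?c p)) =
      frechet_derivative (\<lambda>x. thc ?c x u) (at (snd ?c p))"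
    by (rule frechet_cong_open[OF open_chart(2)[OF c(1)] snd_in[OF c(2)]])
      (use chart_inv_dom[OF c(1)] c in \<open>auto simp: gW_reeb coord_vec_tangent thc_def\<close>)
  moreover have "((\<lambda>q. gW q (Tr q) (?U q)) \<circ> chart_inv ?c) differentiable (at (snd ?c p))"
    by (rule differentiable_cong_open(1)[OF smooth_on_differentiable[OF thc_smooth[OF c(1)] snd_in[OF c(2)]]
          open_chart(2)[OF c(1)] snd_in[OF c(2)], of u])
      (use chart_inv_dom[OF c(1)] c in \<open>auto simp: gW_reeb coord_vec_tangent thc_def\<close>)
  ultimately have "dir_deriv A p v (\<lambda>q. gW q (Tr q) (?U q)) = pd (v ?c) (\<lambda>x. thc ?c x u) (snd ?c p)"
    using dir_deriv_chart[OF c v] by simp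
  also have "\<dots> = thc ?c (snd ?c p) (Chr ?c (snd ?c p) (v ?c) u)"
    by (simp add: thc_parallel[OF c(1) snd_in[OF c(2)]])
  also have "Chr ?c (snd ?c p) (v ?c) u = nabla p v ?U ?c"
    using c v by (simp add: Chr_def chart_inv_snd tangent_coord_vec)
  also have "thc ?c (snd ?c p) (nabla p v ?U ?c) = \<theta> p (nabla p v ?U)"
    using theta_chart[OF c nabla_tangent[OF f c(2) v]] by simp
  finally have "gW p ?N (?U p) = 0"
    using tw_metric[OF rf f c(2) v, of u] nabla_tangent[OF f c(2) v] by (simp add: gW_reeb)
  then show False using gW_pos[OF Nt \<open>?N \<noteq> 0\<close>] U by simp
qed

text \<open>On horizontal vectors the torsion axioms give a multiple of T, and applying \<theta>
  identifies the factor as \<open>curl\<close>. If an argument is T, both sides vanish: the right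
  one by the definition of the Reeb field, the left one because \<tau> = 0. This is where the
  Sasakian condition enters.\<close>

lemma tor_eq:
  assumes c: "c \<in> A" and x: "x \<in> snd c ` fst c"
  shows "tor c x u v = curl (thc c) x u v *\<^sub>R Tc c x"
proof -
  let ?p = "chart_inv c x"
  note p = chart_inv_dom[OF c x]
  note b = tor_bilinear[OF c x] and cb = curl_bil[OF c x]
  have T1: "thc c x (Tc c x) = 1"
    using theta_chart[OF c p(1) reeb(1)] reeb(2)[of ?p] p by (simp add: Tc_def)
  have span: "tor c x (h c) (h' c) = curl (thc c) x (h c) (h' c) *\<^sub>R Tc c x"
    if h: "h \<in> levi T10 ?p" "h' \<in> levi T10 ?p" for h h'
  proof -
    obtain Z W where Z: "Z \<in> T10 ?p" "h = re_part Z" and W: "W \<in> T10 ?p" "h' = re_part W"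
      using h unfolding levi_re by blast
    obtain k where k: "tor c x (h c) (h' c) = k *\<^sub>R Tc c x"
      using torsion_T10(3)[OF Z(1) W(1) c p(1)] p Z W by (auto simp: Tc_def)
    have "k = curl (thc c) x (h c) (h' c)"
      using theta_tor[OF c x, of "h c" "h' c"] by (simp add: k T1 linear_scale[OF thc_linear[OF c x]])
    then show ?thesis using k by simp
  qed
  have tor0: "tor c x (Tc c x) v = 0" for v
    using arg_cong[OF pseudo_torsion_0[OF coord_vec_tangent[OF c p(1)]], of "\<lambda>w. w c"]
      torsion_chart[OF c p(1) reeb(1) coord_vec_tangent[OF c p(1)]] p
    by (simp add: tor_def Tc_def coord_vec_self c)
  have tor0': "tor c x v (Tc c x) = 0" for v using tor0[of v] by (simp add: tor_def)
  have curl0: "curl (thc c) x (Tc c x) v = 0" for v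
    using ext_deriv_chart[OF c p(1) reeb(1) coord_vec_tangent[OF c p(1)], of v]
      reeb(3)[OF coord_vec_tangent[OF c p(1)]] p by (simp add: Tc_def coord_vec_self c)
  have curl0': "curl (thc c) x v (Tc c x) = 0" for v using curl0[of v] by (simp add: curl_def)
  define h where "h u = horiz A \<theta> ?p (coord_vec A c u ?p)" for u
  have dec: "u = h u c + thc c x u *\<^sub>R Tc c x" for u
    by (simp add: h_def horiz_apply thc_def Tc_def coord_vec_self c p)
  have hl: "h u \<in> levi T10 ?p" for u unfolding h_def by (rule horiz_levi[OF coord_vec_tangent[OF c p(1)]])
  have "tor c x u v = tor c x (h u c) (h v c)"
    by (subst dec[of u], subst dec[of v])
      (simp add: bilinear_ladd[OF b] bilinear_radd[OF b] bilinear_lmul[OF b] bilinear_rmul[OF b] tor0 tor0')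
  moreover have "curl (thc c) x u v = curl (thc c) x (h u c) (h v c)"
    by (subst dec[of u], subst dec[of v])
      (simp add: bilinear_ladd[OF cb] bilinear_radd[OF cb] bilinear_lmul[OF cb] bilinear_rmul[OF cb] curl0 curl0')
  ultimately show ?thesis using span[OF hl hl] by simp
qed

text \<open>J^2 = -1 on horizontal vectors turns g(u, Jv) into - d\<theta>(u, v), and the components
  along T contribute nothing to d\<theta>. The remaining 1/2 is that of
  \<open>ext_deriv_chart\<close>.\<close>

lemma Omega_chart:
  assumes c: "c \<in> A" "p \<in> fst c" and u: "u \<in> TM p" and v: "v \<in> TM p"
  shows "Omega_form A T10 \<theta> p u v = - curl (thc c) (snd c p) (u c) (v c) / 2"
proof -
  have L: "horiz A \<theta> p v \<in> levi T10 p" by (rule horiz_levi[OF v])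
  note JL = levi_J_levi[OF L]
  have "Omega_form A T10 \<theta> p u v = dth p (horiz A \<theta> p u) (- horiz A \<theta> p v)"
    by (simp add: Omega_form_def J_tensor_def gW_eq horiz_levi_id[OF JL] levi_tangent(2)[OF JL] levi_J_J[OF L])
  also have "\<dots> = - dth p (horiz A \<theta> p u) (horiz A \<theta> p v)"
    by (rule dth_neg[OF horiz_tangent[OF u] levi_tangent(1)[OF L]])
  also have "dth p (horiz A \<theta> p u) (horiz A \<theta> p v) = dth p u v"
  proof -
    have "dth p w (Tr p) = 0" if "w \<in> TM p" for w
      using dth_skew[OF that reeb(1)] reeb(3)[OF that] by simp
    then show ?thesis
      unfolding horiz_def using u v
      by (simp add: dth_diff dth_scaleR tangent_diff tangent_scaleR reeb)
  qed
  finally show ?thesis by (simp add: ext_deriv_chart[OF c u v])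
qed

lemma tw_chart:
  assumes c: "c \<in> A"
  shows "tw_chart (snd c ` fst c) (Gc c) (Chr c) (thc c) (Tc c)"
proof (rule tw_chart.intro)
  fix x u v w assume x: "x \<in> snd c ` fst c"
  note p = chart_inv_dom[OF c x]
  note t = coord_vec_tangent[OF c p(1)]
  show "Gc c x u v = Gc c x v u" unfolding Gc_def by (rule gW_sym[OF t t])
  show "pd w (\<lambda>y. Gc c y u v) x = Gc c x (Chr c x w u) v + Gc c x u (Chr c x w v)" by (rule Gc_compat[OF c x])
  show "Chr c x u v - Chr c x v u = curl (thc c) x u v *\<^sub>R Tc c x"
    using tor_eq[OF c x] by (simp add: tor_def)
  show "pd w (Tc c) x + Chr c x w (Tc c x) = 0"
    using Tc_nabla[OF c p(1) t, of w] p by (simp add: nabla_reeb[OF t] coord_vec_self c)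
  show "Gc c x (Tc c x) u = thc c x u"
    using Gc_chart[OF c p(1) reeb(1) t, of u] p by (simp add: Tc_def coord_vec_self c gW_reeb t thc_def)
  show "thc c x (Tc c x) = 1"
    using theta_chart[OF c p(1) reeb(1)] reeb(2)[of "chart_inv c x"] p by (simp add: Tc_def)
next
  fix x assume x: "x \<in> snd c ` fst c"
  show "bilinear (Gc c x)" by (rule Gc_bilinear[OF c x])
  show "bilinear (Chr c x)" by (rule Chr_bilinear[OF c x])
  show "linear (thc c x)" by (rule thc_linear[OF c x])
qed (use open_chart(2)[OF c] Gc_smooth[OF c] Chr_smooth[OF c] thc_smooth[OF c] Tc_smooth[OF c] in auto)

end

subsection \<open>Properties of intervals that are additive under concatenation\<close>

lemma partition_mono:
  assumes "partition a b k ts" "i \<le> j" "j \<le> k" shows "ts i \<le> ts j"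
  using assms(2,3)
proof (induction j rule: dec_induct)
  case (step j)
  then show ?case using assms(1) by (fastforce simp: partition_def dest: spec[of _ j])
qed simp

lemma partition_bounds:
  assumes "partition a b k ts" "j < k"
  shows "a \<le> ts j" "ts j < ts (Suc j)" "ts (Suc j) \<le> b"
  using partition_mono[OF assms(1), of 0 j] partition_mono[OF assms(1), of "Suc j" k] assms
  by (auto simp: partition_def)

text \<open>Bisection settles each piece, and then the pieces are concatenated. As
  \<open>loc\<close> concerns only short intervals inside one piece, it can be checked in a single
  chart.\<close>

lemma partition_additive:
  assumes part: "partition a b k ts" and "a < b"
    and trans: "\<And>l m u. P l m \<Longrightarrow> P m u \<Longrightarrow> a \<le> l \<Longrightarrow> l \<le> m \<Longrightarrow> m \<le> u \<Longrightarrow> u \<le> b \<Longrightarrow> P l u"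
    and loc: "\<And>j x. j < k \<Longrightarrow> ts j \<le> x \<Longrightarrow> x \<le> ts (Suc j) \<Longrightarrow>
      \<exists>d>0. \<forall>l u. ts j \<le> l \<and> l \<le> x \<and> x \<le> u \<and> u \<le> ts (Suc j) \<and> u - l < d \<longrightarrow> P l u"
  shows "P a b"
proof -
  have piece: "P (ts j) (ts (Suc j))" if j: "j < k" for j
  proof -
    note b = partition_bounds[OF part j]
    have "ts j \<le> ts (Suc j)" using b by simp
    then have "ts j \<le> ts j \<and> ts (Suc j) \<le> ts (Suc j) \<longrightarrow> P (ts j) (ts (Suc j))"
    proof (rule Bolzano[where P="\<lambda>l u. ts j \<le> l \<and> u \<le> ts (Suc j) \<longrightarrow> P l u"])
      fix l m u
      assume h: "ts j \<le> l \<and> m \<le> ts (Suc j) \<longrightarrow> P l m" "ts j \<le> m \<and> u \<le> ts (Suc j) \<longrightarrow> P m u"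
        and o: "l \<le> m" "m \<le> u"
      show "ts j \<le> l \<and> u \<le> ts (Suc j) \<longrightarrow> P l u"
      proof
        assume "ts j \<le> l \<and> u \<le> ts (Suc j)"
        then show "P l u" using h o b by (intro trans[of l m u]) auto
      qed
    next
      fix x assume "ts j \<le> x" "x \<le> ts (Suc j)"
      then obtain d where "d > 0"
        "\<forall>l u. ts j \<le> l \<and> l \<le> x \<and> x \<le> u \<and> u \<le> ts (Suc j) \<and> u - l < d \<longrightarrow> P l u"
        using loc[OF j] by blast
      then show "\<exists>d>0. \<forall>l u. l \<le> x \<and> x \<le> u \<and> u - l < d \<longrightarrow> ts j \<le> l \<and> u \<le> ts (Suc j) \<longrightarrow> P l u"
        by blast
    qed
    then show ?thesis by simp
  qed
  have "k \<noteq> 0" using part \<open>a < b\<close> by (cases "k = 0") (auto simp: partition_def)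
  have "P (ts 0) (ts (Suc j))" if "j < k" for j
    using that
  proof (induction j)
    case 0
    then show ?case by (rule piece)
  next
    case (Suc j)
    note b = partition_bounds[OF part Suc.prems] and m = partition_mono[OF part]
    show ?case
      by (rule trans[OF Suc.IH piece[OF Suc.prems]])
        (use Suc.prems b m[of 0 "Suc j"] part in \<open>auto simp: partition_def\<close>)
  qed
  from this[of "k - 1"] \<open>k \<noteq> 0\<close> show ?thesis using part by (simp add: partition_def)
qed

lemma partition_concat:
  assumes "partition l m k ts" "partition m u k' ts'"
  shows "partition l u (k + k') (\<lambda>j. if j \<le> k then ts j else ts' (j - k))"
  using assms unfolding partition_def
  by (auto simp: Suc_diff_le not_less_eq_eq)

text \<open>Supplies one range of the variation parameter for a whole compact time interval.\<close>

lemma tube_real: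
  fixes K :: "'a::topological_space set"
  assumes "compact K" "open W" "K \<times> {0::real} \<subseteq> W"
  obtains e where "e > 0" "K \<times> {-e<..<e} \<subseteq> W"
proof -
  have sw: "open (prod.swap -` W)"
    by (rule open_vimage[OF assms(2)]) (simp add: continuous_on_swap)
  have "{0} \<times> K \<subseteq> prod.swap -` W" using assms(3) by auto
  from Elementary_Topology.tube_lemma[OF assms(1) sw this] obtain X0 where X0: "0 \<in> X0" "open X0" "X0 \<times> K \<subseteq> prod.swap -` W"
    by blast
  then obtain e where e: "e > 0" "ball 0 e \<subseteq> X0" using open_contains_ball by blast
  have "K \<times> {-e<..<e} \<subseteq> W"
    using X0(3) e(2) by (force simp: subset_iff dist_real_def)
  with e(1) show ?thesis by (rule that)
qed

subsection \<open>Existence of variations\<close>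

lemma smooth_on_along_line:
  assumes "(f has_derivative f') (at (t, s))"
  shows "((\<lambda>t. f (t, s)) has_vector_derivative f' (1, 0)) (at t)"
    and "((\<lambda>s. f (t, s)) has_vector_derivative f' (0, 1)) (at s)"
proof -
  have lin: "linear f'" using assms by (rule has_derivative_linear)
  have "((\<lambda>t. (t, s)) has_derivative (\<lambda>x. x *\<^sub>R (1, 0))) (at t)" "((\<lambda>s. (t, s)) has_derivative (\<lambda>x. x *\<^sub>R (0, 1))) (at s)"
    by (auto intro!: derivative_eq_intros)
  from this[THEN has_derivative_compose, OF assms]
  show "((\<lambda>t. f (t, s)) has_vector_derivative f' (1, 0)) (at t)"
    "((\<lambda>s. f (t, s)) has_vector_derivative f' (0, 1)) (at s)"
    unfolding has_vector_derivative_def by (simp_all only: linear_scale[OF lin])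
qed

lemma smooth_map_subset: "smooth_map A S f \<Longrightarrow> T \<subseteq> S \<Longrightarrow> smooth_map A T f"
  unfolding smooth_map_def
proof (intro ballI impI)
  fix x c assume *: "\<forall>x\<in>S. \<forall>c\<in>A. f x \<in> fst c \<longrightarrow> (\<exists>W h. open W \<and> x \<in> W \<and> f ` (W \<inter> S) \<subseteq> fst c \<and>
      smooth_on W h \<and> (\<forall>w\<in>W \<inter> S. h w = snd c (f w)))" and T: "T \<subseteq> S" and x: "x \<in> T" "c \<in> A" "f x \<in> fst c"
  have "x \<in> S" using T x(1) by blast
  from *[THEN bspec, OF this, THEN bspec, OF x(2), THEN mp, OF x(3)] T
  show "\<exists>W h. open W \<and> x \<in> W \<and> f ` (W \<inter> T) \<subseteq> fst c \<and> smooth_on W h \<and> (\<forall>w\<in>W \<inter> T. h w = snd c (f w))"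
    by (elim exE conjE, intro exI conjI) (assumption | blast)+
qed

lemma smooth_map_cong:
  assumes "smooth_map A S f" "\<And>x. x \<in> S \<Longrightarrow> f x = g x" shows "smooth_map A S g"
  unfolding smooth_map_def
proof (intro ballI impI)
  fix x c assume x: "x \<in> S" "c \<in> A" "g x \<in> fst c"
  then obtain W h where "open W" "x \<in> W" "f ` (W \<inter> S) \<subseteq> fst c" "smooth_on W h" "\<forall>w\<in>W \<inter> S. h w = snd c (f w)"
    using assms unfolding smooth_map_def by (metis (no_types, lifting))
  then show "\<exists>W h. open W \<and> x \<in> W \<and> g ` (W \<inter> S) \<subseteq> fst c \<and> smooth_on W h \<and> (\<forall>w\<in>W \<inter> S. h w = snd c (g w))"
    using assms(2) by (intro exI[of _ W] exI[of _ h]) (auto simp: image_subset_iff)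
qed

context atlas
begin

lemma smooth_map_chart:
  fixes y :: "'a::real_normed_vector \<Rightarrow> real^'m"
  assumes c: "c \<in> A" and W: "open W" "smooth_on W y" "y ` W \<subseteq> snd c ` fst c" and S: "S \<subseteq> W"
  shows "smooth_map A S (\<lambda>w. chart_inv c (y w))"
  unfolding smooth_map_def
proof (intro ballI impI)
  fix x c' assume x: "x \<in> S" and c': "c' \<in> A" "chart_inv c (y x) \<in> fst c'"
  let ?D = "snd c ` (fst c' \<inter> fst c)"
  let ?W = "W \<inter> y -` ?D"
  have D: "open ?D" by (rule open_chart_image[OF c open_chart(1)[OF c'(1)]])
  have oW: "open ?W" by (rule continuous_open_preimage[OF smooth_on_continuous_on[OF W(2)] W(1) D])
  have yx: "y x \<in> snd c ` fst c" using W(3) S x by blast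
  have "y x \<in> ?D" using chart_inv_dom[OF c yx] c'(2) by (metis IntI imageI)
  then have "x \<in> ?W" using S x by blast
  moreover have "(\<lambda>w. chart_inv c (y w)) ` (?W \<inter> S) \<subseteq> fst c'"
    using chart_inv_image(1)[OF c] by blast
  moreover have "smooth_on ?W (\<lambda>w. transition c c' (y w))"
    by (rule smooth_on_compose[OF oW D _ transition_smooth[OF c c'(1)] smooth_on_subset[OF W(2)]]) auto
  ultimately show "\<exists>W h. open W \<and> x \<in> W \<and> (\<lambda>w. chart_inv c (y w)) ` (W \<inter> S) \<subseteq> fst c' \<and> smooth_on W h \<and>
      (\<forall>w\<in>W \<inter> S. h w = snd c' (chart_inv c (y w)))"
    using oW by (intro exI[of _ ?W] exI[of _ "\<lambda>w. transition c c' (y w)"]) (auto simp: transition_eq)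
qed

lemma velocity_transition:
  assumes c: "c \<in> A" "c' \<in> A" "p \<in> fst c" "p \<in> fst c'"
    and k: "(k has_vector_derivative v c) (at x within S)" "k x = snd c p" and v: "v \<in> tangent_space A p"
  shows "((\<lambda>s. snd c' (chart_inv c (k s))) has_vector_derivative v c') (at x within S)"
proof -
  have lin: "linear (J c c' (snd c p))" by (rule J_linear[OF c])
  have "((\<lambda>s. transition c c' (k s)) has_derivative (\<lambda>s. J c c' (snd c p) (s *\<^sub>R v c))) (at x within S)"
    by (rule has_derivative_compose[OF k(1)[unfolded has_vector_derivative_def]])
      (use transition_has_derivative[OF c] k(2) in simp)
  then have "((\<lambda>s. transition c c' (k s)) has_derivative (\<lambda>s. s *\<^sub>R J c c' (snd c p) (v c))) (at x within S)"
    by (simp only: linear_scale[OF lin])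
  then show ?thesis
    unfolding has_vector_derivative_def tangentD[OF v c] by (simp only: transition_eq)
qed

text \<open>A germ of a curve at \<open>p\<close> with velocity \<open>v\<close>. It prescribes how
  a variation moves an end point of a subinterval.\<close>

definition bcurve :: "'p \<Rightarrow> ('p, 'm) tvec \<Rightarrow> (real \<Rightarrow> 'p) \<Rightarrow> bool"
  where "bcurve p v \<sigma> \<longleftrightarrow> (\<exists>e>0. smooth_map A {-e<..<e} \<sigma>) \<and> \<sigma> 0 = p \<and>
    (\<forall>c\<in>A. p \<in> fst c \<longrightarrow> ((\<lambda>s. snd c (\<sigma> s)) has_vector_derivative v c) (at 0))"

lemma bcurve_chart:
  assumes "bcurve p v \<sigma>" and c: "c \<in> A" "p \<in> fst c"
  obtains e k where "e > 0" "smooth_on {-e<..<e} k" "\<And>s. s \<in> {-e<..<e} \<Longrightarrow> \<sigma> s \<in> fst c \<and> k s = snd c (\<sigma> s)"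
    "k 0 = snd c p" "(k has_vector_derivative v c) (at 0)"
proof -
  obtain e0 where e0: "e0 > 0" "smooth_map A {-e0<..<e0} \<sigma>" and p: "\<sigma> 0 = p"
    and d: "((\<lambda>s. snd c (\<sigma> s)) has_vector_derivative v c) (at 0)"
    using assms unfolding bcurve_def by blast
  have "0 \<in> {-e0<..<e0}" using e0 by simp
  then obtain W k where W: "open W" "0 \<in> W" "\<sigma> ` (W \<inter> {-e0<..<e0}) \<subseteq> fst c" "smooth_on W k"
    "\<forall>w\<in>W \<inter> {-e0<..<e0}. k w = snd c (\<sigma> w)"
    using e0(2) c p unfolding smooth_map_def by meson
  obtain e1 where e1: "e1 > 0" "ball 0 e1 \<subseteq> W" using W open_contains_ball by blast
  define e where "e = min e0 e1"
  have e: "e > 0" "{-e<..<e} \<subseteq> W" "{-e<..<e} \<subseteq> {-e0<..<e0}"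
    using e0 e1 by (auto simp: e_def subset_iff dist_real_def)
  have k: "\<sigma> s \<in> fst c \<and> k s = snd c (\<sigma> s)" if "s \<in> {-e<..<e}" for s
    using W(3,5) e(2,3) that by blast
  show ?thesis
  proof (rule that[OF e(1) smooth_on_subset[OF W(4) e(2)] k])
    show "k 0 = snd c p" using k[of 0] e(1) p by simp
    show "(k has_vector_derivative v c) (at 0)"
      by (rule has_vector_derivative_transform_within_open[OF d, of "{-e<..<e}"]) (use k e(1) in auto)
  qed
qed

lemma chart_bcurve:
  assumes c: "c \<in> A" "p \<in> fst c" and v: "v \<in> tangent_space A p"
  shows "\<exists>\<sigma>. bcurve p v \<sigma>"
proof -
  define k where "k s = snd c p + s *\<^sub>R v c" for s :: real
  have k0: "k 0 = snd c p" by (simp add: k_def)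
  have ks: "smooth_on UNIV k" unfolding k_def[abs_def]
    by (intro smooth_on_add smooth_on_const smooth_on_scaleR smooth_on_id open_UNIV)
  have "open (k -` (snd c ` fst c))"
    using continuous_open_preimage[OF smooth_on_continuous_on[OF ks] open_UNIV open_chart(2)[OF c(1)]] by simp
  then obtain e where e: "e > 0" "ball 0 e \<subseteq> k -` (snd c ` fst c)"
    using open_contains_ball k0 c(2) by (metis snd_conv image_eqI vimage_eq)
  have sm: "smooth_map A {-e<..<e} (\<lambda>s. chart_inv c (k s))"
    by (rule smooth_map_chart[OF c(1) open_greaterThanLessThan smooth_on_subset[OF ks]])
      (use e(2) in \<open>auto simp: subset_iff dist_real_def\<close>)
  have d: "(k has_vector_derivative v c) (at 0)"
    unfolding k_def[abs_def] by (auto intro!: derivative_eq_intros)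
  have "bcurve p v (\<lambda>s. chart_inv c (k s))"
    unfolding bcurve_def using e(1) sm k0 chart_inv_snd[OF c] velocity_transition[OF c(1) _ c(2) _ d k0 v]
    by auto
  then show ?thesis by blast
qed

text \<open>A variation over \<open>{l..u}\<close> whose ends follow \<sigma> and \<tau>.
  Prescribing these curves exactly, and not only to first order, is what allows neighbouring pieces
  to be joined.\<close>

definition var_between ::
    "(real \<Rightarrow> 'p) \<Rightarrow> (real \<Rightarrow> ('p, 'm) tvec) \<Rightarrow> real \<Rightarrow> real \<Rightarrow> (real \<Rightarrow> 'p) \<Rightarrow> (real \<Rightarrow> 'p) \<Rightarrow>
      real \<Rightarrow> (real \<Rightarrow> real \<Rightarrow> 'p) \<Rightarrow> bool"
  where "var_between \<gamma> X l u \<sigma> \<tau> e V \<longleftrightarrow> e > 0 \<and> (\<forall>s\<in>{-e<..<e}. V s l = \<sigma> s \<and> V s u = \<tau> s) \<and>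
    (\<forall>t\<in>{l..u}. V 0 t = \<gamma> t \<and>
      (\<forall>c\<in>A. \<gamma> t \<in> fst c \<longrightarrow> ((\<lambda>s. snd c (V s t)) has_vector_derivative X t c) (at 0))) \<and>
    (\<exists>k ts. partition l u k ts \<and>
      (\<forall>j<k. smooth_map A ({ts j..ts (Suc j)} \<times> {-e<..<e}) (\<lambda>(t, s). V s t)))"

text \<open>Along a short interval the variation is linear in a chart, corrected near the two end points by
  terms of second order in \<open>s\<close> so that it has the prescribed boundary curves.\<close>

lemma var_between_chart:
  assumes c: "c \<in> A" and lu: "l < u" and W: "open W" "{l..u} \<subseteq> W" "smooth_on W h" "smooth_on W hX"
    and h: "\<And>t. t \<in> {l..u} \<Longrightarrow> \<gamma> t \<in> fst c \<and> h t = snd c (\<gamma> t) \<and> hX t = X t c \<and> X t \<in> tangent_space A (\<gamma> t)"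
    and \<sigma>: "bcurve (\<gamma> l) (X l) \<sigma>" and \<tau>: "bcurve (\<gamma> u) (X u) \<tau>"
  shows "\<exists>e V. var_between \<gamma> X l u \<sigma> \<tau> e V"
proof -
  have l: "l \<in> {l..u}" and u: "u \<in> {l..u}" using lu by auto
  obtain e1 k1 where k1: "e1 > 0" "smooth_on {-e1<..<e1} k1"
    "\<And>s. s \<in> {-e1<..<e1} \<Longrightarrow> \<sigma> s \<in> fst c \<and> k1 s = snd c (\<sigma> s)" "k1 0 = snd c (\<gamma> l)"
    "(k1 has_vector_derivative X l c) (at 0)"
    using bcurve_chart[OF \<sigma> c] h[OF l] by metis
  obtain e2 k2 where k2: "e2 > 0" "smooth_on {-e2<..<e2} k2"
    "\<And>s. s \<in> {-e2<..<e2} \<Longrightarrow> \<tau> s \<in> fst c \<and> k2 s = snd c (\<tau> s)" "k2 0 = snd c (\<gamma> u)"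
    "(k2 has_vector_derivative X u c) (at 0)"
    using bcurve_chart[OF \<tau> c] h[OF u] by metis
  define e0 where "e0 = min e1 e2"
  let ?I = "{-e0<..<e0}"
  have I: "?I \<subseteq> {-e1<..<e1}" "?I \<subseteq> {-e2<..<e2}" "e0 > 0" using k1(1) k2(1) by (auto simp: e0_def)
  \<comment> \<open>Each difference such as \<open>k1 s - k1 0 - s *\<^sub>R X l c\<close> vanishes
    to first order at \<open>s = 0\<close>. The affine weights are 1 at their own end and 0 at the
    other, so that \<open>y\<close> equals \<open>k1\<close> at \<open>l\<close> and
    \<open>k2\<close> at \<open>u\<close>.\<close>
  define y where "y z = h (fst z) + snd z *\<^sub>R hX (fst z)
      + ((u - fst z) / (u - l)) *\<^sub>R (k1 (snd z) - k1 0 - snd z *\<^sub>R X l c)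
      + ((fst z - l) / (u - l)) *\<^sub>R (k2 (snd z) - k2 0 - snd z *\<^sub>R X u c)" for z :: "real \<times> real"
  let ?B = "W \<times> ?I"
  have oB: "open ?B" by (intro open_Times W open_greaterThanLessThan)
  have f: "smooth_on ?B fst" and s: "smooth_on ?B snd"
    by (auto intro: smooth_on_linear bounded_linear_fst bounded_linear_snd)
  have along: "smooth_on ?B (\<lambda>z. h (fst z))" "smooth_on ?B (\<lambda>z. hX (fst z))"
    "smooth_on ?B (\<lambda>z. k1 (snd z))" "smooth_on ?B (\<lambda>z. k2 (snd z))"
    by (rule smooth_on_compose[OF oB W(1) _ W(3) f] smooth_on_compose[OF oB W(1) _ W(4) f]
        smooth_on_compose[OF oB open_greaterThanLessThan _ smooth_on_subset[OF k1(2) I(1)] s]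
        smooth_on_compose[OF oB open_greaterThanLessThan _ smooth_on_subset[OF k2(2) I(2)] s]; force)+
  have ys: "smooth_on ?B y"
    unfolding y_def[abs_def] using lu
    by (intro smooth_on_add smooth_on_scaleR smooth_on_diff smooth_on_divide smooth_on_const f s along oB) auto
  have y0: "y (t, 0) = h t" for t by (simp add: y_def)
  let ?O = "?B \<inter> y -` (snd c ` fst c)"
  have "open ?O"
    by (rule continuous_open_preimage[OF smooth_on_continuous_on[OF ys] oB open_chart(2)[OF c]])
  moreover have "{l..u} \<times> {0} \<subseteq> ?O" using W(2) h y0 I(3) by auto
  ultimately obtain e where e: "e > 0" "{l..u} \<times> {-e<..<e} \<subseteq> ?O"
    using tube_real[of "{l..u}" ?O] compact_Icc by blast
  define V where "V s t = chart_inv c (y (t, s))" for s t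
  have yl: "y (l, s) = k1 s" "y (u, s) = k2 s" for s
    using lu k1(4) k2(4) h[OF l] h[OF u] by (simp_all add: y_def algebra_simps)
  have eI: "s \<in> ?I" if "s \<in> {-e<..<e}" for s
    using e(2) l that by blast
  have "V s l = \<sigma> s \<and> V s u = \<tau> s" if "s \<in> {-e<..<e}" for s
    using k1(3)[of s] k2(3)[of s] eI[OF that] I(1,2) yl chart_inv_snd[OF c] by (auto simp: V_def)
  moreover have "V 0 t = \<gamma> t \<and> (\<forall>c'\<in>A. \<gamma> t \<in> fst c' \<longrightarrow> ((\<lambda>s. snd c' (V s t)) has_vector_derivative X t c') (at 0))"
    if t: "t \<in> {l..u}" for t
  proof -
    have d: "((\<lambda>s. y (t, s)) has_vector_derivative X t c) (at 0)"
    proof -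
      have "((\<lambda>s. y (t, s)) has_vector_derivative
          (0 + (0 *\<^sub>R 0 + 1 *\<^sub>R hX t) + ((u - t) / (u - l)) *\<^sub>R (X l c - 0 - (0 *\<^sub>R 0 + 1 *\<^sub>R X l c))
          + ((t - l) / (u - l)) *\<^sub>R (X u c - 0 - (0 *\<^sub>R 0 + 1 *\<^sub>R X u c)))) (at 0)"
        unfolding y_def fst_conv snd_conv
        by (intro has_vector_derivative_add has_vector_derivative_diff has_vector_derivative_const
            has_vector_derivative_scaleR DERIV_ident k1(5) k2(5)
            bounded_linear.has_vector_derivative[OF bounded_linear_scaleR_right])
      then show ?thesis using h[OF t] by simp
    qed
    have y0t: "y (t, 0) = snd c (\<gamma> t)" using h[OF t] y0 by simp
    show ?thesis
      using velocity_transition[where p="\<gamma> t" and k="\<lambda>s. y (t, s)" and v="X t" and x=0 and S=UNIV, OF c _ _ _ d y0t] h[OF t] chart_inv_snd[OF c]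
      by (auto simp: V_def y0)
  qed
  moreover have "partition l u 1 (\<lambda>j. if j = 0 then l else u)" using lu by (simp add: partition_def)
  moreover have "smooth_map A ({l..u} \<times> {-e<..<e}) (\<lambda>(t, s). V s t)"
  proof -
    have "smooth_map A ({l..u} \<times> {-e<..<e}) (\<lambda>z. chart_inv c (y z))"
      by (rule smooth_map_chart[OF c \<open>open ?O\<close> smooth_on_subset[OF ys] _ e(2)]) auto
    then show ?thesis by (simp add: V_def case_prod_unfold)
  qed
  ultimately have "var_between \<gamma> X l u \<sigma> \<tau> e V"
    unfolding var_between_def using e(1)
    by (intro conjI exI[of _ 1] exI[of _ "\<lambda>j. if j = 0 then l else u"]) auto
  then show ?thesis by blast
qed

lemma var_between_glue:
  assumes lm: "l < m" and mu: "m < u"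
    and V1: "var_between \<gamma> X l m \<sigma> \<rho> e1 V1" and V2: "var_between \<gamma> X m u \<rho> \<tau> e2 V2"
  shows "\<exists>e V. var_between \<gamma> X l u \<sigma> \<tau> e V"
proof -
  define e where "e = min e1 e2"
  define V where "V s t = (if t \<le> m then V1 s t else V2 s t)" for s t
  have pos: "e1 > 0" "e2 > 0" using V1 V2 by (auto simp: var_between_def)
  have e: "e > 0" "{-e<..<e} \<subseteq> {-e1<..<e1}" "{-e<..<e} \<subseteq> {-e2<..<e2}"
    using pos by (auto simp: e_def)
  \<comment> \<open>Both pieces follow \<rho> at \<open>m\<close>, so the preference of
    \<open>V\<close> for \<open>V1\<close> there is harmless.\<close>
  have m: "V1 s m = V2 s m" if "s \<in> {-e<..<e}" for s
    using V1 V2 e that unfolding var_between_def by (metis subsetD)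
  obtain k1 ts1 where p1: "partition l m k1 ts1"
    "\<And>j. j < k1 \<Longrightarrow> smooth_map A ({ts1 j..ts1 (Suc j)} \<times> {-e1<..<e1}) (\<lambda>(t, s). V1 s t)"
    using V1 unfolding var_between_def by blast
  obtain k2 ts2 where p2: "partition m u k2 ts2"
    "\<And>j. j < k2 \<Longrightarrow> smooth_map A ({ts2 j..ts2 (Suc j)} \<times> {-e2<..<e2}) (\<lambda>(t, s). V2 s t)"
    using V2 unfolding var_between_def by blast
  define ts where "ts j = (if j \<le> k1 then ts1 j else ts2 (j - k1))" for j
  have part: "partition l u (k1 + k2) ts"
    unfolding ts_def[abs_def] by (rule partition_concat[OF p1(1) p2(1)])
  have "smooth_map A ({ts j..ts (Suc j)} \<times> {-e<..<e}) (\<lambda>(t, s). V s t)" if j: "j < k1 + k2" for j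
  proof (cases "j < k1")
    case True
    then have tj: "ts j = ts1 j" "ts (Suc j) = ts1 (Suc j)" by (auto simp: ts_def)
    show ?thesis
      by (rule smooth_map_cong[OF smooth_map_subset[OF p1(2)[OF True]]])
        (use partition_bounds[OF p1(1) True] e in \<open>auto simp: V_def tj\<close>)
  next
    case False
    then have j2: "j - k1 < k2" using j by simp
    have "ts1 k1 = ts2 0" using p1(1) p2(1) by (simp add: partition_def)
    then have tj: "ts j = ts2 (j - k1)" "ts (Suc j) = ts2 (Suc (j - k1))"
      using False by (auto simp: ts_def Suc_diff_le)
    show ?thesis
    proof (rule smooth_map_cong[OF smooth_map_subset[OF p2(2)[OF j2]]])
      show "{ts j..ts (Suc j)} \<times> {-e<..<e} \<subseteq> {ts2 (j - k1)..ts2 (Suc (j - k1))} \<times> {-e2<..<e2}"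
        using e tj by auto
      fix z assume z: "z \<in> {ts j..ts (Suc j)} \<times> {-e<..<e}"
      obtain t s where ts: "z = (t, s)" "t \<in> {ts j..ts (Suc j)}" "s \<in> {-e<..<e}" using z by blast
      have "m \<le> t" using ts(2) partition_bounds[OF p2(1) j2] tj by auto
      then have "V s t = V2 s t" using m[OF ts(3)] by (cases "t = m") (auto simp: V_def)
      then show "(case z of (t, s) \<Rightarrow> V2 s t) = (case z of (t, s) \<Rightarrow> V s t)" by (simp add: ts(1))
    qed
  qed
  then have pc: "\<exists>k ts. partition l u k ts \<and>
      (\<forall>j<k. smooth_map A ({ts j..ts (Suc j)} \<times> {-e<..<e}) (\<lambda>(t, s). V s t))"
    using part by blast
  have "V s l = \<sigma> s \<and> V s u = \<tau> s" if "s \<in> {-e<..<e}" for s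
    using V1 V2 e lm mu that unfolding var_between_def V_def by auto
  moreover have "V 0 t = \<gamma> t \<and> (\<forall>c\<in>A. \<gamma> t \<in> fst c \<longrightarrow> ((\<lambda>s. snd c (V s t)) has_vector_derivative X t c) (at 0))"
    if "t \<in> {l..u}" for t
    using V1 V2 that unfolding var_between_def V_def by (cases "t \<le> m") auto
  ultimately have "var_between \<gamma> X l u \<sigma> \<tau> e V"
    unfolding var_between_def using e(1) pc by blast
  then show ?thesis by blast
qed

lemma bcurve_const: "bcurve p 0 (\<lambda>s. p)"
proof -
  have "smooth_map A {-1<..<1::real} (\<lambda>s. p)"
    unfolding smooth_map_def by (auto intro!: exI[of _ UNIV] smooth_on_const)
  then show ?thesis by (auto simp: bcurve_def intro!: exI[of _ 1])
qed

lemma Gamma_tangent_tangent: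
  assumes "X \<in> Gamma_tangent A a b \<gamma>" "a < b" "t \<in> {a..b}"
  shows "X t \<in> tangent_space A (\<gamma> t)"
proof -
  obtain k ts where p: "partition a b k ts" "\<And>j. j < k \<Longrightarrow> smooth_field_along A {ts j..ts (Suc j)} \<gamma> X"
    using assms(1) unfolding Gamma_tangent_def by blast
  have "\<forall>t\<in>{a..b}. X t \<in> tangent_space A (\<gamma> t)"
  proof (rule partition_additive[OF p(1) assms(2), where P="\<lambda>l u. \<forall>t\<in>{l..u}. X t \<in> tangent_space A (\<gamma> t)"])
    show "\<exists>d>0. \<forall>l u. ts j \<le> l \<and> l \<le> x \<and> x \<le> u \<and> u \<le> ts (Suc j) \<and> u - l < d \<longrightarrow>
        (\<forall>t\<in>{l..u}. X t \<in> tangent_space A (\<gamma> t))" if "j < k" for j x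
      using p(2)[OF that] by (intro exI[of _ 1]) (auto simp: smooth_field_along_def)
  qed force
  then show ?thesis using assms(3) by blast
qed

theorem variation_exists:
  assumes ab: "a < b" and \<gamma>: "smooth_map A {a..b} \<gamma>" and X: "X \<in> Gamma_tangent A a b \<gamma>"
  shows "\<exists>\<epsilon> V. variation A a b \<gamma> X \<epsilon> V"
proof -
  obtain k ts where p: "partition a b k ts" "\<And>j. j < k \<Longrightarrow> smooth_field_along A {ts j..ts (Suc j)} \<gamma> X"
    using X unfolding Gamma_tangent_def by blast
  note XT = Gamma_tangent_tangent[OF X ab]
  \<comment> \<open>Quantifying over all boundary curves allows a free choice of the curve \<rho> at
    the point where two intervals are joined. The premise \<open>l < u\<close> makes degenerate
    intervals trivial.\<close>
  let ?P = "\<lambda>l u. l < u \<longrightarrow> (\<forall>\<sigma> \<tau>. bcurve (\<gamma> l) (X l) \<sigma> \<longrightarrow> bcurve (\<gamma> u) (X u) \<tau> \<longrightarrow>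
    (\<exists>e V. var_between \<gamma> X l u \<sigma> \<tau> e V))"
  have Pab: "?P a b"
  proof (rule partition_additive[OF p(1) ab, where P="?P"])
    fix l m u assume P: "?P l m" "?P m u" and lmu: "a \<le> l" "l \<le> m" "m \<le> u" "u \<le> b"
    show "?P l u"
    proof (cases "l = m \<or> m = u")
      case True
      then show ?thesis using P by auto
    next
      case False
      then have lt: "l < m" "m < u" using lmu by auto
      obtain \<rho> where \<rho>: "bcurve (\<gamma> m) (X m) \<rho>"
        using chart_bcurve[OF chart_at XT[of m]] lmu by auto
      show ?thesis
      proof (intro impI allI)
        fix \<sigma> \<tau> assume "bcurve (\<gamma> l) (X l) \<sigma>" "bcurve (\<gamma> u) (X u) \<tau>"
        then obtain e1 V1 e2 V2 where "var_between \<gamma> X l m \<sigma> \<rho> e1 V1" "var_between \<gamma> X m u \<rho> \<tau> e2 V2"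
          using P lt \<rho> by blast
        then show "\<exists>e V. var_between \<gamma> X l u \<sigma> \<tau> e V" using var_between_glue lt by blast
      qed
    qed
  next
    fix j x assume j: "j < k" and x: "ts j \<le> x" "x \<le> ts (Suc j)"
    let ?S = "{ts j..ts (Suc j)}"
    let ?c = "chart_at A (\<gamma> x)"
    note b = partition_bounds[OF p(1) j]
    have xS: "x \<in> ?S" using x by simp
    obtain W1 h where W1: "open W1" "x \<in> W1" "\<gamma> ` (W1 \<inter> {a..b}) \<subseteq> fst ?c" "smooth_on W1 h"
      "\<forall>w\<in>W1 \<inter> {a..b}. h w = snd ?c (\<gamma> w)"
      using \<gamma>[unfolded smooth_map_def, THEN bspec, THEN bspec, THEN mp, of x ?c] chart_at x b by force
    obtain W2 hX where W2: "open W2" "x \<in> W2" "smooth_on W2 hX" "\<forall>w\<in>W2 \<inter> ?S. hX w = X w ?c"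
      using p(2)[OF j, unfolded smooth_field_along_def, THEN conjunct2, THEN bspec, OF xS, THEN bspec, THEN mp, OF chart_at(1) chart_at(2)]
      by blast
    obtain d where d: "d > 0" "ball x d \<subseteq> W1 \<inter> W2"
      using W1(1,2) W2(1,2) open_contains_ball[of "W1 \<inter> W2"] by (meson IntI open_Int)
    have "?P l u" if lu: "ts j \<le> l" "l \<le> x" "x \<le> u" "u \<le> ts (Suc j)" "u - l < d" for l u
    proof (intro impI allI)
      fix \<sigma> \<tau> assume lt: "l < u" and bc: "bcurve (\<gamma> l) (X l) \<sigma>" "bcurve (\<gamma> u) (X u) \<tau>"
      have sub: "{l..u} \<subseteq> W1 \<inter> W2" using d(2) lu by (force simp: subset_iff dist_real_def)
      have in_ab: "t \<in> {a..b}" "t \<in> ?S" if "t \<in> {l..u}" for t using that lu b by auto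
      show "\<exists>e V. var_between \<gamma> X l u \<sigma> \<tau> e V"
      proof (rule var_between_chart[OF chart_at(1) lt open_Int[OF W1(1) W2(1)] sub
            smooth_on_subset[OF W1(4)] smooth_on_subset[OF W2(3)] _ bc])
        fix t assume t: "t \<in> {l..u}"
        show "\<gamma> t \<in> fst ?c \<and> h t = snd ?c (\<gamma> t) \<and> hX t = X t ?c \<and> X t \<in> tangent_space A (\<gamma> t)"
          using W1(3,5) W2(4) sub t in_ab[OF t] XT[of t] by blast
      qed auto
    qed
    then show "\<exists>d>0. \<forall>l u. ts j \<le> l \<and> l \<le> x \<and> x \<le> u \<and> u \<le> ts (Suc j) \<and> u - l < d \<longrightarrow> ?P l u"
      using d(1) by blast
  qed
  \<comment> \<open>Since \<open>X\<close> vanishes at \<open>a\<close> and \<open>b\<close>, the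
    constant curves are admissible boundary curves, and they keep the end points fixed.\<close>
  have X0: "X a = 0" "X b = 0" using X by (auto simp: Gamma_tangent_def)
  have "bcurve (\<gamma> a) (X a) (\<lambda>s. \<gamma> a)" "bcurve (\<gamma> b) (X b) (\<lambda>s. \<gamma> b)"
    unfolding X0 by (rule bcurve_const)+
  then obtain e V where V: "var_between \<gamma> X a b (\<lambda>s. \<gamma> a) (\<lambda>s. \<gamma> b) e V"
    using Pab ab by blast
  have "curve_velocity A {-e<..<e} (\<lambda>s. V s t) 0 = X t" if t: "t \<in> {a..b}" for t
  proof
    fix c
    have e: "e > 0" "V 0 t = \<gamma> t" using V t by (auto simp: var_between_def)
    show "curve_velocity A {-e<..<e} (\<lambda>s. V s t) 0 c = X t c"
    proof (cases "c \<in> A \<and> \<gamma> t \<in> fst c")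
      case True
      then have "((\<lambda>s. snd c (V s t)) has_vector_derivative X t c) (at 0)"
        using V t by (auto simp: var_between_def)
      then have "vector_derivative (\<lambda>s. snd c (V s t)) (at 0 within {-e<..<e}) = X t c"
        using e by (simp add: at_within_open[of 0 "{-e<..<e}"] vector_derivative_at)
      then show ?thesis using True e by (simp add: curve_velocity_def)
    next
      case False
      show ?thesis unfolding curve_velocity_def e(2) tangent_0D[OF XT[OF t] False] by (simp only: False if_False)
    qed
  qed
  then have "variation A a b \<gamma> X e V"
    using V unfolding variation_def var_between_def by blast
  then show ?thesis by blast
qed

end

subsection \<open>Second variation of length\<close>

lemma smooth_on_sqrt:
  fixes f :: "'a::real_normed_vector \<Rightarrow> real"
  assumes "open S" and pos: "\<And>x. x \<in> S \<Longrightarrow> f x > 0" and f: "smooth_on S f"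
  shows "smooth_on S (\<lambda>x. sqrt (f x))"
proof -
  have "Ck_on k S (\<lambda>x. sqrt (f x))" for k
  proof (induction k)
    case 0
    then show ?case using smooth_on_continuous_on[OF f] by (auto intro: continuous_on_real_sqrt)
  next
    case (Suc k)
    have D: "((\<lambda>x. sqrt (f x)) has_derivative
        (\<lambda>v. frechet_derivative f (at x) v * inverse (2 * sqrt (f x)))) (at x)" if "x \<in> S" for x
    proof -
      have "((\<lambda>x. sqrt (f x)) has_derivative (\<lambda>v. (inverse (sqrt (f x)) / 2) * frechet_derivative f (at x) v)) (at x)"
        by (rule has_derivative_compose[OF smooth_on_has_derivative[OF f that]
              DERIV_real_sqrt[OF pos[OF that], unfolded has_field_derivative_def]])
      then show ?thesis by (simp add: field_simps)
    qed
    have "Ck_on k S (\<lambda>x. frechet_derivative f (at x) v * inverse (2 * sqrt (f x)))" for v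
      using smooth_on_frechet[OF f, of v] pos Suc
      by (intro Ck_on_bilinear[OF bounded_bilinear_mult] Ck_on_inverse Ck_on_const assms(1))
        (auto simp: smooth_on_def dest: less_imp_neq[THEN not_sym])
    then have "Ck_on k S (\<lambda>x. frechet_derivative (\<lambda>x. sqrt (f x)) (at x) v)" for v
      by (rule Ck_on_cong[OF assms(1), rotated]) (use frechet_eqI[OF D] in auto)
    then show ?case using D by (auto simp: differentiable_def)
  qed
  then show ?thesis by (simp add: smooth_on_def)
qed

lemma leibniz_smooth:
  fixes H :: "real \<times> real \<Rightarrow> real"
  assumes D: "smooth_on D H" "{l..u} \<times> {-d<..<d} \<subseteq> D" and s: "s \<in> {-d<..<d}"
  shows "(\<lambda>t. H (t, s)) integrable_on {l..u}"
    "((\<lambda>s. integral {l..u} (\<lambda>t. H (t, s))) has_real_derivative integral {l..u} (\<lambda>t. pd (0, 1) H (t, s))) (at s)"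
proof -
  have int: "(\<lambda>t. H (t, s)) integrable_on {l..u}" if s: "s \<in> {-d<..<d}" for s
    by (intro integrable_continuous_real continuous_on_compose2[OF smooth_on_continuous_on[OF D(1)]] continuous_intros)
      (use D(2) s in auto)
  show "(\<lambda>t. H (t, s)) integrable_on {l..u}" by (rule int[OF s])
  have "((\<lambda>s. integral (cbox l u) (\<lambda>t. H (t, s))) has_field_derivative
      integral (cbox l u) (\<lambda>t. pd (0, 1) H (t, s))) (at s within {-d<..<d})"
  proof (rule leibniz_rule_field_derivative[where f="\<lambda>s t. H (t, s)" and fx="\<lambda>s t. pd (0, 1) H (t, s)"])
    fix s t assume st: "s \<in> {-d<..<d}" "t \<in> cbox l u"
    then have "(t, s) \<in> D" using D(2) by auto
    from smooth_on_along_line(2)[OF smooth_on_has_derivative[OF D(1) this]]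
    have "((\<lambda>s. H (t, s)) has_field_derivative pd (0, 1) H (t, s)) (at s)"
      by (simp add: has_real_derivative_iff_has_vector_derivative)
    then show "((\<lambda>s. H (t, s)) has_field_derivative pd (0, 1) H (t, s)) (at s within {-d<..<d})"
      by (rule has_field_derivative_at_within)
  next
    fix s assume "s \<in> {-d<..<d}"
    then show "(\<lambda>t. H (t, s)) integrable_on cbox l u" using int by simp
  next
    show "continuous_on ({-d<..<d} \<times> cbox l u) (\<lambda>(s, t). pd (0, 1) H (t, s))"
      unfolding case_prod_unfold
      by (intro continuous_on_compose2[OF smooth_on_continuous_on[OF smooth_on_frechet[OF D(1)]]] continuous_intros)
        (use D(2) in auto)
  qed (use s in auto)
  then show "((\<lambda>s. integral {l..u} (\<lambda>t. H (t, s))) has_real_derivative integral {l..u} (\<lambda>t. pd (0, 1) H (t, s))) (at s)"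
    using s by (simp add: at_within_open[of s "{-d<..<d}"])
qed

lemma pd_pd_cong:
  assumes "open I" "x \<in> I" "\<And>y. y \<in> I \<Longrightarrow> f y = g y"
  shows "pd e (pd e' f) x = pd e (pd e' g) x"
proof -
  have "frechet_derivative (pd e' f) (at x) = frechet_derivative (pd e' g) (at x)"
    by (rule frechet_cong_open[OF assms(1,2)]) (simp add: frechet_cong_open[OF assms(1) _ assms(3)])
  then show ?thesis by simp
qed

lemma pd_vector_derivative: "(f has_vector_derivative w) (at t) \<Longrightarrow> pd 1 f t = w"
  unfolding has_vector_derivative_def by (simp add: frechet_eqI)

lemma smooth_on_has_vector_derivative:
  "smooth_on S f \<Longrightarrow> t \<in> S \<Longrightarrow> (f has_vector_derivative pd 1 f t) (at t)"
  for f :: "real \<Rightarrow> 'b::real_normed_vector"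
proof -
  assume "smooth_on S f" "t \<in> S"
  then have D: "(f has_derivative frechet_derivative f (at t)) (at t)" by (rule smooth_on_has_derivative)
  have "frechet_derivative f (at t) = (\<lambda>e. e *\<^sub>R pd 1 f t)"
  proof
    fix e show "pd e f t = e *\<^sub>R pd 1 f t"
      using linear_scale[OF has_derivative_linear[OF D], of e 1] by (simp only: real_scaleR_def mult_1_right)
  qed
  with D show ?thesis unfolding has_vector_derivative_def by simp
qed

lemma pd_line:
  fixes f :: "real \<times> real \<Rightarrow> 'b::real_normed_vector"
  assumes "smooth_on D f" "(t, s) \<in> D"
  shows "pd 1 (\<lambda>t. f (t, s)) t = pd (1, 0) f (t, s)" "pd 1 (\<lambda>s. f (t, s)) s = pd (0, 1) f (t, s)"
  by (rule pd_vector_derivative, rule smooth_on_along_line[OF smooth_on_has_derivative[OF assms]])+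

lemma smooth_on_partial:
  fixes f :: "real \<times> real \<Rightarrow> 'b::real_normed_vector"
  assumes "smooth_on D f" "(t, s) \<in> D"
  shows "((\<lambda>t. f (t, s)) has_vector_derivative pd (1, 0) f (t, s)) (at t within S)"
    "((\<lambda>s. f (t, s)) has_vector_derivative pd (0, 1) f (t, s)) (at s within S)"
  using smooth_on_along_line[OF smooth_on_has_derivative[OF assms]] has_vector_derivative_at_within by blast+

lemma smooth_on_line:
  fixes f :: "real \<times> real \<Rightarrow> 'b::real_normed_vector"
  assumes "smooth_on D f" "open D"
  shows "open {t. (t, s) \<in> D}" "smooth_on {t. (t, s) \<in> D} (\<lambda>t. f (t, s))"
    "open {s. (t, s) \<in> D}" "smooth_on {s. (t, s) \<in> D} (\<lambda>s. f (t, s))"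
proof -
  show o: "open {t. (t, s) \<in> D}"
    using open_vimage[OF assms(2), of "\<lambda>t. (t, s)"] by (simp add: vimage_def continuous_on_Pair)
  show o': "open {s. (t, s) \<in> D}"
    using open_vimage[OF assms(2), of "\<lambda>s. (t, s)"] by (simp add: vimage_def continuous_on_Pair)
  have l: "smooth_on S (\<lambda>t. (t, s))" "smooth_on S' (\<lambda>s. (t, s))" if "open S" "open S'" for S S' :: "real set"
  proof -
    have "smooth_on S (\<lambda>t. t *\<^sub>R (1::real, 0::real) + (0, s))" "smooth_on S' (\<lambda>s. s *\<^sub>R (0::real, 1::real) + (t, 0))"
      by (intro smooth_on_add smooth_on_scaleR smooth_on_id smooth_on_const that)+
    then show "smooth_on S (\<lambda>t. (t, s))" "smooth_on S' (\<lambda>s. (t, s))" by simp_all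
  qed
  show "smooth_on {t. (t, s) \<in> D} (\<lambda>t. f (t, s))"
    by (rule smooth_on_compose[OF o assms(2) _ assms(1) l(1)[OF o o']]) auto
  show "smooth_on {s. (t, s) \<in> D} (\<lambda>s. f (t, s))"
    by (rule smooth_on_compose[OF o' assms(2) _ assms(1) l(2)[OF o o']]) auto
qed

section \<open>Velocity and acceleration under a change of chart\<close>

lemma (in atlas) curve_velocity_eq:
  assumes c: "c \<in> A" "\<sigma> x \<in> fst c" and k: "(k has_vector_derivative w) (at x within S)"
    and x: "x \<in> S" "at x within S \<noteq> bot"
    and near: "d > 0" "\<And>s. s \<in> S \<Longrightarrow> dist s x < d \<Longrightarrow> \<sigma> s \<in> fst c \<and> k s = snd c (\<sigma> s)"
  shows "curve_velocity A S \<sigma> x = coord_vec A c w (\<sigma> x)"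
proof
  fix c'
  show "curve_velocity A S \<sigma> x c' = coord_vec A c w (\<sigma> x) c'"
  proof (cases "c' \<in> A \<and> \<sigma> x \<in> fst c'")
    case True
    have kx: "k x = snd c (\<sigma> x)" using near x by auto
    have "((\<lambda>s. snd c' (chart_inv c (k s))) has_vector_derivative coord_vec A c w (\<sigma> x) c') (at x within S)"
      by (rule velocity_transition[where v="coord_vec A c w (\<sigma> x)" and k=k, OF c(1) _ c(2) _ _ kx coord_vec_tangent[OF c]])
        (use True k c in \<open>auto simp: coord_vec_self\<close>)
    then have "((\<lambda>s. snd c' (\<sigma> s)) has_vector_derivative coord_vec A c w (\<sigma> x) c') (at x within S)"
      by (rule has_vector_derivative_transform_within[OF _ near(1) x(1)])
        (use near(2) chart_inv_snd[OF c(1)] in auto)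
    then show ?thesis using True by (simp add: curve_velocity_def vector_derivative_within[OF x(2)])
  next
    case False
    show ?thesis unfolding curve_velocity_def coord_vec_def by (simp only: False if_False)
  qed
qed

text \<open>Differentiating the Jacobian along \<open>k\<close> produces the second derivative of
  the transition map, which the inhomogeneous term of \<open>Chr_transition\<close> cancels.\<close>

lemma (in connection_atlas) acceleration_transition:
  fixes k :: "real \<Rightarrow> real^'m"
  assumes c: "c \<in> A" "c' \<in> A" and I: "open I" "0 \<in> I" and k: "smooth_on I k"
    and kI: "k ` I \<subseteq> snd c ` (fst c' \<inter> fst c)"
  defines "k' \<equiv> \<lambda>s. transition c c' (k s)"
  shows "pd 1 (pd 1 k') 0 + Chr c' (k' 0) (pd 1 k' 0) (pd 1 k' 0) =
    J c c' (k 0) (pd 1 (pd 1 k) 0 + Chr c (k 0) (pd 1 k 0) (pd 1 k 0))"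
proof -
  let ?D = "snd c ` (fst c' \<inter> fst c)"
  have T: "smooth_on ?D (transition c c')" by (rule transition_smooth[OF c])
  have D: "open ?D" by (rule open_chart_image[OF c(1) open_chart(1)[OF c(2)]])
  have kD: "k s \<in> ?D" if "s \<in> I" for s using kI that by blast
  have d1: "pd 1 k' s = J c c' (k s) (pd 1 k s)" if "s \<in> I" for s
  proof -
    have "(k' has_derivative (\<lambda>e. J c c' (k s) (pd e k s))) (at s)"
      unfolding k'_def
      by (rule has_derivative_compose[OF smooth_on_has_derivative[OF k that] smooth_on_has_derivative[OF T kD[OF that]]])
    then show ?thesis by (simp add: frechet_eqI)
  qed
  have lin: "linear (J c c' (k s))" if "s \<in> I" for s
    using smooth_on_has_derivative[OF T kD[OF that]] by (rule has_derivative_linear)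
  have diff: "((\<lambda>s. J c c' (k s) u) has_derivative (\<lambda>e. pd (pd e k 0) (\<lambda>x. J c c' x u) (k 0))) (at 0)" for u
    by (rule has_derivative_compose[OF smooth_on_has_derivative[OF k I(2)]
          smooth_on_has_derivative[OF smooth_on_frechet[OF T] kD[OF I(2)]]])
  have "((\<lambda>s. J c c' (k s) (pd 1 k s)) has_derivative
      (\<lambda>e. pd e (\<lambda>s. J c c' (k s) (pd 1 k 0)) 0 + J c c' (k 0) (pd e (pd 1 k) 0))) (at 0)"
    by (rule frechet_apply_linear[OF I lin _ smooth_on_has_derivative[OF smooth_on_frechet[OF k] I(2)]])
      (use diff in \<open>auto simp: differentiable_def\<close>)
  then have "(pd 1 k' has_derivative
      (\<lambda>e. pd e (\<lambda>s. J c c' (k s) (pd 1 k 0)) 0 + J c c' (k 0) (pd e (pd 1 k) 0))) (at 0)"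
    by (rule has_derivative_transform_within_open[OF _ I]) (simp add: d1)
  then have d2: "pd 1 (pd 1 k') 0 = pd (pd 1 k 0) (pd (pd 1 k 0) (transition c c')) (k 0) + J c c' (k 0) (pd 1 (pd 1 k) 0)"
    by (simp add: frechet_eqI frechet_eqI[OF diff])
  define p where "p = chart_inv c (k 0)"
  have p: "p \<in> fst c" "p \<in> fst c'" "snd c p = k 0"
    using chart_inv_image[OF c(1) kD[OF I(2)]] by (auto simp: p_def)
  have "snd c' p = k' 0" by (simp add: k'_def transition_eq p_def)
  with Chr_transition[OF c(1) p(1) c(2) p(2), of "pd 1 k 0" "pd 1 k 0"]
  show ?thesis by (simp add: p(3) d1[OF I(2)] d2 linear_add[OF lin[OF I(2)]])
qed

abbreviation (in sasaki_pos) "covc c \<equiv> tw_chart.cov (Chr c)"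

lemma (in sasaki_pos) covc_def: "c \<in> A \<Longrightarrow> covc c h e p z = pd e p z + Chr c (h z) (pd e h z) (p z)"
  by (rule tw_chart.cov_def[OF tw_chart])

lemma (in sasaki_pos) Gc_transition:
  assumes "c \<in> A" "c' \<in> A" "p \<in> fst c" "p \<in> fst c'"
  shows "Gc c' (snd c' p) (J c c' (snd c p) u) (J c c' (snd c p) v) = Gc c (snd c p) u v"
proof -
  note t = coord_vec_tangent[OF assms(1,3)]
  show ?thesis
    using Gc_chart[OF assms(1,3) t t, of u v] Gc_chart[OF assms(2,4) t t, of u v]
    by (simp add: coord_vec_apply assms J_id)
qed

locale lengthy_geodesic = sasaki_pos A n T10 \<theta> nabla
  for A :: "('p::topological_space, 'm::finite) chart set" and n :: nat
    and T10 :: "'p \<Rightarrow> ('p, 'm) ctvec set"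
    and \<theta> :: "'p \<Rightarrow> ('p, 'm) tvec \<Rightarrow> real"
    and nabla :: "('p, 'm) connection" +
  fixes a b r :: real and \<gamma> :: "real \<Rightarrow> 'p"
  assumes ab: "a < b" and gamma_smooth: "smooth_map A {a..b} \<gamma>"
    and geodesic: "\<And>t. t \<in> {a..b} \<Longrightarrow> cov_deriv A nabla {a..b} \<gamma> (curve_velocity A {a..b} \<gamma>) t = 0"
    and lengthy: "\<And>t. t \<in> {a..b} \<Longrightarrow> curve_velocity A {a..b} \<gamma> t \<in> levi T10 (\<gamma> t)"
    and r_pos: "r > 0"
    and speed: "\<And>t. t \<in> {a..b} \<Longrightarrow> webster_metric A T10 \<theta> (\<gamma> t)
      (curve_velocity A {a..b} \<gamma> t) (curve_velocity A {a..b} \<gamma> t) = r\<^sup>2"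
begin

abbreviation "vel \<equiv> curve_velocity A {a..b} \<gamma>"
abbreviation "nor \<equiv> perp A gW a b \<gamma> r"
abbreviation "D\<^sub>t \<equiv> cov_deriv A nabla {a..b} \<gamma>"
abbreviation "Om \<equiv> Omega_form A T10 \<theta>"

definition integrand :: "(real \<Rightarrow> ('p, 'm) tvec) \<Rightarrow> (real \<Rightarrow> ('p, 'm) tvec) \<Rightarrow> real \<Rightarrow> real"
  where "integrand X Y t =
     gW (\<gamma> t) (D\<^sub>t (nor X) t) (D\<^sub>t (nor Y) t)
     - gW (\<gamma> t) (curvature A nabla (\<gamma> t) (nor X t) (vel t) (vel t)) (nor Y t)
     - 2 * Om (\<gamma> t) (nor X t) (vel t) * \<theta> (\<gamma> t) (D\<^sub>t (nor Y) t)
     - 2 * (\<theta> (\<gamma> t) (D\<^sub>t (nor X) t) - 2 * Om (\<gamma> t) (nor X t) (vel t)) * Om (\<gamma> t) (nor Y t) (vel t)"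

section \<open>The geodesic and the fields along it in a chart\<close>

lemma nontrivial: "l < u \<Longrightarrow> t \<in> {l..u} \<Longrightarrow> at t within {l..u} \<noteq> bot" for l u t :: real
  by (metis islimpt_Icc trivial_limit_within atLeastAtMost_iff)

lemma vel_tangent: "t \<in> {a..b} \<Longrightarrow> vel t \<in> TM (\<gamma> t)"
  using lengthy levi_tangent by blast

lemma gamma_velocity:
  assumes t: "t \<in> {a..b}" and c: "c \<in> A" "\<gamma> t \<in> fst c"
  shows "((\<lambda>s. snd c (\<gamma> s)) has_vector_derivative vel t c) (at t within {a..b})"
proof -
  obtain W x where W: "open W" "t \<in> W" "\<gamma> ` (W \<inter> {a..b}) \<subseteq> fst c" "smooth_on W x"
    "\<forall>w\<in>W \<inter> {a..b}. x w = snd c (\<gamma> w)"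
    using gamma_smooth[unfolded smooth_map_def, THEN bspec, OF t, THEN bspec, OF c(1), THEN mp, OF c(2)] by blast
  obtain e where e: "e > 0" "ball t e \<subseteq> W" using W open_contains_ball by blast
  have "(x has_vector_derivative pd 1 x t) (at t within {a..b})"
    by (rule has_vector_derivative_at_within[OF smooth_on_has_vector_derivative[OF W(4,2)]])
  then have d: "((\<lambda>s. snd c (\<gamma> s)) has_vector_derivative pd 1 x t) (at t within {a..b})"
    by (rule has_vector_derivative_transform_within[OF _ e(1) t])
      (use W e in \<open>auto simp: subset_iff dist_commute\<close>)
  show ?thesis
    using vector_derivative_within[OF nontrivial[OF ab t] d] d c by (simp add: curve_velocity_def)
qed

lemma cov_deriv_chart:
  fixes t
  defines "c \<equiv> chart_at A (\<gamma> t)"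
  assumes t: "t \<in> {a..b}"
  shows "D\<^sub>t Z t = coord_vec A c (vector_derivative (\<lambda>s. Z s c) (at t within {a..b})
    + Chr c (snd c (\<gamma> t)) (vel t c) (Z t c)) (\<gamma> t)"
proof -
  have c: "c \<in> A" "\<gamma> t \<in> fst c" using chart_at by (auto simp: c_def)
  have "nabla (\<gamma> t) (vel t) (coord_vec A c (Z t c)) =
      coord_vec A c (Chr c (snd c (\<gamma> t)) (vel t c) (Z t c)) (\<gamma> t)"
    using tangent_coord_vec[OF nabla_tangent[OF vector_field_coord_const[OF c(1)] c(2) vel_tangent[OF t]] c, of "Z t c"]
      tangent_coord_vec[OF vel_tangent[OF t] c]
    by (simp add: Chr_def chart_inv_snd c)
  then show ?thesis by (simp only: cov_deriv_def Let_def c_def[symmetric] coord_vec_add[OF c])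
qed

lemma nor_tangent: "t \<in> {a..b} \<Longrightarrow> X t \<in> TM (\<gamma> t) \<Longrightarrow> nor X t \<in> TM (\<gamma> t)"
  unfolding perp_def by (intro tangent_diff tangent_scaleR vel_tangent)

text \<open>\<open>x\<close> and \<open>\<xi>\<close> are the coordinate expressions of \<open>\<gamma>\<close> and \<open>X\<close> near \<open>t\<close>, in the chart that the
  definitions of curvature and covariant derivative select at \<open>\<gamma> t\<close>.\<close>

definition loc_rep :: "real \<Rightarrow> real set \<Rightarrow> (real \<Rightarrow> real^'m) \<Rightarrow> bool"
  where "loc_rep t W x \<longleftrightarrow> open W \<and> t \<in> W \<and> W \<subseteq> {a<..<b} \<and> smooth_on W x \<and>
    (\<forall>s\<in>W. \<gamma> s \<in> fst (chart_at A (\<gamma> t)) \<and> x s = snd (chart_at A (\<gamma> t)) (\<gamma> s))"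

definition field_rep :: "real \<Rightarrow> real set \<Rightarrow> (real \<Rightarrow> ('p, 'm) tvec) \<Rightarrow> (real \<Rightarrow> real^'m) \<Rightarrow> bool"
  where "field_rep t W X \<xi> \<longleftrightarrow> smooth_on W \<xi> \<and> (\<forall>s\<in>W. \<xi> s = X s (chart_at A (\<gamma> t)) \<and> X s \<in> TM (\<gamma> s))"

context
  fixes t W x c
  assumes loc: "loc_rep t W x"
  defines "c \<equiv> chart_at A (\<gamma> t)"
begin

lemma loc_c: "c \<in> A" "s \<in> W \<Longrightarrow> \<gamma> s \<in> fst c" "s \<in> W \<Longrightarrow> x s = snd c (\<gamma> s)"
  "s \<in> W \<Longrightarrow> x s \<in> snd c ` fst c" "s \<in> W \<Longrightarrow> s \<in> {a..b}" "open W" "t \<in> W" "smooth_on W x"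
  using loc chart_at by (auto simp: loc_rep_def c_def)

lemma at_within_W: "s \<in> W \<Longrightarrow> at s within {a..b} = at s"
  using loc by (intro at_within_interior) (auto simp: loc_rep_def subset_iff)

lemma loc_vel: assumes "s \<in> W" shows "vel s c = pd 1 x s"
proof -
  have "((\<lambda>s. snd c (\<gamma> s)) has_vector_derivative vel s c) (at s)"
    using gamma_velocity[OF loc_c(5)[OF assms] loc_c(1) loc_c(2)[OF assms]] by (simp add: at_within_W[OF assms])
  then have "(x has_vector_derivative vel s c) (at s)"
    by (rule has_vector_derivative_transform_within_open[OF _ loc_c(6) assms]) (simp add: loc_c)
  then show ?thesis by (simp add: pd_vector_derivative)
qed

lemma loc_cov_deriv:
  assumes z: "smooth_on W z" "\<And>s. s \<in> W \<Longrightarrow> z s = Z s c"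
  shows "D\<^sub>t Z t = coord_vec A c (covc c x 1 z t) (\<gamma> t)"
proof -
  have "((\<lambda>s. Z s c) has_vector_derivative pd 1 z t) (at t)"
    by (rule has_vector_derivative_transform_within_open[OF smooth_on_has_vector_derivative[OF z(1) loc_c(7)] loc_c(6,7)])
      (rule z(2))
  then show ?thesis
    using cov_deriv_chart[OF loc_c(5)[OF loc_c(7)], of Z] loc_vel[OF loc_c(7)] z(2)[OF loc_c(7)] loc_c(3)[OF loc_c(7)]
    by (simp add: covc_def[OF loc_c(1)] at_within_W[OF loc_c(7)] vector_derivative_at flip: c_def)
qed

lemma loc_geodesic: "covc c x 1 (pd 1 x) t = 0"
proof -
  have "D\<^sub>t vel t c = covc c x 1 (pd 1 x) t"
    using loc_cov_deriv[of "pd 1 x" vel, OF smooth_on_frechet[OF loc_c(8)] loc_vel[symmetric]] loc_c by (simp add: coord_vec_self)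
  then show ?thesis using geodesic[OF loc_c(5)[OF loc_c(7)]] by simp
qed

lemma loc_facts: "thc c (x t) (pd 1 x t) = 0" "Gc c (x t) (pd 1 x t) (pd 1 x t) = r\<^sup>2"
proof -
  note t = loc_c(5)[OF loc_c(7)] and c = loc_c(1) loc_c(2)[OF loc_c(7)]
  show "thc c (x t) (pd 1 x t) = 0"
    using theta_chart[OF c vel_tangent[OF t]] levi_tangent(2)[OF lengthy[OF t]] loc_vel[OF loc_c(7)] loc_c(3)[OF loc_c(7)]
    by simp
  show "Gc c (x t) (pd 1 x t) (pd 1 x t) = r\<^sup>2"
    using Gc_chart[OF c vel_tangent[OF t] vel_tangent[OF t]] speed[OF t] loc_vel[OF loc_c(7)] loc_c(3)[OF loc_c(7)]
    by simp
qed

definition nor_c :: "real^'m \<Rightarrow> real^'m"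
  where "nor_c w = w - (1 / r\<^sup>2 * Gc c (x t) w (pd 1 x t)) *\<^sub>R pd 1 x t"

text \<open>The velocity is parallel and the connection is metric, so covariant differentiation
  commutes with the projection onto the normal part.\<close>

lemma nor_rep:
  assumes X: "field_rep t W X \<xi>"
  shows "nor X t c = nor_c (\<xi> t)" "D\<^sub>t (nor X) t = coord_vec A c (nor_c (covc c x 1 \<xi> t)) (\<gamma> t)"
proof -
  interpret C: tw_chart "snd c ` fst c" "Gc c" "Chr c" "thc c" "Tc c" by (rule tw_chart[OF loc_c(1)])
  have X: "smooth_on W \<xi>" "\<And>s. s \<in> W \<Longrightarrow> \<xi> s = X s c" "\<And>s. s \<in> W \<Longrightarrow> X s \<in> TM (\<gamma> s)"
    using X by (auto simp: field_rep_def c_def)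
  have xW: "x ` W \<subseteq> snd c ` fst c" using loc_c(4) by blast
  note al = loc_c(6) loc_c(8) xW
  have v: "smooth_on W (pd 1 x)" by (rule smooth_on_frechet[OF loc_c(8)])
  define k where "k s = 1 / r\<^sup>2 * Gc c (x s) (\<xi> s) (pd 1 x s)" for s
  have ks: "smooth_on W k"
    unfolding k_def[abs_def] by (intro smooth_on_mult smooth_on_const loc_c(6) C.smooth_G[OF al X(1) v])
  define P where "P s = \<xi> s + (- k s) *\<^sub>R pd 1 x s" for s
  have Ps: "smooth_on W P"
    unfolding P_def[abs_def] by (intro smooth_on_add smooth_on_scaleR smooth_on_minus ks X(1) v loc_c(6))
  have P: "P s = nor X s c" if s: "s \<in> W" for s
    using Gc_chart[OF loc_c(1) loc_c(2)[OF s] X(3)[OF s] vel_tangent[OF loc_c(5)[OF s]]]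
      loc_vel[OF s] X(2)[OF s] loc_c(3)[OF s]
    by (simp add: P_def perp_def k_def)
  show "nor X t c = nor_c (\<xi> t)"
    using P[OF loc_c(7)] by (simp add: P_def nor_c_def k_def)
  have d: "\<xi> differentiable (at t)" "pd 1 x differentiable (at t)" "k differentiable (at t)" "(\<lambda>s. - k s) differentiable (at t)"
    using smooth_on_differentiable[OF _ loc_c(7)] X(1) v ks smooth_on_minus[OF loc_c(6) ks] by auto
  \<comment> \<open>In the derivative of the inner product the term with the acceleration of the
    curve drops out by the geodesic equation.\<close>
  have "pd 1 k t = 1 / r\<^sup>2 * Gc c (x t) (covc c x 1 \<xi> t) (pd 1 x t)"
    unfolding k_def[abs_def]
    using frechet_eqI[OF has_derivative_mult_right[OF C.compat_along[OF al loc_c(7) d(1,2)], of "1 / r\<^sup>2"]] loc_geodesic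
    by (simp add: C.G_simps loc_c(4,7))
  moreover have "pd 1 (\<lambda>s. - k s) t = - pd 1 k t"
    using frechet_eqI[OF has_derivative_minus[OF frechet_works[OF d(3)]]] by simp
  moreover have "covc c x 1 P t = covc c x 1 \<xi> t + (pd 1 (\<lambda>s. - k s) t *\<^sub>R pd 1 x t + (- k t) *\<^sub>R covc c x 1 (pd 1 x) t)"
  proof -
    have "(\<lambda>s. (- k s) *\<^sub>R pd 1 x s) differentiable (at t)"
      by (intro smooth_on_differentiable[OF smooth_on_scaleR[OF loc_c(6) smooth_on_minus[OF loc_c(6) ks] v] loc_c(7)])
    from C.cov_add[OF al loc_c(7) d(1) this] C.cov_scaleR[OF al loc_c(7) d(4,2)]
    show ?thesis unfolding P_def[abs_def] by (simp only:)
  qed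
  ultimately have "covc c x 1 P t = nor_c (covc c x 1 \<xi> t)"
    by (simp add: nor_c_def loc_geodesic)
  then show "D\<^sub>t (nor X) t = coord_vec A c (nor_c (covc c x 1 \<xi> t)) (\<gamma> t)"
    using loc_cov_deriv[of P "nor X", OF Ps P] by simp
qed

lemma integrand_rep:
  assumes X: "field_rep t W X \<xi>" and Y: "field_rep t W Y \<eta>"
  defines "P \<equiv> nor_c (\<xi> t)" and "DP \<equiv> nor_c (covc c x 1 \<xi> t)"
    and "Q \<equiv> nor_c (\<eta> t)" and "DQ \<equiv> nor_c (covc c x 1 \<eta> t)" and "v \<equiv> pd 1 x t"
  shows "integrand X Y t = Gc c (x t) DP DQ - Gc c (x t) (tw_chart.Rc (Chr c) (x t) P v v) Q
    - 2 * (- curl (thc c) (x t) P v / 2) * thc c (x t) DQ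
    - 2 * (thc c (x t) DP - 2 * (- curl (thc c) (x t) P v / 2)) * (- curl (thc c) (x t) Q v / 2)"
proof -
  note t = loc_c(5)[OF loc_c(7)] and c = loc_c(1) loc_c(2)[OF loc_c(7)]
  note vt = vel_tangent[OF t]
  have Xt: "X t \<in> TM (\<gamma> t)" "Y t \<in> TM (\<gamma> t)" using X Y loc_c(7) by (auto simp: field_rep_def)
  note nt = nor_tangent[of t X, OF t Xt(1)] nor_tangent[of t Y, OF t Xt(2)]
  have nc: "nor X t c = P" "nor Y t c = Q" using nor_rep(1)[OF X] nor_rep(1)[OF Y] by (simp_all add: P_def Q_def)
  have vc: "vel t c = v" using loc_vel[OF loc_c(7)] by (simp add: v_def)
  have D: "D\<^sub>t (nor X) t = coord_vec A c DP (\<gamma> t)" "D\<^sub>t (nor Y) t = coord_vec A c DQ (\<gamma> t)"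
    using nor_rep(2)[OF X] nor_rep(2)[OF Y] by (simp_all add: DP_def DQ_def)
  note ct = coord_vec_tangent[OF c]
  note xs = loc_c(3)[OF loc_c(7)]
  have R: "curvature A nabla (\<gamma> t) (nor X t) (vel t) (vel t) \<in> TM (\<gamma> t)"
    "curvature A nabla (\<gamma> t) (nor X t) (vel t) (vel t) c = tw_chart.Rc (Chr c) (x t) P v v"
    using curvature_chart[OF nt(1) vt vt] nc vc xs
    by (simp_all add: tw_chart.Rc_def[OF tw_chart[OF c(1)]] flip: c_def)
  show ?thesis
    unfolding integrand_def D
    using Gc_chart[OF c ct ct, of DP DQ] Gc_chart[OF c R(1) nt(2)] R(2) nc vc xs
      Omega_chart[OF c nt(1) vt] Omega_chart[OF c nt(2) vt] theta_chart[OF c ct, of DP] theta_chart[OF c ct, of DQ]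
    by (simp add: coord_vec_self[OF c])
qed

end

text \<open>The integrand is bilinear, and its two mixed terms in \<Omega> and \<theta> are
  exchanged when \<open>X\<close> and \<open>Y\<close> are. Its symmetry thus rests on the curvature
  term, which is \<open>Rc_pair_symmetric\<close>.\<close>

lemma integrand_polar:
  assumes loc: "loc_rep t W x" and X: "field_rep t W X \<xi>" and Y: "field_rep t W Y \<eta>"
  shows "integrand (\<lambda>t. X t + Y t) (\<lambda>t. X t + Y t) t - integrand X X t - integrand Y Y t = 2 * integrand X Y t"
proof -
  define c where "c = chart_at A (\<gamma> t)"
  note lc = loc_c[OF loc, folded c_def]
  interpret C: tw_chart "snd c ` fst c" "Gc c" "Chr c" "thc c" "Tc c" by (rule tw_chart[OF lc(1)])
  have XY: "field_rep t W (\<lambda>t. X t + Y t) (\<lambda>s. \<xi> s + \<eta> s)"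
    using X Y lc(6) by (auto simp: field_rep_def intro: smooth_on_add tangent_add)
  have xt: "x t \<in> snd c ` fst c" using lc(4,7) by blast
  have d: "\<xi> differentiable (at t)" "\<eta> differentiable (at t)"
    using X Y lc(7) smooth_on_differentiable by (auto simp: field_rep_def)
  have xW: "x ` W \<subseteq> snd c ` fst c" using lc(4) by blast
  let ?n = "nor_c t x" and ?v = "pd 1 x t"
  have na: "?n (u + w) = ?n u + ?n w" for u w
    unfolding nor_c_def[OF loc] c_def[symmetric] by (simp add: C.G_simps xt algebra_simps)
  have cov: "covc c x 1 (\<lambda>s. \<xi> s + \<eta> s) t = covc c x 1 \<xi> t + covc c x 1 \<eta> t"
    by (rule C.cov_add[OF lc(6,8) xW lc(7) d])
  note i = integrand_rep[OF loc, folded c_def]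
  note cb = C.curl_bil[OF xt]
  show ?thesis
    unfolding i[OF XY XY] i[OF X X] i[OF Y Y] i[OF X Y] cov na
    using C.Rc_pair_symmetric[OF xt, of "?n (\<eta> t)" ?v "?n (\<xi> t)"]
      C.G_sym[OF xt, of "?n (covc c x 1 \<eta> t)" "?n (covc c x 1 \<xi> t)"]
    by (simp add: C.G_simps xt linear_add[OF C.Rc_linear(1)] linear_add[OF C.th_lin] bilinear_ladd[OF cb] field_simps)
qed

text \<open>The components in \<open>c\<close> of the covariant acceleration, at
  \<open>s = 0\<close>, of the transverse curve \<open>\<lambda>s. V s t\<close>.\<close>

definition acc :: "(real \<Rightarrow> real \<Rightarrow> 'p) \<Rightarrow> (real \<Rightarrow> ('p, 'm) tvec) \<Rightarrow> ('p, 'm) chart \<Rightarrow> real \<Rightarrow> real^'m"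
  where "acc V X c t = pd 1 (pd 1 (\<lambda>s. snd c (V s t))) 0 + Chr c (snd c (\<gamma> t)) (X t c) (X t c)"

text \<open>The boundary term \<open>g(\<nabla>\<^sub>s \<partial>\<^sub>s V, \<gamma>')\<close> of the second variation formula.\<close>

definition bterm :: "(real \<Rightarrow> real \<Rightarrow> 'p) \<Rightarrow> (real \<Rightarrow> ('p, 'm) tvec) \<Rightarrow> real \<Rightarrow> real"
  where "bterm V X t = (let c = chart_at A (\<gamma> t) in Gc c (snd c (\<gamma> t)) (acc V X c t) (vel t c))"

context
  fixes X :: "real \<Rightarrow> ('p, 'm) tvec" and \<epsilon> :: real and V :: "real \<Rightarrow> real \<Rightarrow> 'p" and p q :: real
  assumes eps: "\<epsilon> > 0" and V0: "\<And>t. t \<in> {a..b} \<Longrightarrow> V 0 t = \<gamma> t"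
    and VX: "\<And>t. t \<in> {a..b} \<Longrightarrow> curve_velocity A {-\<epsilon><..<\<epsilon>} (\<lambda>s. V s t) 0 = X t"
    and pq: "a \<le> p" "p < q" "q \<le> b"
    and V_smooth: "smooth_map A ({p..q} \<times> {-\<epsilon><..<\<epsilon>}) (\<lambda>(t, s). V s t)"
begin

text \<open>The coordinate form \<open>h\<close> of the variation. Its open domain \<open>D\<close>
  may reach beyond \<open>{p..q}\<close>, where \<open>h\<close> is merely a smooth extension; this
  makes ordinary derivatives available at the end points of the piece.\<close>

definition rep :: "('p, 'm) chart \<Rightarrow> (real \<times> real) set \<Rightarrow> (real \<times> real \<Rightarrow> real^'m) \<Rightarrow> bool"
  where "rep c D h \<longleftrightarrow> c \<in> A \<and> open D \<and> smooth_on D h \<and> h ` D \<subseteq> snd c ` fst c \<and>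
    (\<forall>t s. (t, s) \<in> D \<and> t \<in> {p..q} \<and> s \<in> {-\<epsilon><..<\<epsilon>} \<longrightarrow> V s t \<in> fst c \<and> h (t, s) = snd c (V s t))"

section \<open>A smooth piece of a variation in a chart\<close>

lemma pq_ab: "t \<in> {p..q} \<Longrightarrow> t \<in> {a..b}" "t \<in> {p<..<q} \<Longrightarrow> t \<in> {a<..<b}" "t \<in> {p<..<q} \<Longrightarrow> t \<in> {p..q}"
  using pq by auto

lemma eps0: "0 \<in> {-\<epsilon><..<\<epsilon>}" using eps by simp

lemma rep_exists:
  assumes t: "t \<in> {p..q}" and c: "c \<in> A" "\<gamma> t \<in> fst c"
  shows "\<exists>D h. rep c D h \<and> (t, 0) \<in> D"
proof -
  let ?S = "{p..q} \<times> {-\<epsilon><..<\<epsilon>}"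
  have z: "(t, 0) \<in> ?S" using t eps by simp
  have "(\<lambda>(t, s). V s t) (t, 0) \<in> fst c" using V0[OF pq_ab(1)[OF t]] c by simp
  from V_smooth[unfolded smooth_map_def, THEN bspec, OF z, THEN bspec, OF c(1), THEN mp, OF this]
  obtain W h where W: "open W" "(t, 0) \<in> W" "(\<lambda>(t, s). V s t) ` (W \<inter> ?S) \<subseteq> fst c" "smooth_on W h"
    "\<forall>w\<in>W \<inter> ?S. h w = snd c ((\<lambda>(t, s). V s t) w)" by blast
  \<comment> \<open>Off the piece \<open>h\<close> is an arbitrary extension; the restriction keeps
    its values in the image of the chart.\<close>
  let ?D = "W \<inter> h -` (snd c ` fst c)"
  have oD: "open ?D"
    by (rule continuous_open_preimage[OF smooth_on_continuous_on[OF W(4)] W(1) open_chart(2)[OF c(1)]])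
  have "h (t, 0) = snd c (V 0 t)" using W(5)[THEN bspec, of "(t, 0)"] W(2) z by simp
  then have "(t, 0) \<in> ?D" using W(2) V0[OF pq_ab(1)[OF t]] c by auto
  moreover have "rep c ?D h"
    unfolding rep_def
  proof (intro conjI allI impI)
    fix t' s assume *: "(t', s) \<in> ?D \<and> t' \<in> {p..q} \<and> s \<in> {-\<epsilon><..<\<epsilon>}"
    then have m: "(t', s) \<in> W \<inter> ?S" by blast
    show "V s t' \<in> fst c" using imageI[OF m, of "\<lambda>(t, s). V s t"] W(3) by (simp add: subset_iff)
    show "h (t', s) = snd c (V s t')" using W(5)[THEN bspec, OF m] by simp
  qed (use c oD smooth_on_subset[OF W(4)] in auto)
  ultimately show ?thesis by blast
qed

context
  fixes c D h
  assumes rep: "rep c D h"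
begin

lemma repD: "c \<in> A" "open D" "smooth_on D h" "h ` D \<subseteq> snd c ` fst c"
  "(t, s) \<in> D \<Longrightarrow> t \<in> {p..q} \<Longrightarrow> s \<in> {-\<epsilon><..<\<epsilon>} \<Longrightarrow> V s t \<in> fst c \<and> h (t, s) = snd c (V s t)"
  using rep unfolding rep_def by blast+

lemma rep_gamma:
  assumes "(t, 0) \<in> D" "t \<in> {p..q}" shows "\<gamma> t \<in> fst c" "snd c (\<gamma> t) = h (t, 0)"
  using repD(5)[OF assms eps0] V0[OF pq_ab(1)[OF assms(2)]] by auto

lemma line_nbhd:
  assumes "(t, s) \<in> D"
  shows "\<exists>d>0. \<forall>t' s'. dist t' t < d \<longrightarrow> dist s' s < d \<longrightarrow> (t', s') \<in> D"
proof -
  obtain T S where TS: "open T" "open S" "(t, s) \<in> T \<times> S" "T \<times> S \<subseteq> D"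
    using open_prod_elim[OF repD(2) assms] by blast
  obtain d1 where d1: "d1 > 0" "ball t d1 \<subseteq> T" using TS open_contains_ball by blast
  obtain d2 where d2: "d2 > 0" "ball s d2 \<subseteq> S" using TS open_contains_ball by blast
  show ?thesis
    by (intro exI[of _ "min d1 d2"]) (use d1 d2 TS(4) in \<open>auto simp: subset_iff dist_commute\<close>)
qed

text \<open>Derivatives are compared within \<open>{p..q}\<close>, where \<open>h\<close> and
  \<gamma> agree. This covers the end points of the piece, at which only one side is
  controlled.\<close>

lemma rep_vel:
  assumes z: "(t, 0) \<in> D" and t: "t \<in> {p..q}" shows "vel t c = pd (1, 0) h (t, 0)"
proof -
  note g = rep_gamma[OF z t]
  have "((\<lambda>s. snd c (\<gamma> s)) has_vector_derivative vel t c) (at t within {p..q})"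
    by (rule has_vector_derivative_within_subset[OF gamma_velocity[OF pq_ab(1)[OF t] repD(1) g(1)]])
      (use pq in auto)
  moreover obtain d where d: "d > 0" "\<And>t' s'. dist t' t < d \<Longrightarrow> dist s' 0 < d \<Longrightarrow> (t', s') \<in> D"
    using line_nbhd[OF z] by blast
  have "((\<lambda>s. h (s, 0)) has_vector_derivative pd (1, 0) h (t, 0)) (at t within {p..q})"
    by (rule smooth_on_partial[OF repD(3) z])
  then have "((\<lambda>s. snd c (\<gamma> s)) has_vector_derivative pd (1, 0) h (t, 0)) (at t within {p..q})"
  proof (rule has_vector_derivative_transform_within[OF _ d(1) t])
    show "h (t', 0) = snd c (\<gamma> t')" if "t' \<in> {p..q}" "dist t' t < d" for t'
      using rep_gamma(2)[of t'] d(2)[of t' 0] d(1) that by simp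
  qed
  ultimately show ?thesis
    by (rule vector_derivative_unique_within[OF nontrivial[OF pq(2) t]])
qed

lemma rep_X:
  assumes z: "(t, 0) \<in> D" and t: "t \<in> {p..q}"
  shows "X t c = pd (0, 1) h (t, 0)" "X t \<in> TM (\<gamma> t)"
proof -
  note g = rep_gamma[OF z t]
  obtain d where d: "d > 0" "\<And>t' s'. dist t' t < d \<Longrightarrow> dist s' 0 < d \<Longrightarrow> (t', s') \<in> D"
    using line_nbhd[OF z] by blast
  have "curve_velocity A {-\<epsilon><..<\<epsilon>} (\<lambda>s. V s t) 0 = coord_vec A c (pd (0, 1) h (t, 0)) (V 0 t)"
  proof (rule curve_velocity_eq[OF repD(1) _ _ eps0 _ d(1)])
    show "((\<lambda>s. h (t, s)) has_vector_derivative pd (0, 1) h (t, 0)) (at 0 within {-\<epsilon><..<\<epsilon>})"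
      by (rule smooth_on_partial[OF repD(3) z])
    show "V 0 t \<in> fst c" using g V0[OF pq_ab(1)[OF t]] by simp
    show "at 0 within {-\<epsilon><..<\<epsilon>} \<noteq> bot" by (simp add: at_within_open[OF eps0])
    show "V s t \<in> fst c \<and> h (t, s) = snd c (V s t)" if "s \<in> {-\<epsilon><..<\<epsilon>}" "dist s 0 < d" for s
      using repD(5)[OF d(2)[of t s] t that(1)] d(1) that(2) by simp
  qed
  then have "X t = coord_vec A c (pd (0, 1) h (t, 0)) (\<gamma> t)"
    using VX V0 pq_ab(1)[OF t] by simp
  then show "X t c = pd (0, 1) h (t, 0)" "X t \<in> TM (\<gamma> t)"
    using coord_vec_self[OF repD(1) g(1)] coord_vec_tangent[OF repD(1) g(1)] by auto
qed

text \<open>Interior times only: the velocity is a derivative within \<open>{a..b}\<close>, and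
  \<open>V s\<close> may have a corner at an end of the piece.\<close>

lemma rep_curve_velocity:
  assumes z: "(t, s) \<in> D" and t: "t \<in> {p<..<q}" and s: "s \<in> {-\<epsilon><..<\<epsilon>}"
  shows "curve_velocity A {a..b} (V s) t = coord_vec A c (pd (1, 0) h (t, s)) (V s t)"
proof -
  obtain d where d: "d > 0" "\<And>t' s'. dist t' t < d \<Longrightarrow> dist s' s < d \<Longrightarrow> (t', s') \<in> D"
    using line_nbhd[OF z] by blast
  define d' where "d' = min (t - p) (q - t)"
  have d': "d' > 0" "ball t d' \<subseteq> {p<..<q}" using t by (auto simp: d'_def dist_real_def)
  have tab: "t \<in> {a..b}" using pq_ab t by blast
  show ?thesis
  proof (rule curve_velocity_eq[OF repD(1) _ _ tab nontrivial[OF ab tab], where k="\<lambda>t. h (t, s)" and d="min d d'"])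
    show "((\<lambda>t. h (t, s)) has_vector_derivative pd (1, 0) h (t, s)) (at t within {a..b})"
      by (rule smooth_on_partial[OF repD(3) z])
    show "V s t \<in> fst c" using repD(5)[OF z pq_ab(3)[OF t] s] by blast
    show "0 < min d d'" using d d' by simp
    fix t' assume t': "t' \<in> {a..b}" "dist t' t < min d d'"
    have "(t', s) \<in> D" using d(2)[of t' s] d(1) t'(2) by simp
    moreover have "t' \<in> ball t d'" using t'(2) by (simp add: dist_commute)
    then have "t' \<in> {p..q}" using d'(2) by auto
    ultimately show "V s t' \<in> fst c \<and> h (t', s) = snd c (V s t')" using repD(5) s by blast
  qed
qed

definition Fh :: "real \<times> real \<Rightarrow> real"
  where "Fh z = Gc c (h z) (pd (1, 0) h z) (pd (1, 0) h z)"

definition bh :: "real \<times> real \<Rightarrow> real"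
  where "bh z = Gc c (h z) (covc c h (0, 1) (pd (0, 1) h) z) (pd (1, 0) h z)"

lemma rep_smooth: "smooth_on D Fh" "smooth_on D bh"
proof -
  interpret C: tw_chart "snd c ` fst c" "Gc c" "Chr c" "thc c" "Tc c" by (rule tw_chart[OF repD(1)])
  show "smooth_on D Fh" "smooth_on D bh"
    unfolding Fh_def[abs_def] bh_def[abs_def]
    by (intro C.smooth_G[OF repD(2-4)] C.smooth_cov[OF repD(2-4)] smooth_on_frechet repD(3))+
qed

lemma Fh_eq:
  assumes z: "(t, s) \<in> D" and t: "t \<in> {p<..<q}" and s: "s \<in> {-\<epsilon><..<\<epsilon>}"
  shows "gW (V s t) (curve_velocity A {a..b} (V s) t) (curve_velocity A {a..b} (V s) t) = Fh (t, s)"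
proof -
  have V: "V s t \<in> fst c" "h (t, s) = snd c (V s t)" using repD(5)[OF z pq_ab(3)[OF t] s] by auto
  note ct = coord_vec_tangent[OF repD(1) V(1)]
  show ?thesis
    unfolding rep_curve_velocity[OF z t s] Fh_def
    using Gc_chart[OF repD(1) V(1) ct ct] V(2) by (simp add: coord_vec_self repD(1) V(1))
qed

lemma Fh_0:
  assumes z: "(t, 0) \<in> D" and t: "t \<in> {p..q}" shows "Fh (t, 0) = r\<^sup>2"
proof -
  note g = rep_gamma[OF z t] and vt = vel_tangent[OF pq_ab(1)[OF t]]
  show ?thesis
    using Gc_chart[OF repD(1) g(1) vt vt] speed[OF pq_ab(1)[OF t]] g(2) rep_vel[OF z t]
    by (simp add: Fh_def)
qed

lemma rep_acc:
  assumes z: "(t, 0) \<in> D" and t: "t \<in> {p..q}"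
  shows "acc V X c t = covc c h (0, 1) (pd (0, 1) h) (t, 0)"
proof -
  let ?I = "{s. (t, s) \<in> D} \<inter> {-\<epsilon><..<\<epsilon>}"
  have I: "open ?I" "0 \<in> ?I" using smooth_on_line(3)[OF repD(3,2)] z eps by auto
  have "pd 1 (pd 1 (\<lambda>s. snd c (V s t))) 0 = pd 1 (pd 1 (\<lambda>s. h (t, s))) 0"
    by (rule pd_pd_cong[OF I]) (use repD(5) t in auto)
  also have "\<dots> = pd 1 (\<lambda>s. pd (0, 1) h (t, s)) 0"
    by (rule arg_cong[where f="\<lambda>f. f 1"], rule frechet_cong_open[OF I]) (use pd_line(2)[OF repD(3)] in auto)
  also have "\<dots> = pd (0, 1) (pd (0, 1) h) (t, 0)"
    by (rule pd_line(2)[OF smooth_on_frechet[OF repD(3)] z])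
  finally show ?thesis
    using rep_gamma[OF z t] rep_X(1)[OF z t] by (simp add: acc_def covc_def[OF repD(1)])
qed

end

text \<open>Makes the boundary term independent of the chart. Although \<open>bterm\<close> is
  defined through charts that change with \<open>t\<close>, it can then be differentiated in any
  fixed one.\<close>

lemma acc_transition:
  assumes t: "t \<in> {p..q}" and c: "c \<in> A" "\<gamma> t \<in> fst c" and c': "c' \<in> A" "\<gamma> t \<in> fst c'"
  shows "acc V X c' t = J c c' (snd c (\<gamma> t)) (acc V X c t)"
proof -
  obtain D h where D: "rep c D h" "(t, 0) \<in> D" using rep_exists[OF t c] by blast
  obtain D' h' where D': "rep c' D' h'" "(t, 0) \<in> D'" using rep_exists[OF t c'] by blast
  define k where "k s = h (t, s)" for s
  let ?E = "snd c ` (fst c' \<inter> fst c)"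
  let ?I0 = "{s. (t, s) \<in> D}"
  have I0: "open ?I0" "smooth_on ?I0 k" unfolding k_def by (rule smooth_on_line[OF repD(3,2)[OF D(1)]])+
  have oE: "open ?E" by (rule open_chart_image[OF c(1) open_chart(1)[OF c'(1)]])
  let ?I = "(?I0 \<inter> k -` ?E) \<inter> {-\<epsilon><..<\<epsilon>}"
  have k0: "k 0 = snd c (\<gamma> t)" using rep_gamma[OF D(1,2) t] by (simp add: k_def)
  have I: "open ?I"
    by (intro open_Int continuous_open_preimage[OF smooth_on_continuous_on[OF I0(2)] I0(1) oE] open_greaterThanLessThan)
  have I': "0 \<in> ?I" using D(2) k0 c c' eps by auto
  have V: "V s t \<in> fst c \<and> k s = snd c (V s t)" if "s \<in> ?I" for s
    using repD(5)[OF D(1), of t s] that t by (auto simp: k_def)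
  have e: "pd 1 (pd 1 (\<lambda>s. snd c (V s t))) 0 = pd 1 (pd 1 k) 0"
    "pd 1 (pd 1 (\<lambda>s. snd c' (V s t))) 0 = pd 1 (pd 1 (\<lambda>s. transition c c' (k s))) 0"
  proof -
    show "pd 1 (pd 1 (\<lambda>s. snd c (V s t))) 0 = pd 1 (pd 1 k) 0"
      by (rule pd_pd_cong[OF I I']) (metis V)
    show "pd 1 (pd 1 (\<lambda>s. snd c' (V s t))) 0 = pd 1 (pd 1 (\<lambda>s. transition c c' (k s))) 0"
      by (rule pd_pd_cong[OF I I']) (metis V transition_snd[OF c(1)])
  qed
  have x: "X t c = pd 1 k 0"
    using rep_X(1)[OF D(1,2) t] pd_line(2)[OF repD(3)[OF D(1)] D(2)] by (simp add: k_def[abs_def])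
  have x': "X t c' = pd 1 (\<lambda>s. transition c c' (k s)) 0"
  proof -
    have "pd 1 (\<lambda>s. transition c c' (k s)) 0 = J c c' (k 0) (pd 1 k 0)"
    proof -
      have "(k has_derivative (\<lambda>e. pd e k 0)) (at 0)" by (rule smooth_on_has_derivative[OF I0(2)]) (use D(2) in simp)
      moreover have "(transition c c' has_derivative J c c' (k 0)) (at (k 0))"
        unfolding k0 by (rule transition_has_derivative[OF c(1) c'(1) c(2) c'(2)])
      ultimately have "((\<lambda>s. transition c c' (k s)) has_derivative (\<lambda>e. J c c' (k 0) (pd e k 0))) (at 0)"
        by (rule has_derivative_compose)
      then show ?thesis by (simp only: frechet_eqI)
    qed
    also have "\<dots> = X t c'"
      using tangentD[OF rep_X(2)[OF D(1,2) t] c(1) c'(1) c(2) c'(2)] by (simp add: x k0)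
    finally show ?thesis ..
  qed
  have kI: "smooth_on ?I k" by (rule smooth_on_subset[OF I0(2)]) blast
  have "snd c' (\<gamma> t) = transition c c' (k 0)" using transition_snd[OF c] by (simp add: k0)
  then show ?thesis
    using acceleration_transition[OF c(1) c'(1) I I' kI]
    by (simp add: acc_def e x x' k0 image_subset_iff)
qed

lemma bterm_chart:
  assumes t: "t \<in> {p..q}" and c: "c \<in> A" "\<gamma> t \<in> fst c"
  shows "bterm V X t = Gc c (snd c (\<gamma> t)) (acc V X c t) (vel t c)"
proof -
  let ?c = "chart_at A (\<gamma> t)"
  note c0 = chart_at[of "\<gamma> t"]
  show ?thesis
    unfolding bterm_def Let_def acc_transition[OF t c c0] tangentD[OF vel_tangent[OF pq_ab(1)[OF t]] c(1) c0(1) c(2) c0(2)]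
    by (rule Gc_transition[OF c(1) c0(1) c(2) c0(2)])
qed

lemma bterm_rep:
  assumes rep: "rep c D h" and z: "(t, 0) \<in> D" and t: "t \<in> {p..q}" shows "bterm V X t = bh c h (t, 0)"
  using bterm_chart[OF t repD(1)[OF rep] rep_gamma(1)[OF rep z t]] rep_gamma(2)[OF rep z t]
    rep_acc[OF rep z t] rep_vel[OF rep z t]
  by (simp add: bh_def[OF rep])

lemma bterm_deriv:
  assumes rep: "rep c D h" and z: "(t, 0) \<in> D" and t: "t \<in> {p<..<q}"
  shows "(bterm V X has_real_derivative pd (1, 0) (bh c h) (t, 0)) (at t)"
proof -
  let ?I = "{t. (t, 0) \<in> D} \<inter> {p<..<q}"
  have I: "open ?I" "t \<in> ?I" using smooth_on_line(1)[OF repD(3,2)[OF rep]] z t by auto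
  have "((\<lambda>t. bh c h (t, 0)) has_vector_derivative pd (1, 0) (bh c h) (t, 0)) (at t)"
    by (rule smooth_on_along_line(1)[OF smooth_on_has_derivative[OF rep_smooth(2)[OF rep] z]])
  then have "(bterm V X has_vector_derivative pd (1, 0) (bh c h) (t, 0)) (at t)"
    by (rule has_vector_derivative_transform_within_open[OF _ I]) (use bterm_rep[OF rep] in auto)
  then show ?thesis by (simp add: has_real_derivative_iff_has_vector_derivative)
qed

text \<open>The chart is the one in which curvature and covariant derivatives at
  \<open>\<gamma> t\<close> are defined. For H = sqrt F the identity F'' = 2 H'^2 + 2 H H'' converts
  derivatives of the squared speed into those of the speed; the term H'^2 is the square removed in
  \<open>index_integrand_algebra\<close>.\<close>

lemma second_variation_chart_at:
  fixes t
  defines "c \<equiv> chart_at A (\<gamma> t)"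
  assumes rep: "rep c D h" and z: "(t, 0) \<in> D" and t: "t \<in> {p<..<q}"
  shows "pd (0, 1) (pd (0, 1) (\<lambda>z. sqrt (Fh c h z))) (t, 0) = 1 / r * (pd (1, 0) (bh c h) (t, 0) + integrand X X t)"
proof -
  note rD = repD[OF rep]
  interpret C: tw_chart "snd c ` fst c" "Gc c" "Chr c" "thc c" "Tc c" by (rule tw_chart[OF rD(1)])
  note tc = pq_ab(3)[OF t]
  let ?z = "(t, 0::real)"
  let ?ht = "pd (1, 0) h" and ?hs = "pd (0, 1) h"
  define W where "W = {s. (s, 0) \<in> D} \<inter> {p<..<q}"
  define x where "x s = h (s, 0)" for s
  define \<xi> where "\<xi> s = ?hs (s, 0)" for s
  note l = smooth_on_line[OF rD(3,2)]
  have W: "open W" "t \<in> W" "W \<subseteq> {a<..<b}" "W \<subseteq> {s. (s, 0) \<in> D}"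
    using l(1) z t pq by (auto simp: W_def)
  have Wpq: "s \<in> {p..q}" "(s, 0) \<in> D" if "s \<in> W" for s using that by (auto simp: W_def)
  have xs: "smooth_on W x" "smooth_on W \<xi>"
    using smooth_on_subset[OF l(2) W(4)] smooth_on_subset[OF smooth_on_line(2)[OF smooth_on_frechet[OF rD(3)] rD(2)] W(4)]
    by (simp_all add: x_def[abs_def] \<xi>_def[abs_def])
  have loc: "loc_rep t W x"
    unfolding loc_rep_def c_def[symmetric] using W xs rep_gamma[OF rep Wpq(2,1)] by (auto simp: x_def)
  have fr: "field_rep t W X \<xi>"
    unfolding field_rep_def c_def[symmetric] using xs rep_X[OF rep Wpq(2,1)] by (auto simp: \<xi>_def)
  have v: "pd 1 x s = ?ht (s, 0)" if "s \<in> W" for s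
    unfolding x_def[abs_def] by (rule pd_line(1)[OF rD(3) Wpq(2)[OF that]])
  have cov1: "covc c x 1 \<xi> t = covc c h (1, 0) ?hs ?z"
    unfolding covc_def[OF rD(1)] v[OF W(2)] unfolding \<xi>_def[abs_def] pd_line(1)[OF smooth_on_frechet[OF rD(3)] z] x_def ..
  have "pd 1 (pd 1 x) t = pd 1 (\<lambda>s. ?ht (s, 0)) t"
    by (rule arg_cong[where f="\<lambda>f. f 1"], rule frechet_cong_open[OF W(1,2) v])
  then have cov2: "covc c x 1 (pd 1 x) t = covc c h (1, 0) ?ht ?z"
    unfolding covc_def[OF rD(1)] v[OF W(2)] unfolding pd_line(1)[OF smooth_on_frechet[OF rD(3)] z] x_def by simp
  have xt: "x t = h ?z" "\<xi> t = ?hs ?z" by (simp_all add: x_def \<xi>_def)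
  have hU: "h ?z \<in> snd c ` fst c" using rD(4) z by blast
  have hor: "thc c (h ?z) (?ht ?z) = 0" and len: "Gc c (h ?z) (?ht ?z) (?ht ?z) = r\<^sup>2"
    using loc_facts[OF loc] by (simp_all add: v[OF W(2)] xt flip: c_def)
  have geo: "covc c h (1, 0) ?ht ?z = 0" using loc_geodesic[OF loc] cov2 by (simp flip: c_def)
  have FF: "(\<lambda>z. Gc c (h z) (?ht z) (?ht z)) = Fh c h"
    "(\<lambda>z. Gc c (h z) (covc c h (0, 1) ?hs z) (?ht z)) = bh c h"
    by (auto simp: Fh_def[OF rep] bh_def[OF rep])
  let ?F = "Fh c h" and ?Dv = "covc c h (1, 0) ?hs ?z"
  have F1: "pd (0, 1) ?F ?z = 2 * Gc c (h ?z) ?Dv (?ht ?z)"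
    using C.second_variation_point(1)[OF rD(2,3,4) z hor geo] unfolding FF .
  have F2: "pd (0, 1) (pd (0, 1) ?F) ?z = 2 * (pd (1, 0) (bh c h) ?z +
      Gc c (h ?z) (C.Rc (h ?z) (?hs ?z) (?ht ?z) (?hs ?z)) (?ht ?z) +
      Gc c (h ?z) (?Dv + curl (thc c) (h ?z) (?hs ?z) (?ht ?z) *\<^sub>R Tc c (h ?z))
        (?Dv + curl (thc c) (h ?z) (?hs ?z) (?ht ?z) *\<^sub>R Tc c (h ?z)))"
    using C.second_variation_point(2)[OF rD(2,3,4) z hor geo] unfolding FF .
  have Q: "integrand X X t = Gc c (h ?z) (C.Rc (h ?z) (?hs ?z) (?ht ?z) (?hs ?z)) (?ht ?z) +
      Gc c (h ?z) (?Dv + curl (thc c) (h ?z) (?hs ?z) (?ht ?z) *\<^sub>R Tc c (h ?z))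
        (?Dv + curl (thc c) (h ?z) (?hs ?z) (?ht ?z) *\<^sub>R Tc c (h ?z)) -
      (Gc c (h ?z) ?Dv (?ht ?z))\<^sup>2 / r\<^sup>2"
    unfolding C.index_integrand_algebra[OF hU hor r_pos len] integrand_rep[OF loc fr fr, folded c_def]
      nor_c_def[OF loc, folded c_def] cov1 v[OF W(2)] xt ..
  let ?H = "\<lambda>z. sqrt (?F z)"
  let ?D = "D \<inter> ?F -` {0<..}"
  note Fs = rep_smooth(1)[OF rep]
  have oD: "open ?D"
    by (rule continuous_open_preimage[OF smooth_on_continuous_on[OF Fs] rD(2) open_greaterThan])
  have zD: "?z \<in> ?D" using z Fh_0[OF rep z tc] r_pos by simp
  have Hs: "smooth_on ?D ?H" by (rule smooth_on_sqrt[OF oD _ smooth_on_subset[OF Fs]]) auto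
  have H1: "pd (0, 1) ?F y = 2 * ?H y * pd (0, 1) ?H y" if y: "y \<in> ?D" for y
  proof -
    have "((\<lambda>y. ?H y * ?H y) has_derivative (\<lambda>e. ?H y * pd e ?H y + pd e ?H y * ?H y)) (at y)"
      by (intro has_derivative_mult smooth_on_has_derivative[OF Hs y])
    then have "(?F has_derivative (\<lambda>e. ?H y * pd e ?H y + pd e ?H y * ?H y)) (at y)"
      by (rule has_derivative_transform_within_open[OF _ oD y]) auto
    then show ?thesis by (simp add: frechet_eqI)
  qed
  have H2: "pd (0, 1) (pd (0, 1) ?F) ?z = 2 * (pd (0, 1) ?H ?z)\<^sup>2 + 2 * ?H ?z * pd (0, 1) (pd (0, 1) ?H) ?z"
  proof -
    have "((\<lambda>y. (2 * ?H y) * pd (0, 1) ?H y) has_derivative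
        (\<lambda>e. 2 * ?H ?z * pd e (pd (0, 1) ?H) ?z + (2 * pd e ?H ?z) * pd (0, 1) ?H ?z)) (at ?z)"
      by (intro has_derivative_mult has_derivative_mult_right smooth_on_has_derivative[OF Hs zD]
          smooth_on_has_derivative[OF smooth_on_frechet[OF Hs] zD])
    then have "(pd (0, 1) ?F has_derivative
        (\<lambda>e. 2 * ?H ?z * pd e (pd (0, 1) ?H) ?z + (2 * pd e ?H ?z) * pd (0, 1) ?H ?z)) (at ?z)"
      by (rule has_derivative_transform_within_open[OF _ oD zD]) (simp add: H1)
    then show ?thesis by (simp add: frechet_eqI power2_eq_square)
  qed
  have Hr: "?H ?z = r" using Fh_0[OF rep z tc] r_pos by simp
  have "pd (0, 1) ?H ?z = Gc c (h ?z) ?Dv (?ht ?z) / r"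
    using H1[OF zD] F1 r_pos by (simp add: Hr field_simps)
  then have "r * pd (0, 1) (pd (0, 1) ?H) ?z = pd (1, 0) (bh c h) ?z + integrand X X t"
    using H2 F2 r_pos unfolding Q Hr by (simp add: power_divide)
  then show ?thesis using r_pos by (simp add: field_simps)
qed

text \<open>Neither side depends on the chart: near \<open>(t, 0)\<close> the root is the speed of
  the curves, and the derivative of \<open>bh\<close> is that of \<open>bterm\<close>. The formula
  thus holds in one chart for all interior \<open>t\<close> that the chart covers.\<close>

lemma second_variation_rep:
  assumes rep: "rep c D h" and z: "(t, 0) \<in> D" and t: "t \<in> {p<..<q}"
  shows "pd (0, 1) (pd (0, 1) (\<lambda>z. sqrt (Fh c h z))) (t, 0) = 1 / r * (pd (1, 0) (bh c h) (t, 0) + integrand X X t)"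
proof -
  let ?c = "chart_at A (\<gamma> t)"
  obtain D0 h0 where r0: "rep ?c D0 h0" "(t, 0) \<in> D0"
    using rep_exists[OF pq_ab(3)[OF t] chart_at] by blast
  have "pd (1, 0) (bh c h) (t, 0) = pd (1, 0) (bh ?c h0) (t, 0)"
    using DERIV_unique[OF bterm_deriv[OF rep z t] bterm_deriv[OF r0 t]] .
  moreover have "pd (0, 1) (pd (0, 1) (\<lambda>z. sqrt (Fh c h z))) (t, 0) = pd (0, 1) (pd (0, 1) (\<lambda>z. sqrt (Fh ?c h0 z))) (t, 0)"
  proof (rule pd_pd_cong)
    let ?D = "(D \<inter> D0) \<inter> {p<..<q} \<times> {-\<epsilon><..<\<epsilon>}"
    show "open ?D" using repD(2)[OF rep] repD(2)[OF r0(1)] by (intro open_Int open_Times) auto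
    show "(t, 0) \<in> ?D" using z r0(2) t eps by auto
    show "sqrt (Fh c h y) = sqrt (Fh ?c h0 y)" if y: "y \<in> ?D" for y
    proof -
      obtain t' s' where "y = (t', s')" by (cases y)
      then show ?thesis using y Fh_eq[OF rep, of t' s'] Fh_eq[OF r0(1), of t' s'] by auto
    qed
  qed
  ultimately show ?thesis using second_variation_chart_at[OF r0 t] by simp
qed

end

end

lemma has_second_deriv_unique:
  assumes "has_second_deriv f d x" "has_second_deriv f d' x" shows "d = d'"
proof -
  obtain g g' where g: "\<forall>\<^sub>F s in nhds x. (f has_real_derivative g s) (at s)" "(g has_real_derivative d) (at x)"
    and g': "\<forall>\<^sub>F s in nhds x. (f has_real_derivative g' s) (at s)" "(g' has_real_derivative d') (at x)"
    using assms unfolding has_second_deriv_def by blast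
  have "\<forall>\<^sub>F s in nhds x. g s = g' s"
    using eventually_conj[OF g(1) g'(1)] by eventually_elim (blast dest: DERIV_unique)
  then have "(g has_real_derivative d') (at x)"
    using g'(2) by (simp add: DERIV_cong_ev)
  with g(2) show ?thesis by (rule DERIV_unique)
qed

section \<open>Common refinements of partitions and sums of fields along the curve\<close>

lemma partition_find:
  assumes "partition a b k ts" "a \<le> x" "x < b"
  obtains i where "i < k" "ts i \<le> x" "x < ts (Suc i)"
proof -
  have ex: "x < ts k" using assms by (simp add: partition_def)
  define j where "j = (LEAST j. x < ts j)"
  have j: "x < ts j" "j \<le> k" using LeastI[of "\<lambda>j. x < ts j", OF ex] Least_le[of "\<lambda>j. x < ts j", OF ex] by (auto simp: j_def)
  have "j \<noteq> 0"
  proof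
    assume "j = 0"
    then show False using j(1) assms by (simp add: partition_def)
  qed
  then obtain i where i: "j = Suc i" by (cases j) auto
  have "\<not> x < ts i" using not_less_Least[of i "\<lambda>j. x < ts j"] i by (simp add: j_def)
  then show ?thesis using that[of i] j i by auto
qed

text \<open>The sorted elements of \<open>F\<close> serve as break points, so none of them lies
  strictly inside an interval. With \<open>F\<close> the union of the break points of two
  partitions, this is a common refinement.\<close>

lemma partition_of_set:
  assumes F: "finite F" "a \<in> F" "b \<in> F" "F \<subseteq> {a..b}" and ab: "a < (b::real)"
  obtains k ts where "partition a b k ts" "\<And>j y. j < k \<Longrightarrow> y \<in> F \<Longrightarrow> y \<le> ts j \<or> ts (Suc j) \<le> y"
proof -
  define L where "L = sorted_list_of_set F"
  have L: "set L = F" "sorted L" "distinct L" using F by (auto simp: L_def)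
  have len: "length L > 0" using L(1) F(2) by (cases L) auto
  have mono: "L ! i \<le> L ! j" if "i \<le> j" "j < length L" for i j
    using sorted_nth_mono[OF L(2) that] .
  have a0: "L ! 0 = a"
  proof -
    obtain i where "i < length L" "L ! i = a" using F(2) L(1) by (metis in_set_conv_nth)
    then have "L ! 0 \<le> a" using mono[of 0 i] by simp
    moreover have "L ! 0 \<in> F" using L(1) len nth_mem by blast
    ultimately show ?thesis using F(4) by force
  qed
  have b0: "L ! (length L - 1) = b"
  proof -
    obtain i where "i < length L" "L ! i = b" using F(3) L(1) by (metis in_set_conv_nth)
    then have "b \<le> L ! (length L - 1)" using mono[of i "length L - 1"] by simp
    moreover have "L ! (length L - 1) \<in> F" using L(1) len nth_mem[of "length L - 1" L] by simp
    ultimately show ?thesis using F(4) by force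
  qed
  have st: "L ! j < L ! Suc j" if "j < length L - 1" for j
  proof -
    have "j < length L" "Suc j < length L" using that by auto
    then show ?thesis
      using mono[of j "Suc j"] nth_eq_iff_index_eq[OF L(3), of j "Suc j"] by (simp add: order_less_le)
  qed
  show ?thesis
  proof (rule that[of "length L - 1" "\<lambda>j. L ! j"])
    show "partition a b (length L - 1) ((!) L)" using a0 b0 st by (simp add: partition_def)
    fix j y assume j: "j < length L - 1" and y: "y \<in> F"
    obtain i where i: "i < length L" "L ! i = y" using y L(1) by (metis in_set_conv_nth)
    show "y \<le> L ! j \<or> L ! Suc j \<le> y"
      using mono[of i j] mono[of "Suc j" i] i j by (cases "i \<le> j") auto
  qed
qed

lemma smooth_field_along_subset:
  assumes "smooth_field_along A S \<gamma> X" "T \<subseteq> S" shows "smooth_field_along A T \<gamma> X"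
  unfolding smooth_field_along_def
proof (intro conjI ballI impI)
  show "X t \<in> tangent_space A (\<gamma> t)" if "t \<in> T" for t
    using assms that unfolding smooth_field_along_def by blast
  fix t c assume t: "t \<in> T" "c \<in> A" "\<gamma> t \<in> fst c"
  have "t \<in> S" using t(1) assms(2) by blast
  from assms(1)[unfolded smooth_field_along_def, THEN conjunct2, THEN bspec, OF this, THEN bspec, OF t(2), THEN mp, OF t(3)]
  show "\<exists>W h. open W \<and> t \<in> W \<and> \<gamma> ` (W \<inter> T) \<subseteq> fst c \<and> smooth_on W h \<and> (\<forall>w\<in>W \<inter> T. h w = X w c)"
    using assms(2) by (elim exE conjE, intro exI conjI) (assumption | blast)+
qed

lemma (in atlas) smooth_field_along_add:
  assumes X: "smooth_field_along A S \<gamma> X" and Y: "smooth_field_along A S \<gamma> Y"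
  shows "smooth_field_along A S \<gamma> (\<lambda>t. X t + Y t)"
  unfolding smooth_field_along_def
proof (intro conjI ballI impI)
  show "X t + Y t \<in> tangent_space A (\<gamma> t)" if "t \<in> S" for t
    using X Y that unfolding smooth_field_along_def by (blast intro: tangent_add)
  fix t c assume t: "t \<in> S" "c \<in> A" "\<gamma> t \<in> fst c"
  obtain W1 h1 where W1: "open W1" "t \<in> W1" "\<gamma> ` (W1 \<inter> S) \<subseteq> fst c" "smooth_on W1 h1" "\<forall>w\<in>W1 \<inter> S. h1 w = X w c"
    using X[unfolded smooth_field_along_def, THEN conjunct2, THEN bspec, OF t(1), THEN bspec, OF t(2), THEN mp, OF t(3)] by blast
  obtain W2 h2 where W2: "open W2" "t \<in> W2" "\<gamma> ` (W2 \<inter> S) \<subseteq> fst c" "smooth_on W2 h2" "\<forall>w\<in>W2 \<inter> S. h2 w = Y w c"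
    using Y[unfolded smooth_field_along_def, THEN conjunct2, THEN bspec, OF t(1), THEN bspec, OF t(2), THEN mp, OF t(3)] by blast
  have "smooth_on (W1 \<inter> W2) (\<lambda>w. h1 w + h2 w)"
    by (intro smooth_on_add open_Int W1(1) W2(1) smooth_on_subset[OF W1(4)] smooth_on_subset[OF W2(4)]) auto
  moreover have "\<gamma> ` ((W1 \<inter> W2) \<inter> S) \<subseteq> fst c" using W1(3) by blast
  moreover have "\<forall>w\<in>(W1 \<inter> W2) \<inter> S. h1 w + h2 w = (X w + Y w) c" using W1(5) W2(5) by simp
  ultimately show "\<exists>W h. open W \<and> t \<in> W \<and> \<gamma> ` (W \<inter> S) \<subseteq> fst c \<and> smooth_on W h \<and> (\<forall>w\<in>W \<inter> S. h w = (X w + Y w) c)"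
    using W1(1,2) W2(1,2) by (intro exI[of _ "W1 \<inter> W2"] exI[of _ "\<lambda>w. h1 w + h2 w"]) auto
qed

lemma (in atlas) Gamma_tangent_add:
  assumes ab: "a < b" and X: "X \<in> Gamma_tangent A a b \<gamma>" and Y: "Y \<in> Gamma_tangent A a b \<gamma>"
  shows "(\<lambda>t. X t + Y t) \<in> Gamma_tangent A a b \<gamma>"
proof -
  obtain k1 t1 where p1: "partition a b k1 t1" "\<And>j. j < k1 \<Longrightarrow> smooth_field_along A {t1 j..t1 (Suc j)} \<gamma> X"
    using X unfolding Gamma_tangent_def by blast
  obtain k2 t2 where p2: "partition a b k2 t2" "\<And>j. j < k2 \<Longrightarrow> smooth_field_along A {t2 j..t2 (Suc j)} \<gamma> Y"
    using Y unfolding Gamma_tangent_def by blast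
  let ?F = "t1 ` {..k1} \<union> t2 ` {..k2}"
  have ends: "t1 0 = a" "t1 k1 = b" using p1(1) by (auto simp: partition_def)
  have bd: "t1 i \<in> {a..b}" if "i \<le> k1" for i
    using partition_mono[OF p1(1), of 0 i] partition_mono[OF p1(1), of i k1] that ends by auto
  have bd2: "t2 i \<in> {a..b}" if "i \<le> k2" for i
    using partition_mono[OF p2(1), of 0 i] partition_mono[OF p2(1), of i k2] that p2(1) by (auto simp: partition_def)
  have F: "finite ?F" "a \<in> ?F" "b \<in> ?F" "?F \<subseteq> {a..b}" using ends bd bd2 by (auto intro: rev_image_eqI)
  obtain k ts where part: "partition a b k ts" and gap: "\<And>j y. j < k \<Longrightarrow> y \<in> ?F \<Longrightarrow> y \<le> ts j \<or> ts (Suc j) \<le> y"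
    using partition_of_set[OF F ab] by blast
  have "smooth_field_along A {ts j..ts (Suc j)} \<gamma> (\<lambda>t. X t + Y t)" if j: "j < k" for j
  proof (rule smooth_field_along_add)
    note b = partition_bounds[OF part j]
    have lt: "a \<le> ts j" "ts j < b" using b by auto
    obtain i where i: "i < k1" "t1 i \<le> ts j" "ts j < t1 (Suc i)" using partition_find[OF p1(1) lt] .
    have "ts (Suc j) \<le> t1 (Suc i)" using gap[OF j, of "t1 (Suc i)"] i by auto
    then show "smooth_field_along A {ts j..ts (Suc j)} \<gamma> X"
      by (intro smooth_field_along_subset[OF p1(2)[OF i(1)]]) (use i in auto)
    obtain l where l: "l < k2" "t2 l \<le> ts j" "ts j < t2 (Suc l)" using partition_find[OF p2(1) lt] .
    have "ts (Suc j) \<le> t2 (Suc l)" using gap[OF j, of "t2 (Suc l)"] l by auto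
    then show "smooth_field_along A {ts j..ts (Suc j)} \<gamma> Y"
      by (intro smooth_field_along_subset[OF p2(2)[OF l(1)]]) (use l in auto)
  qed
  then show ?thesis using part X Y by (auto simp: Gamma_tangent_def)
qed

section \<open>Second variation over subintervals, and the index form\<close>

context lengthy_geodesic
begin

text \<open>The second variation formula over a subinterval, with boundary terms: \<open>L\<close>
  is the length of that part of \<open>V s\<close> and \<open>L'\<close> its derivative. Velocities
  are taken within \<open>{a..b}\<close> on every subinterval, so that the integrands fit those of
  \<open>curve_length\<close> when intervals are joined.\<close>

definition length_variation_on :: "(real \<Rightarrow> real \<Rightarrow> 'p) \<Rightarrow> (real \<Rightarrow> ('p, 'm) tvec) \<Rightarrow> real \<Rightarrow> real \<Rightarrow> bool"
  where "length_variation_on V X l u \<longleftrightarrow> (\<exists>d>0. \<exists>L L' I.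
    (\<forall>s\<in>{-d<..<d}. ((\<lambda>t. sqrt (gW (V s t) (curve_velocity A {a..b} (V s) t) (curve_velocity A {a..b} (V s) t)))
        has_integral L s) {l..u} \<and> (L has_real_derivative L' s) (at s)) \<and>
    (integrand X X has_integral I) {l..u} \<and>
    (L' has_real_derivative 1 / r * (I + bterm V X u - bterm V X l)) (at 0))"

text \<open>Lengths and integrals add, and the boundary terms at \<open>m\<close> cancel.\<close>

lemma length_variation_on_trans:
  assumes "length_variation_on V X l m" "length_variation_on V X m u" and lmu: "l \<le> m" "m \<le> u" shows "length_variation_on V X l u"
proof -
  let ?f = "\<lambda>s t. sqrt (gW (V s t) (curve_velocity A {a..b} (V s) t) (curve_velocity A {a..b} (V s) t))"
  obtain d1 L1 M1 I1 where 1: "d1 > 0"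
    "\<And>s. s \<in> {-d1<..<d1} \<Longrightarrow> (?f s has_integral L1 s) {l..m} \<and> (L1 has_real_derivative M1 s) (at s)"
    "(integrand X X has_integral I1) {l..m}" "(M1 has_real_derivative 1 / r * (I1 + bterm V X m - bterm V X l)) (at 0)"
    using assms(1) unfolding length_variation_on_def by blast
  obtain d2 L2 M2 I2 where 2: "d2 > 0"
    "\<And>s. s \<in> {-d2<..<d2} \<Longrightarrow> (?f s has_integral L2 s) {m..u} \<and> (L2 has_real_derivative M2 s) (at s)"
    "(integrand X X has_integral I2) {m..u}" "(M2 has_real_derivative 1 / r * (I2 + bterm V X u - bterm V X m)) (at 0)"
    using assms(2) unfolding length_variation_on_def by blast
  have "((\<lambda>s. M1 s + M2 s) has_real_derivative 1 / r * ((I1 + I2) + bterm V X u - bterm V X l)) (at 0)"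
    by (rule DERIV_cong[OF DERIV_add[OF 1(4) 2(4)]]) (simp add: algebra_simps)
  moreover have "(integrand X X has_integral (I1 + I2)) {l..u}"
    by (rule has_integral_combine[OF lmu 1(3) 2(3)])
  moreover have "(?f s has_integral L1 s + L2 s) {l..u} \<and> ((\<lambda>s. L1 s + L2 s) has_real_derivative M1 s + M2 s) (at s)"
    if "s \<in> {- min d1 d2<..<min d1 d2}" for s
  proof -
    have "s \<in> {-d1<..<d1}" "s \<in> {-d2<..<d2}" using that by auto
    with 1(2) 2(2) show ?thesis by (blast intro: has_integral_combine[OF lmu] DERIV_add)
  qed
  ultimately show ?thesis
    unfolding length_variation_on_def using 1(1) 2(1)
    by (intro exI[of _ "min d1 d2"] conjI exI[of _ "\<lambda>s. L1 s + L2 s"] exI[of _ "\<lambda>s. M1 s + M2 s"] exI[of _ "I1 + I2"]) auto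
qed

lemma length_variation_on_refl: "length_variation_on V X l l"
  unfolding length_variation_on_def
  by (intro exI[of _ 1] conjI exI[of _ "\<lambda>s. 0"] exI[of _ 0]) (auto simp: has_integral_refl)

lemma length_variation_on_local:
  assumes eps: "\<epsilon> > 0" and V0: "\<And>t. t \<in> {a..b} \<Longrightarrow> V 0 t = \<gamma> t"
    and VX: "\<And>t. t \<in> {a..b} \<Longrightarrow> curve_velocity A {-\<epsilon><..<\<epsilon>} (\<lambda>s. V s t) 0 = X t"
    and pq: "a \<le> p" "p < q" "q \<le> b"
    and V_smooth: "smooth_map A ({p..q} \<times> {-\<epsilon><..<\<epsilon>}) (\<lambda>(t, s). V s t)"
    and x: "p \<le> x" "x \<le> q"
  shows "\<exists>d>0. \<forall>l u. p \<le> l \<and> l \<le> x \<and> x \<le> u \<and> u \<le> q \<and> u - l < d \<longrightarrow> length_variation_on V X l u"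
proof -
  note ctxt = eps V0 VX pq V_smooth
  have xpq: "x \<in> {p..q}" using x by simp
  obtain c D h where rep: "rep \<epsilon> V p q c D h" and z: "(x, 0) \<in> D"
    using rep_exists[OF ctxt xpq chart_at] by blast
  let ?F = "Fh c h" and ?b = "bh c h"
  note Fh' = Fh_def[OF ctxt rep] and rD = repD[OF ctxt rep]
  note sm = rep_smooth[OF ctxt rep]
  let ?D = "D \<inter> ?F -` {0<..}"
  have oD: "open ?D"
    by (rule continuous_open_preimage[OF smooth_on_continuous_on[OF sm(1)] rD(2) open_greaterThan])
  have "(x, 0) \<in> ?D" using z Fh_0[OF ctxt rep z xpq] r_pos by simp
  then obtain T S where TS: "open T" "open S" "(x, 0) \<in> T \<times> S" "T \<times> S \<subseteq> ?D"
    using open_prod_elim[OF oD] by blast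
  obtain d1 where d1: "d1 > 0" "ball x d1 \<subseteq> T" using TS open_contains_ball by blast
  obtain d2 where d2: "d2 > 0" "ball 0 d2 \<subseteq> S" using TS open_contains_ball by blast
  define d where "d = min d2 \<epsilon>"
  have d: "d > 0" using d2 eps by (simp add: d_def)
  have "length_variation_on V X l u" if lu: "p \<le> l" "l \<le> x" "x \<le> u" "u \<le> q" "u - l < d1" for l u
  proof (cases "l = u")
    case True then show ?thesis by (simp add: length_variation_on_refl)
  next
    case False
    then have lt: "l < u" using lu by simp
    have sub: "{l..u} \<times> {-d<..<d} \<subseteq> ?D"
    proof -
      have "{l..u} \<subseteq> T" using d1(2) lu by (force simp: subset_iff dist_real_def)
      moreover have "{-d<..<d} \<subseteq> S" using d2(2) by (force simp: d_def subset_iff dist_real_def)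
      ultimately show ?thesis using TS(4) by blast
    qed
    define H where "H z = sqrt (?F z)" for z
    have Hs: "smooth_on ?D H"
      unfolding H_def by (rule smooth_on_sqrt[OF oD _ smooth_on_subset[OF sm(1)]]) auto
    define L where "L s = integral {l..u} (\<lambda>t. H (t, s))" for s
    define M where "M s = integral {l..u} (\<lambda>t. pd (0, 1) H (t, s))" for s
    define K where "K t = pd (0, 1) (pd (0, 1) H) (t, 0)" for t
    have d0: "0 \<in> {-d<..<d}" using d by simp
    have L: "(L has_real_derivative M s) (at s)" if "s \<in> {-d<..<d}" for s
      unfolding L_def[abs_def] M_def by (rule leibniz_smooth(2)[OF Hs sub that])
    have M: "(M has_real_derivative integral {l..u} K) (at 0)"
      unfolding M_def[abs_def] K_def[abs_def] by (rule leibniz_smooth(2)[OF smooth_on_frechet[OF Hs] sub d0])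
    have Kint: "(K has_integral integral {l..u} K) {l..u}"
      unfolding K_def[abs_def]
      by (rule integrable_integral[OF leibniz_smooth(1)[OF smooth_on_frechet[OF smooth_on_frechet[OF Hs]] sub d0]])
    have inner: "t \<in> {p<..<q}" if "t \<in> {l<..<u}" for t using that lu by auto
    \<comment> \<open>The representation in the chart gives the speed only inside the piece; the end
      points of the interval are negligible for the integral.\<close>
    have f: "((\<lambda>t. sqrt (gW (V s t) (curve_velocity A {a..b} (V s) t) (curve_velocity A {a..b} (V s) t)))
        has_integral L s) {l..u}" if s: "s \<in> {-d<..<d}" for s
    proof (rule has_integral_spike_finite[of "{l, u}"])
      show "((\<lambda>t. H (t, s)) has_integral L s) {l..u}"
        unfolding L_def by (rule integrable_integral[OF leibniz_smooth(1)[OF Hs sub s]])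
      fix t assume t: "t \<in> {l..u} - {l, u}"
      then have "t \<in> {l<..<u}" by auto
      then have "t \<in> {p<..<q}" "(t, s) \<in> D" "s \<in> {-\<epsilon><..<\<epsilon>}"
        using inner t sub s by (auto simp: d_def)
      then show "sqrt (gW (V s t) (curve_velocity A {a..b} (V s) t) (curve_velocity A {a..b} (V s) t)) = H (t, s)"
        using Fh_eq[OF ctxt rep] by (simp add: H_def)
    qed simp
    have lD: "(t, 0) \<in> D" if "t \<in> {l..u}" for t using sub that d0 by blast
    have bt: "bterm V X t = ?b (t, 0)" if "t \<in> {l..u}" for t
      by (rule bterm_rep[OF ctxt rep lD[OF that]]) (use that lu in auto)
    have B: "((\<lambda>t. pd (1, 0) ?b (t, 0)) has_integral bterm V X u - bterm V X l) {l..u}"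
    proof (rule fundamental_theorem_of_calculus_interior)
      have "continuous_on {l..u} (\<lambda>t. ?b (t, 0))"
        by (intro continuous_on_compose2[OF smooth_on_continuous_on[OF sm(2)]] continuous_intros) (use lD in auto)
      then show "continuous_on {l..u} (bterm V X)" by (rule continuous_on_eq) (simp add: bt)
      show "(bterm V X has_vector_derivative pd (1, 0) ?b (t, 0)) (at t)" if "t \<in> {l<..<u}" for t
        using bterm_deriv[OF ctxt rep lD inner[OF that]] that by (simp add: has_real_derivative_iff_has_vector_derivative)
    qed (use lt in simp)
    \<comment> \<open>Solving the pointwise formula for the integrand yields its integrability
      together with its integral.\<close>
    have Q: "(integrand X X has_integral (r * integral {l..u} K - (bterm V X u - bterm V X l))) {l..u}"
    proof (rule has_integral_spike_finite[of "{l, u}"])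
      show "((\<lambda>t. r * K t - pd (1, 0) ?b (t, 0)) has_integral (r * integral {l..u} K - (bterm V X u - bterm V X l))) {l..u}"
        by (intro has_integral_diff has_integral_mult_right Kint B)
      fix t assume "t \<in> {l..u} - {l, u}"
      then have t: "t \<in> {l<..<u}" by auto
      have "K t = 1 / r * (pd (1, 0) ?b (t, 0) + integrand X X t)"
        unfolding K_def H_def[abs_def]
        by (rule second_variation_rep[OF ctxt rep lD inner[OF t]]) (use t in auto)
      then show "integrand X X t = r * K t - pd (1, 0) ?b (t, 0)" using r_pos by (simp add: field_simps)
    qed simp
    have "(M has_real_derivative 1 / r * ((r * integral {l..u} K - (bterm V X u - bterm V X l)) + bterm V X u - bterm V X l)) (at 0)"
      using M r_pos by simp
    with L f Q d show ?thesis unfolding length_variation_on_def by blast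
  qed
  then show ?thesis using d1(1) by blast
qed

lemma second_variation:
  assumes V: "variation A a b \<gamma> X \<epsilon> V" and X: "X a = 0" "X b = 0"
  shows "\<exists>I. (integrand X X has_integral I) {a..b} \<and> has_second_deriv (\<lambda>s. curve_length A gW a b (V s)) (I / r) 0"
proof -
  have eps: "\<epsilon> > 0" and V0: "\<And>t. t \<in> {a..b} \<Longrightarrow> V 0 t = \<gamma> t"
    and VX: "\<And>t. t \<in> {a..b} \<Longrightarrow> curve_velocity A {-\<epsilon><..<\<epsilon>} (\<lambda>s. V s t) 0 = X t"
    and ends: "\<And>s. s \<in> {-\<epsilon><..<\<epsilon>} \<Longrightarrow> V s a = \<gamma> a \<and> V s b = \<gamma> b"
    using V unfolding variation_def by blast+
  obtain k ts where part: "partition a b k ts"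
    and sm: "\<And>j. j < k \<Longrightarrow> smooth_map A ({ts j..ts (Suc j)} \<times> {-\<epsilon><..<\<epsilon>}) (\<lambda>(t, s). V s t)"
    using V unfolding variation_def by blast
  have var_ab: "length_variation_on V X a b"
  proof (rule partition_additive[OF part ab, where P="length_variation_on V X"])
    show "length_variation_on V X l u" if "length_variation_on V X l m" "length_variation_on V X m u" "l \<le> m" "m \<le> u" for l m u
      by (rule length_variation_on_trans[OF that])
    show "\<exists>d>0. \<forall>l u. ts j \<le> l \<and> l \<le> x \<and> x \<le> u \<and> u \<le> ts (Suc j) \<and> u - l < d \<longrightarrow> length_variation_on V X l u"
      if "j < k" "ts j \<le> x" "x \<le> ts (Suc j)" for j x
      by (rule length_variation_on_local[OF eps V0 VX partition_bounds[OF part that(1)] sm[OF that(1)] that(2,3)])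
  qed
  \<comment> \<open>Where the variation is fixed, the coordinates of \<open>V s t\<close> are
    constant in \<open>s\<close> and \<open>X t\<close> is zero, so both terms of \<open>acc\<close>
    vanish.\<close>
  have "bterm V X t = 0" if t: "X t = 0" "\<And>s. s \<in> {-\<epsilon><..<\<epsilon>} \<Longrightarrow> V s t = \<gamma> t" for t
  proof -
    let ?c = "chart_at A (\<gamma> t)"
    note c = chart_at[of "\<gamma> t"]
    have "pd 1 (pd 1 (\<lambda>s. snd ?c (V s t))) 0 = pd 1 (pd 1 (\<lambda>s::real. snd ?c (\<gamma> t))) 0"
      by (rule pd_pd_cong[of "{-\<epsilon><..<\<epsilon>}"]) (use t(2) eps in auto)
    also have "\<dots> = 0" by (simp add: frechet_eqI[OF has_derivative_const])
    finally show ?thesis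
      using bilinear_lzero[OF Chr_bilinear[OF c(1) snd_in[OF c(2)]]] bilinear_lzero[OF Gc_bilinear[OF c(1) snd_in[OF c(2)]]]
      by (simp add: bterm_def acc_def Let_def t(1))
  qed
  then have b0: "bterm V X a = 0" "bterm V X b = 0" using X ends by auto
  obtain d L L' I where d: "d > 0"
    and L: "\<And>s. s \<in> {-d<..<d} \<Longrightarrow> ((\<lambda>t. sqrt (gW (V s t) (curve_velocity A {a..b} (V s) t) (curve_velocity A {a..b} (V s) t)))
        has_integral L s) {a..b} \<and> (L has_real_derivative L' s) (at s)"
    and I: "(integrand X X has_integral I) {a..b}" "(L' has_real_derivative 1 / r * (I + bterm V X b - bterm V X a)) (at 0)"
    using var_ab unfolding length_variation_on_def by blast
  have I2: "(L' has_real_derivative I / r) (at 0)" using I(2) by (simp add: b0)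
  have len: "curve_length A gW a b (V s) = L s" if "s \<in> {-d<..<d}" for s
    using L[OF that] by (simp add: curve_length_def integral_unique)
  have "((\<lambda>s. curve_length A gW a b (V s)) has_real_derivative L' s) (at s)" if s: "s \<in> {-d<..<d}" for s
    by (rule has_field_derivative_transform_within_open[OF conjunct2[OF L[OF s]] open_greaterThanLessThan s]) (simp add: len)
  then have "\<forall>\<^sub>F s in nhds 0. ((\<lambda>s. curve_length A gW a b (V s)) has_real_derivative L' s) (at s)"
    using d by (intro eventually_nhds_in_open[THEN eventually_mono, of "{-d<..<d}"]) auto
  then show ?thesis using I(1) I2 unfolding has_second_deriv_def by blast
qed

text \<open>A variation exists, every variation has the second derivative given by
  \<open>second_variation\<close>, and second derivatives are unique. These are the three facts that
  the definite description needs.\<close>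

lemma index_quad_eq:
  assumes X: "X \<in> Gamma_tangent A a b \<gamma>"
  shows "integrand X X integrable_on {a..b}"
    "index_quad A gW a b \<gamma> X = integral {a..b} (integrand X X) / r"
proof -
  have X0: "X a = 0" "X b = 0" using X by (auto simp: Gamma_tangent_def)
  obtain \<epsilon> V where V: "variation A a b \<gamma> X \<epsilon> V"
    using variation_exists[OF ab gamma_smooth X] by blast
  note sv = second_variation[OF _ X0]
  show int: "integrand X X integrable_on {a..b}" using sv[OF V] by blast
  let ?I = "integral {a..b} (integrand X X)"
  have sd: "has_second_deriv (\<lambda>s. curve_length A gW a b (V s)) (?I / r) 0" if "variation A a b \<gamma> X \<epsilon> V" for \<epsilon> V
    using sv[OF that] integral_unique by blast
  show "index_quad A gW a b \<gamma> X = ?I / r"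
    unfolding index_quad_def
    by (rule the_equality) (use V sd has_second_deriv_unique in blast)+
qed

lemma loc_rep_exists:
  assumes t: "t \<in> {a<..<b}" shows "\<exists>W x. loc_rep t W x"
proof -
  have "t \<in> {a..b}" using t by simp
  from gamma_smooth[unfolded smooth_map_def, THEN bspec, OF this, THEN bspec, OF chart_at(1), THEN mp, OF chart_at(2)]
  obtain W x where W: "open W" "t \<in> W" "\<gamma> ` (W \<inter> {a..b}) \<subseteq> fst (chart_at A (\<gamma> t))" "smooth_on W x"
    "\<forall>w\<in>W \<inter> {a..b}. x w = snd (chart_at A (\<gamma> t)) (\<gamma> w)" by blast
  have "loc_rep t (W \<inter> {a<..<b}) x"
    unfolding loc_rep_def using W t by (auto intro: smooth_on_subset[OF W(4)])
  then show ?thesis by blast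
qed

text \<open>Away from its break points the field is smooth on both sides, and a finite exceptional
  set does not affect the integrals.\<close>

lemma field_rep_exists:
  assumes X: "X \<in> Gamma_tangent A a b \<gamma>"
  shows "\<exists>N. finite N \<and> (\<forall>t\<in>{a..b} - N. \<exists>W \<xi>. open W \<and> t \<in> W \<and> field_rep t W X \<xi>)"
proof -
  obtain k ts where p: "partition a b k ts" "\<And>j. j < k \<Longrightarrow> smooth_field_along A {ts j..ts (Suc j)} \<gamma> X"
    using X unfolding Gamma_tangent_def by blast
  have "\<exists>W \<xi>. open W \<and> t \<in> W \<and> field_rep t W X \<xi>" if t: "t \<in> {a..b} - ts ` {..k}" for t
  proof -
    have "t \<noteq> b" using t p(1) by (auto simp: partition_def)
    then have "a \<le> t" "t < b" using t by auto
    then obtain i where i: "i < k" "ts i \<le> t" "t < ts (Suc i)" by (rule partition_find[OF p(1)])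
    have ti: "t \<in> {ts i<..<ts (Suc i)}" using i t by (auto simp: less_le)
    then have ti': "t \<in> {ts i..ts (Suc i)}" by simp
    note S = p(2)[OF i(1), unfolded smooth_field_along_def]
    from S[THEN conjunct2, THEN bspec, OF ti', THEN bspec, OF chart_at(1), THEN mp, OF chart_at(2)]
    obtain W h where W: "open W" "t \<in> W" "smooth_on W h" "\<forall>w\<in>W \<inter> {ts i..ts (Suc i)}. h w = X w (chart_at A (\<gamma> t))" by blast
    have "field_rep t (W \<inter> {ts i<..<ts (Suc i)}) X h"
      unfolding field_rep_def
    proof (intro conjI ballI)
      show "smooth_on (W \<inter> {ts i<..<ts (Suc i)}) h" by (rule smooth_on_subset[OF W(3)]) blast
      fix s assume s: "s \<in> W \<inter> {ts i<..<ts (Suc i)}"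
      then have s': "s \<in> W \<inter> {ts i..ts (Suc i)}" by auto
      show "h s = X s (chart_at A (\<gamma> t))" by (rule W(4)[THEN bspec, OF s'])
      show "X s \<in> TM (\<gamma> s)" by (rule S[THEN conjunct1, THEN bspec]) (use s' in blast)
    qed
    moreover have "open (W \<inter> {ts i<..<ts (Suc i)})" by (intro open_Int W(1) open_greaterThanLessThan)
    ultimately show ?thesis using W(2) ti by (intro exI conjI) (assumption | rule IntI)+
  qed
  then show ?thesis by (intro exI[of _ "ts ` {..k}"]) auto
qed

lemma rep_restrict:
  assumes "open W'" "t \<in> W'"
  shows "loc_rep t W x \<Longrightarrow> loc_rep t (W \<inter> W') x" and "field_rep t W X \<xi> \<Longrightarrow> field_rep t (W' \<inter> W) X \<xi>"
    "field_rep t W X \<xi> \<Longrightarrow> field_rep t (W \<inter> W') X \<xi>"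
  using assms smooth_on_subset[of W _ "W \<inter> W'"] smooth_on_subset[of W _ "W' \<inter> W"]
  by (auto simp: loc_rep_def field_rep_def)

theorem index_form_eq:
  assumes X: "X \<in> Gamma_tangent A a b \<gamma>" and Y: "Y \<in> Gamma_tangent A a b \<gamma>"
  shows "index_form A gW a b \<gamma> X Y = 1 / r * integral {a..b} (integrand X Y)"
proof -
  let ?Z = "\<lambda>t. X t + Y t"
  have Z: "?Z \<in> Gamma_tangent A a b \<gamma>" by (rule Gamma_tangent_add[OF ab X Y])
  obtain N1 where N1: "finite N1" "\<And>t. t \<in> {a..b} - N1 \<Longrightarrow> \<exists>W \<xi>. open W \<and> t \<in> W \<and> field_rep t W X \<xi>"
    using field_rep_exists[OF X] by blast
  obtain N2 where N2: "finite N2" "\<And>t. t \<in> {a..b} - N2 \<Longrightarrow> \<exists>W \<xi>. open W \<and> t \<in> W \<and> field_rep t W Y \<xi>"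
    using field_rep_exists[OF Y] by blast
  \<comment> \<open>The points at which a local representation may be missing: the break points of
    both fields and the ends of the interval.\<close>
  let ?N = "N1 \<union> N2 \<union> {a, b}"
  have "((\<lambda>t. 1 / 2 * (integrand ?Z ?Z t - integrand X X t - integrand Y Y t)) has_integral
      1 / 2 * (integral {a..b} (integrand ?Z ?Z) - integral {a..b} (integrand X X) - integral {a..b} (integrand Y Y))) {a..b}"
    by (rule has_integral_mult_right[OF has_integral_diff[OF has_integral_diff[OF
            integrable_integral[OF index_quad_eq(1)[OF Z]] integrable_integral[OF index_quad_eq(1)[OF X]]]
            integrable_integral[OF index_quad_eq(1)[OF Y]]]])
  then have "(integrand X Y has_integral
      1 / 2 * (integral {a..b} (integrand ?Z ?Z) - integral {a..b} (integrand X X) - integral {a..b} (integrand Y Y))) {a..b}"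
  proof (rule has_integral_spike_finite[rotated 2, where S="?N"])
    show "finite ?N" using N1 N2 by simp
    fix t assume t: "t \<in> {a..b} - ?N"
    obtain W0 x where W0: "loc_rep t W0 x" using loc_rep_exists[of t] t by auto
    obtain W1 \<xi> where W1: "open W1" "t \<in> W1" "field_rep t W1 X \<xi>" using N1(2)[of t] t by auto
    obtain W2 \<eta> where W2: "open W2" "t \<in> W2" "field_rep t W2 Y \<eta>" using N2(2)[of t] t by auto
    have o0: "open W0" "t \<in> W0" using W0 by (auto simp: loc_rep_def)
    have o12: "open (W1 \<inter> W2)" "t \<in> W1 \<inter> W2" using W1 W2 by auto
    have "integrand ?Z ?Z t - integrand X X t - integrand Y Y t = 2 * integrand X Y t"
      by (rule integrand_polar[OF rep_restrict(1)[OF o12 W0]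
            rep_restrict(2)[OF o0 rep_restrict(3)[OF W2(1,2) W1(3)]]
            rep_restrict(2)[OF o0 rep_restrict(2)[OF W1(1,2) W2(3)]]])
    then show "integrand X Y t = 1 / 2 * (integrand ?Z ?Z t - integrand X X t - integrand Y Y t)" by simp
  qed
  then show ?thesis
    by (simp add: index_form_def index_quad_eq(2) X Y Z integral_unique diff_divide_distrib)
qed

end

lemma (in sasaki) levi_trivial:
  assumes "n = 0" "v \<in> levi T10 p" shows "v = 0"
proof -
  obtain V F where F: "p \<in> V" "\<And>q. q \<in> V \<Longrightarrow> T10 q = {\<Sum>i<n. cscale (a i) (F i q) | a. True}"
    by (rule T10_frame[of p]) (rule that)
  have "T10 p = {0}" unfolding F(2)[OF F(1)] assms(1) by simp
  then show ?thesis using assms(2) by (simp add: levi_re cvec_simps)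
qed

theorem theorem11:
  fixes A :: "('p::{t2_space, second_countable_topology}, 'm::finite) chart set"
    and n :: nat
    and T10 :: "'p \<Rightarrow> ('p, 'm) ctvec set"
    and \<theta> :: "'p \<Rightarrow> ('p, 'm) tvec \<Rightarrow> real"
    and nabla :: "('p, 'm) connection"
    and y z :: 'p and a b r :: real
    and \<gamma> :: "real \<Rightarrow> 'p" and X Y :: "real \<Rightarrow> ('p, 'm) tvec"
  assumes "sasakian A n T10 \<theta> nabla"
    and "a < b"
    and "\<gamma> \<in> Gamma_curves A (webster_metric A T10 \<theta>) a b y z"
    and "geodesic A nabla a b \<gamma>"
    and "lengthy A T10 a b \<gamma>"
    and "r > 0"
    and "\<forall>t\<in>{a..b}. sqrt (webster_metric A T10 \<theta> (\<gamma> t)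
           (curve_velocity A {a..b} \<gamma> t) (curve_velocity A {a..b} \<gamma> t)) = r"
    and "X \<in> Gamma_tangent A a b \<gamma>"
    and "Y \<in> Gamma_tangent A a b \<gamma>"
  shows "(let g = webster_metric A T10 \<theta>;
              \<Omega> = Omega_form A T10 \<theta>;
              R = curvature A nabla;
              \<gamma>' = curve_velocity A {a..b} \<gamma>;
              X' = perp A g a b \<gamma> r X;
              Y' = perp A g a b \<gamma> r Y;
              DX' = cov_deriv A nabla {a..b} \<gamma> X';
              DY' = cov_deriv A nabla {a..b} \<gamma> Y'
          in index_form A g a b \<gamma> X Y = 1 / r * integral {a..b} (\<lambda>t.
               g (\<gamma> t) (DX' t) (DY' t)
               - g (\<gamma> t) (R (\<gamma> t) (X' t) (\<gamma>' t) (\<gamma>' t)) (Y' t)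
               - 2 * \<Omega> (\<gamma> t) (X' t) (\<gamma>' t) * \<theta> (\<gamma> t) (DY' t)
               - 2 * (\<theta> (\<gamma> t) (DX' t) - 2 * \<Omega> (\<gamma> t) (X' t) (\<gamma>' t)) * \<Omega> (\<gamma> t) (Y' t) (\<gamma>' t)))"
proof -
  interpret S: sasaki A n T10 \<theta> nabla by unfold_locales (fact assms(1))
  let ?v = "curve_velocity A {a..b} \<gamma>"
  have lev: "?v t \<in> levi T10 (\<gamma> t)" if "t \<in> {a..b}" for t
    using assms(5) that by (simp add: lengthy_def)
  have sp: "webster_metric A T10 \<theta> (\<gamma> t) (?v t) (?v t) = r\<^sup>2" if "t \<in> {a..b}" for t
    using assms(6,7) that by (metis real_sqrt_gt_0_iff real_sqrt_pow2 less_imp_le)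
  \<comment> \<open>For n = 0 the Levi distribution is zero, so a lengthy curve would have speed 0
    instead of \<open>r\<close>.\<close>
  have "n \<noteq> 0"
  proof
    assume "n = 0"
    then have "?v a = 0" using S.levi_trivial lev[of a] assms(2) by auto
    moreover have "webster_metric A T10 \<theta> (\<gamma> a) 0 0 = 0"
      using S.gW_scaleR(1)[OF S.tangent_0 S.tangent_0, of "\<gamma> a" 0] by simp
    ultimately show False using sp[of a] assms(2,6) by simp
  qed
  then interpret L: lengthy_geodesic A n T10 \<theta> nabla a b r \<gamma>
    by unfold_locales (use assms lev sp in \<open>auto simp: geodesic_def\<close>)
  show ?thesis
    using L.index_form_eq[OF assms(8,9)] unfolding L.integrand_def[abs_def] Let_def .
qed

end
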